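(* Let $k$ be a finite field, let $A$ be a finite-dimensional tame hereditary $k$-algebra and let $\overline{A}$ be the duplicated algebra of $A$. Then $$\mathscr{H}(\overline{A})=\mathscr{H}(A_0)\,\mathscr{H}(A_{01})\,\mathscr{H}(A_1),$$ where the right-hand side is the additive subgroup of the Ringel-Hall algebra $\mathscr{H}(\overline{A})$ generated by all products $xyz$ with $x\in\mathscr{H}(A_0)$, $y\in\mathscr{H}(A_{01})$, $z\in\mathscr{H}(A_1)$.
   Context: All modules are finitely generated. The duplicated algebra is the matrix algebra $\overline{A}=\begin{pmatrix}A&0\\ DA&A\end{pmatrix}$ with $DA=\mathrm{Hom}_k(A,k)$. It contains two copies of $A$: $A_0=A=e\overline{A}e$ and $A_1=A'=e'\overline{A}e'$, where $e,e'$ are the diagonal idempotents (first and second entry). Convention: an $\overline{A}$-module is a triple $(X,Y,\varphi)$ with $X$ an $A_0$-module, $Y$ an $A_1$-module and $\varphi: DA\otimes_A Y\to X$ an $A$-linear map; thus each $\overline{A}$-module has an $A_0$-submodule $X$ with quotient the $A_1$-module $Y$. $A_0$-modules and $A_1$-modules are regarded as $\overline{A}$-modules in the obvious way. For finite modules $M,N_1,N_2$ let $G^M_{N_1N_2}$ be the number of submodules $L\subseteq M$ with $L\simeq N_2$ and $M/L\simeq N_1$. The Ringel-Hall algebra $\mathscr{H}(\overline{A})$ is the free abelian group with basis $u_{[M]}$ indexed by isomorphism classes of finite $\overline{A}$-modules, with multiplication $u_{[N_1]}u_{[N_2]}=\sum_{[M]}G^M_{N_1N_2}u_{[M]}$.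 $A_{01}$-ind is the class of indecomposable $\overline{A}$-modules having both a simple $A_0$-module and a simple $A_1$-module among their composition factors; $\mathrm{add}(A_{01}\text{-ind})$ is the class of direct summands of finite direct sums of such modules, an exact category closed under extensions. $\mathscr{H}(A_0)$, $\mathscr{H}(A_1)$, $\mathscr{H}(A_{01})$ are the subalgebras of $\mathscr{H}(\overline{A})$ with $\mathbf{Z}$-bases the $u_{[M]}$ with $M$ an $A_0$-module, an $A_1$-module, or an object of $\mathrm{add}(A_{01}\text{-ind})$, respectively. *)

theory Defs
  imports "HOL-Algebra.Module" "HOL-Algebra.AbelCoset" "HOL-Algebra.Generated_Groups"
    "HOL-Algebra.Free_Abelian_Groups"
begin

section \<open>Right modules\<close>

text \<open>
  All modules are right modules. They are stored in the record type of \<^theory>\<open>HOL-Algebra.Module\<close>: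
  the field \<open>smult\<close> is the action, with \<open>r \<odot>\<^bsub>M\<^esub> x\<close> standing for \<open>x r\<close> (note the order of the
  factors in \<open>act_assoc\<close>). The fields \<open>mult\<close> and \<open>one\<close> carry no meaning for a module and are
  ignored, except in the algebra \<open>A\<close> below, which is a \<open>module\<close> record over \<open>K\<close> that is also a ring.
\<close>

locale right_module = R?: ring R + M?: abelian_group M
  for R :: "('r, 's) ring_scheme" (structure) and M :: "('r, 'm) module" (structure) +
  assumes act_closed:
      "\<lbrakk>r \<in> carrier R; x \<in> carrier M\<rbrakk> \<Longrightarrow> r \<odot>\<^bsub>M\<^esub> x \<in> carrier M"
    and act_add_scalar:
      "\<lbrakk>r \<in> carrier R; s \<in> carrier R; x \<in> carrier M\<rbrakk> \<Longrightarrow>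
        (r \<oplus> s) \<odot>\<^bsub>M\<^esub> x = r \<odot>\<^bsub>M\<^esub> x \<oplus>\<^bsub>M\<^esub> s \<odot>\<^bsub>M\<^esub> x"
    and act_add:
      "\<lbrakk>r \<in> carrier R; x \<in> carrier M; y \<in> carrier M\<rbrakk> \<Longrightarrow>
        r \<odot>\<^bsub>M\<^esub> (x \<oplus>\<^bsub>M\<^esub> y) = r \<odot>\<^bsub>M\<^esub> x \<oplus>\<^bsub>M\<^esub> r \<odot>\<^bsub>M\<^esub> y"
    and act_assoc:
      "\<lbrakk>r \<in> carrier R; s \<in> carrier R; x \<in> carrier M\<rbrakk> \<Longrightarrow>
        (r \<otimes> s) \<odot>\<^bsub>M\<^esub> x = s \<odot>\<^bsub>M\<^esub> (r \<odot>\<^bsub>M\<^esub> x)"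
    and act_one:
      "x \<in> carrier M \<Longrightarrow> \<one> \<odot>\<^bsub>M\<^esub> x = x"

definition mod_hom ::
  "('r, 's) ring_scheme \<Rightarrow> ('r, 'm) module \<Rightarrow> ('r, 'n) module \<Rightarrow> ('m \<Rightarrow> 'n) set" where
  "mod_hom R M N = {f \<in> carrier M \<rightarrow>\<^sub>E carrier N.
     (\<forall>x\<in>carrier M. \<forall>y\<in>carrier M. f (x \<oplus>\<^bsub>M\<^esub> y) = f x \<oplus>\<^bsub>N\<^esub> f y) \<and>
     (\<forall>r\<in>carrier R. \<forall>x\<in>carrier M. f (r \<odot>\<^bsub>M\<^esub> x) = r \<odot>\<^bsub>N\<^esub> f x)}"

definition mod_iso :: "('r, 's) ring_scheme \<Rightarrow> ('r, 'm) module \<Rightarrow> ('r, 'n) module \<Rightarrow> bool" where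
  "mod_iso R M N \<longleftrightarrow> (\<exists>f\<in>mod_hom R M N. bij_betw f (carrier M) (carrier N))"

text \<open>Submodules are those of the library (\<^const>\<open>submodule\<close>).\<close>

definition sub_mod :: "('r, 'm) module \<Rightarrow> 'm set \<Rightarrow> ('r, 'm) module" where
  "sub_mod M L = M\<lparr>carrier := L\<rparr>"

definition quot_mod :: "('r, 'm) module \<Rightarrow> 'm set \<Rightarrow> ('r, 'm set) module" where
  "quot_mod M L = \<lparr>carrier = a_rcosets\<^bsub>M\<^esub> L, monoid.mult = undefined, one = undefined,
     ring.zero = L, ring.add = set_add M, smult = (\<lambda>r C. set_add M L ((\<lambda>x. r \<odot>\<^bsub>M\<^esub> x) ` C))\<rparr>"

definition direct_sum :: "'i set \<Rightarrow> ('i \<Rightarrow> ('r, 'm) module) \<Rightarrow> ('r, 'i \<Rightarrow> 'm) module" where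
  "direct_sum I M = \<lparr>carrier = (\<Pi>\<^sub>E i\<in>I. carrier (M i)), monoid.mult = undefined, one = undefined,
     ring.zero = (\<lambda>i\<in>I. \<zero>\<^bsub>M i\<^esub>), ring.add = (\<lambda>x y. \<lambda>i\<in>I. x i \<oplus>\<^bsub>M i\<^esub> y i),
     smult = (\<lambda>r x. \<lambda>i\<in>I. r \<odot>\<^bsub>M i\<^esub> x i)\<rparr>"

definition zero_module :: "('r, nat) module" where
  "zero_module = \<lparr>carrier = {0}, monoid.mult = undefined, one = undefined,
     ring.zero = 0, ring.add = (\<lambda>x y. 0), smult = (\<lambda>r x. 0)\<rparr>"

definition regular :: "('r, 's) ring_scheme \<Rightarrow> ('r, 'r) module" where
  "regular R = \<lparr>carrier = carrier R, monoid.mult = monoid.mult R, one = one R,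
     ring.zero = ring.zero R, ring.add = ring.add R, smult = (\<lambda>r x. x \<otimes>\<^bsub>R\<^esub> r)\<rparr>"

definition change_scalars :: "('q \<Rightarrow> 'r) \<Rightarrow> ('r, 'm) module \<Rightarrow> ('q, 'm) module" where
  "change_scalars h M = \<lparr>carrier = carrier M, monoid.mult = monoid.mult M, one = one M,
     ring.zero = ring.zero M, ring.add = ring.add M, smult = (\<lambda>q x. h q \<odot>\<^bsub>M\<^esub> x)\<rparr>"

text \<open>The internal direct sum \<open>M = L \<oplus> L'\<close>.\<close>

definition splits_as :: "('r, 's) ring_scheme \<Rightarrow> ('r, 'm) module \<Rightarrow> 'm set \<Rightarrow> 'm set \<Rightarrow> bool" where
  "splits_as R M L L' \<longleftrightarrow> submodule L R M \<and> submodule L' R M \<and>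
     L \<inter> L' = {\<zero>\<^bsub>M\<^esub>} \<and> set_add M L L' = carrier M"

definition indecomposable :: "('r, 's) ring_scheme \<Rightarrow> ('r, 'm) module \<Rightarrow> bool" where
  "indecomposable R M \<longleftrightarrow> right_module R M \<and> carrier M \<noteq> {\<zero>\<^bsub>M\<^esub>} \<and>
     (\<forall>L L'. splits_as R M L L' \<longrightarrow> L = {\<zero>\<^bsub>M\<^esub>} \<or> L' = {\<zero>\<^bsub>M\<^esub>})"

definition simple_module :: "('r, 's) ring_scheme \<Rightarrow> ('r, 'm) module \<Rightarrow> bool" where
  "simple_module R M \<longleftrightarrow> right_module R M \<and> carrier M \<noteq> {\<zero>\<^bsub>M\<^esub>} \<and>
     (\<forall>L. submodule L R M \<longrightarrow> L = {\<zero>\<^bsub>M\<^esub>} \<or> L = carrier M)"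

definition composition_series ::
  "('r, 's) ring_scheme \<Rightarrow> ('r, 'm) module \<Rightarrow> 'm set list \<Rightarrow> bool" where
  "composition_series R M Ls \<longleftrightarrow> Ls \<noteq> [] \<and> hd Ls = {\<zero>\<^bsub>M\<^esub>} \<and> last Ls = carrier M \<and>
     (\<forall>L\<in>set Ls. submodule L R M) \<and>
     (\<forall>i. Suc i < length Ls \<longrightarrow> Ls ! i \<subseteq> Ls ! Suc i \<and>
        simple_module R (quot_mod (sub_mod M (Ls ! Suc i)) (Ls ! i)))"

definition composition_factor ::
  "('r, 's) ring_scheme \<Rightarrow> ('r, 'm) module \<Rightarrow> ('r, 'n) module \<Rightarrow> bool" where
  "composition_factor R M S \<longleftrightarrow> (\<exists>Ls i. composition_series R M Ls \<and> Suc i < length Ls \<and>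
     mod_iso R (quot_mod (sub_mod M (Ls ! Suc i)) (Ls ! i)) S)"

text \<open>
  Over a finite ring the finitely generated modules are the finite ones, and each of them is
  isomorphic to one whose carrier is a finite set of natural numbers. The latter are used as
  a (small) category of all finitely generated modules.
\<close>

definition fin_modules :: "('r, 's) ring_scheme \<Rightarrow> ('r, nat) module set" where
  "fin_modules R = {M. right_module R M \<and> finite (carrier M)}"

definition iso_class :: "('r, 's) ring_scheme \<Rightarrow> ('r, 'm) module \<Rightarrow> ('r, nat) module set" where
  "iso_class R M = {N \<in> fin_modules R. mod_iso R N M}"

definition iso_classes ::
  "('r, 's) ring_scheme \<Rightarrow> (('r, nat) module \<Rightarrow> bool) \<Rightarrow> ('r, nat) module set set" where
  "iso_classes R P = iso_class R ` {M \<in> fin_modules R. P M}"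

definition class_rep :: "('r, nat) module set \<Rightarrow> ('r, nat) module" where
  "class_rep c = (SOME M. M \<in> c)"


section \<open>Ringel-Hall algebras\<close>

definition hall_number ::
  "('r, 's) ring_scheme \<Rightarrow> ('r, 'm) module \<Rightarrow> ('r, 'n1) module \<Rightarrow> ('r, 'n2) module \<Rightarrow> nat" where
  "hall_number R M N1 N2 =
     card {L. submodule L R M \<and> mod_iso R (sub_mod M L) N2 \<and> mod_iso R (quot_mod M L) N1}"

text \<open>
  The product of two basis elements. For a finite ring the index set of the sum is finite, since
  \<open>G\<^sup>M\<^bsub>N1 N2\<^esub> \<noteq> 0\<close> forces the cardinality of \<open>M\<close> to be the product of those of \<open>N1\<close> and \<open>N2\<close>.
\<close>

definition hall_basis_mult ::
  "('r, 's) ring_scheme \<Rightarrow> ('r, nat) module set \<Rightarrow> ('r, nat) module set \<Rightarrow>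
     ('r, nat) module set \<Rightarrow>\<^sub>0 int" where
  "hall_basis_mult R c1 c2 =
     (let G = (\<lambda>c. hall_number R (class_rep c) (class_rep c1) (class_rep c2)) in
      \<Sum>c \<in> {c \<in> iso_classes R (\<lambda>_. True). G c \<noteq> 0}. frag_cmul (int (G c)) (frag_of c))"

text \<open>The span of the basis elements \<open>u\<^bsub>[M]\<^esub>\<close> (that is, \<open>frag_of (iso_class R M)\<close>) with \<open>P M\<close>.\<close>

definition hall_span ::
  "('r, 's) ring_scheme \<Rightarrow> (('r, nat) module \<Rightarrow> bool) \<Rightarrow> (('r, nat) module set \<Rightarrow>\<^sub>0 int) set" where
  "hall_span R P = carrier (free_Abelian_group (iso_classes R P))"

definition hall_algebra :: "('r, 's) ring_scheme \<Rightarrow> (('r, nat) module set \<Rightarrow>\<^sub>0 int) ring" where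
  "hall_algebra R = \<lparr>carrier = hall_span R (\<lambda>_. True),
     monoid.mult = (\<lambda>x y. frag_extend (\<lambda>c1. frag_extend (\<lambda>c2. hall_basis_mult R c1 c2) y) x),
     one = frag_of (iso_class R zero_module), ring.zero = 0, ring.add = (+)\<rparr>"


section \<open>Finite-dimensional algebras\<close>

text \<open>Vector spaces over \<open>K\<close> are stored as \<open>module\<close> records over \<open>K\<close>.\<close>

definition spanning_set :: "('k, 'l) ring_scheme \<Rightarrow> ('k, 'v) module \<Rightarrow> 'v set \<Rightarrow> bool" where
  "spanning_set K V B \<longleftrightarrow> B \<subseteq> carrier V \<and>
     (\<forall>v\<in>carrier V. \<exists>c\<in>B \<rightarrow> carrier K. v = (\<Oplus>\<^bsub>V\<^esub>b\<in>B. c b \<odot>\<^bsub>V\<^esub> b))"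

definition vdim :: "('k, 'l) ring_scheme \<Rightarrow> ('k, 'v) module \<Rightarrow> nat" where
  "vdim K V = (LEAST n. \<exists>B. finite B \<and> card B = n \<and> spanning_set K V B)"

text \<open>The locale \<^locale>\<open>algebra\<close> of the library only covers commutative algebras.\<close>

locale fd_algebra = K?: field K + A?: module K A + A?: ring A
  for K :: "('k, 'l) ring_scheme" (structure) and A :: "('k, 'a) module" (structure) +
  assumes smult_mult_left:
      "\<lbrakk>c \<in> carrier K; x \<in> carrier A; y \<in> carrier A\<rbrakk> \<Longrightarrow>
        c \<odot>\<^bsub>A\<^esub> (x \<otimes>\<^bsub>A\<^esub> y) = (c \<odot>\<^bsub>A\<^esub> x) \<otimes>\<^bsub>A\<^esub> y"
    and smult_mult_right:
      "\<lbrakk>c \<in> carrier K; x \<in> carrier A; y \<in> carrier A\<rbrakk> \<Longrightarrow>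
        c \<odot>\<^bsub>A\<^esub> (x \<otimes>\<^bsub>A\<^esub> y) = x \<otimes>\<^bsub>A\<^esub> (c \<odot>\<^bsub>A\<^esub> y)"
    and finite_dim: "\<exists>B. finite B \<and> spanning_set K A B"

definition hom_space ::
  "('k, 'a) module \<Rightarrow> ('a, 'm) module \<Rightarrow> ('a, 'n) module \<Rightarrow> ('k, 'm \<Rightarrow> 'n) module" where
  "hom_space A M N = \<lparr>carrier = mod_hom A M N, monoid.mult = undefined, one = undefined,
     ring.zero = (\<lambda>x\<in>carrier M. \<zero>\<^bsub>N\<^esub>), ring.add = (\<lambda>f g. \<lambda>x\<in>carrier M. f x \<oplus>\<^bsub>N\<^esub> g x),
     smult = (\<lambda>c f. \<lambda>x\<in>carrier M. (c \<odot>\<^bsub>A\<^esub> \<one>\<^bsub>A\<^esub>) \<odot>\<^bsub>N\<^esub> f x)\<rparr>"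

text \<open>
  \<open>Ext\<^sup>1(M, N)\<close>, computed from the presentation \<open>0 \<rightarrow> \<Omega> \<rightarrow> F \<rightarrow> M \<rightarrow> 0\<close>, where \<open>F\<close> is the free module
  on the (finite) set of elements of \<open>M\<close>: it is the cokernel of \<open>Hom(F, N) \<rightarrow> Hom(\<Omega>, N)\<close>.
\<close>

definition free_cover :: "('k, 'a) module \<Rightarrow> ('a, 'm) module \<Rightarrow> ('a, 'm \<Rightarrow> 'a) module" where
  "free_cover A M = direct_sum (carrier M) (\<lambda>_. regular A)"

definition syzygy :: "('k, 'a) module \<Rightarrow> ('a, 'm) module \<Rightarrow> ('m \<Rightarrow> 'a) set" where
  "syzygy A M = {a \<in> carrier (free_cover A M).
     (\<Oplus>\<^bsub>M\<^esub>m\<in>carrier M. a m \<odot>\<^bsub>M\<^esub> m) = \<zero>\<^bsub>M\<^esub>}"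

definition ext1_space ::
  "('k, 'a) module \<Rightarrow> ('a, 'm) module \<Rightarrow> ('a, 'n) module \<Rightarrow> ('k, (('m \<Rightarrow> 'a) \<Rightarrow> 'n) set) module" where
  "ext1_space A M N =
     quot_mod (hom_space A (sub_mod (free_cover A M) (syzygy A M)) N)
       ((\<lambda>f. restrict f (syzygy A M)) ` mod_hom A (free_cover A M) N)"


section \<open>Tame hereditary algebras\<close>

definition projective :: "('r, 's) ring_scheme \<Rightarrow> ('r, 'm) module \<Rightarrow> bool" where
  "projective R P \<longleftrightarrow> right_module R P \<and>
     (\<forall>M\<in>fin_modules R. \<forall>N\<in>fin_modules R. \<forall>g\<in>mod_hom R M N. \<forall>f\<in>mod_hom R P N.
        g ` carrier M = carrier N \<longrightarrow>
        (\<exists>h\<in>mod_hom R P M. \<forall>x\<in>carrier P. g (h x) = f x))"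

definition hereditary :: "('r, 's) ring_scheme \<Rightarrow> bool" where
  "hereditary R \<longleftrightarrow> (\<forall>P\<in>fin_modules R. projective R P \<longrightarrow>
     (\<forall>L. submodule L R P \<longrightarrow> projective R (sub_mod P L)))"

text \<open>The Euler form of a hereditary algebra; the higher Ext groups vanish.\<close>

definition euler_form ::
  "('k, 'l) ring_scheme \<Rightarrow> ('k, 'a) module \<Rightarrow> ('a, 'm) module \<Rightarrow> ('a, 'n) module \<Rightarrow> int" where
  "euler_form K A M N = int (vdim K (hom_space A M N)) - int (vdim K (ext1_space A M N))"

text \<open>
  By the Jordan-Hoelder theorem, the Grothendieck group is free on the isomorphism classes
  of simple modules.
\<close>

definition grothendieck_group :: "('k, 'a) module \<Rightarrow> (('a, nat) module set \<Rightarrow>\<^sub>0 int) set" where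
  "grothendieck_group A = carrier (free_Abelian_group (iso_classes A (simple_module A)))"

definition euler_quadratic_form ::
  "('k, 'l) ring_scheme \<Rightarrow> ('k, 'a) module \<Rightarrow> (('a, nat) module set \<Rightarrow>\<^sub>0 int) \<Rightarrow> int" where
  "euler_quadratic_form K A x = (\<Sum>c\<in>Poly_Mapping.keys x. \<Sum>d\<in>Poly_Mapping.keys x.
     Poly_Mapping.lookup x c * Poly_Mapping.lookup x d *
     euler_form K A (class_rep c) (class_rep d))"

text \<open>
  Tameness over an arbitrary (here finite) field in the sense of Dlab and Ringel: the quadratic form
  is positive semidefinite but not positive definite. For connected \<open>A\<close> this says that its valued
  graph is Euclidean (extended Dynkin).
\<close>

definition tame_hereditary :: "('k, 'l) ring_scheme \<Rightarrow> ('k, 'a) module \<Rightarrow> bool" where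
  "tame_hereditary K A \<longleftrightarrow> hereditary A \<and>
     (\<forall>x\<in>grothendieck_group A. euler_quadratic_form K A x \<ge> 0) \<and>
     (\<exists>x\<in>grothendieck_group A. x \<noteq> 0 \<and> euler_quadratic_form K A x = 0)"


section \<open>The duplicated algebra\<close>

definition dual_space :: "('k, 'l) ring_scheme \<Rightarrow> ('k, 'a) module \<Rightarrow> ('a \<Rightarrow> 'k) set" where
  "dual_space K A = mod_hom K A (regular K)"

text \<open>
  The triple \<open>(a, f, b)\<close> is the matrix with rows \<open>(a, 0)\<close> and \<open>(f, b)\<close>. The bimodule structure of
  \<open>DA = Hom\<^sub>k(A, k)\<close> is \<open>(f a)(x) = f (a x)\<close> and \<open>(b f)(x) = f (x b)\<close>. For a right module \<open>M\<close> over
  this matrix algebra put \<open>X = M e\<close> and \<open>Y = M e'\<close>. As \<open>DA\<close> sits in position \<open>e' _ e\<close>, it maps \<open>Y\<close>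
  to \<open>X\<close>; so \<open>X\<close> is a submodule, with quotient \<open>Y\<close>.
\<close>

definition duplicated_algebra ::
  "('k, 'l) ring_scheme \<Rightarrow> ('k, 'a) module \<Rightarrow> ('a \<times> ('a \<Rightarrow> 'k) \<times> 'a) ring" where
  "duplicated_algebra K A =
     \<lparr>carrier = carrier A \<times> dual_space K A \<times> carrier A,
      monoid.mult = (\<lambda>(a, f, b) (a', f', b').
        (a \<otimes>\<^bsub>A\<^esub> a', \<lambda>x\<in>carrier A. f (a' \<otimes>\<^bsub>A\<^esub> x) \<oplus>\<^bsub>K\<^esub> f' (x \<otimes>\<^bsub>A\<^esub> b), b \<otimes>\<^bsub>A\<^esub> b')),
      one = (\<one>\<^bsub>A\<^esub>, \<lambda>x\<in>carrier A. \<zero>\<^bsub>K\<^esub>, \<one>\<^bsub>A\<^esub>),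
      ring.zero = (\<zero>\<^bsub>A\<^esub>, \<lambda>x\<in>carrier A. \<zero>\<^bsub>K\<^esub>, \<zero>\<^bsub>A\<^esub>),
      ring.add = (\<lambda>(a, f, b) (a', f', b').
        (a \<oplus>\<^bsub>A\<^esub> a', \<lambda>x\<in>carrier A. f x \<oplus>\<^bsub>K\<^esub> f' x, b \<oplus>\<^bsub>A\<^esub> b'))\<rparr>"

lemma dual_space_iff:
  "f \<in> dual_space K A \<longleftrightarrow> f \<in> carrier A \<rightarrow>\<^sub>E carrier K \<and>
     (\<forall>x\<in>carrier A. \<forall>y\<in>carrier A. f (x \<oplus>\<^bsub>A\<^esub> y) = f x \<oplus>\<^bsub>K\<^esub> f y) \<and>
     (\<forall>c\<in>carrier K. \<forall>x\<in>carrier A. f (c \<odot>\<^bsub>A\<^esub> x) = f x \<otimes>\<^bsub>K\<^esub> c)"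
  by (simp add: dual_space_def mod_hom_def regular_def)

context fd_algebra
begin

lemma dual_closed: "f \<in> dual_space K A \<Longrightarrow> x \<in> carrier A \<Longrightarrow> f x \<in> carrier K"
  by (auto simp: dual_space_iff)

lemma dual_add:
  "f \<in> dual_space K A \<Longrightarrow> x \<in> carrier A \<Longrightarrow> y \<in> carrier A \<Longrightarrow> f (x \<oplus>\<^bsub>A\<^esub> y) = f x \<oplus> f y"
  by (simp add: dual_space_iff)

lemma dual_smult:
  "f \<in> dual_space K A \<Longrightarrow> c \<in> carrier K \<Longrightarrow> x \<in> carrier A \<Longrightarrow> f (c \<odot>\<^bsub>A\<^esub> x) = f x \<otimes> c"
  by (simp add: dual_space_iff)

lemma dual_ext: "f \<in> dual_space K A \<Longrightarrow> (\<lambda>x\<in>carrier A. f x) = f"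
  by (auto simp: dual_space_iff extensional_restrict)

lemma dual_zero_closed: "(\<lambda>x\<in>carrier A. \<zero>) \<in> dual_space K A"
  by (auto simp: dual_space_iff)

lemma dual_add_closed:
  assumes "f \<in> dual_space K A" "g \<in> dual_space K A"
  shows "(\<lambda>x\<in>carrier A. f x \<oplus> g x) \<in> dual_space K A"
  using assms
  by (auto simp: dual_space_iff Pi_iff PiE_iff K.l_distr K.a_ac)

lemma dual_act_right:
  assumes "f \<in> dual_space K A" "a \<in> carrier A"
  shows "(\<lambda>x\<in>carrier A. f (a \<otimes>\<^bsub>A\<^esub> x)) \<in> dual_space K A"
  using assms
  by (auto simp: dual_space_iff PiE_iff A.r_distr smult_mult_right[symmetric])

lemma dual_act_left:
  assumes "f \<in> dual_space K A" "b \<in> carrier A"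
  shows "(\<lambda>x\<in>carrier A. f (x \<otimes>\<^bsub>A\<^esub> b)) \<in> dual_space K A"
  using assms
  by (auto simp: dual_space_iff PiE_iff A.l_distr smult_mult_left[symmetric])

lemma dual_mult_closed:
  assumes "f \<in> dual_space K A" "a \<in> carrier A" "g \<in> dual_space K A" "b \<in> carrier A"
  shows "(\<lambda>x\<in>carrier A. f (a \<otimes>\<^bsub>A\<^esub> x) \<oplus> g (x \<otimes>\<^bsub>A\<^esub> b)) \<in> dual_space K A"
  using dual_add_closed[OF dual_act_right[OF assms(1,2)] dual_act_left[OF assms(3,4)]]
  by (simp add: restrict_def cong: if_cong)

lemma ring_duplicated_algebra: "ring (duplicated_algebra K A)"
proof (rule ringI)
  show "abelian_group (duplicated_algebra K A)"
  proof (rule abelian_groupI)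
    fix x assume x: "x \<in> carrier (duplicated_algebra K A)"
    obtain a f b where x_eq: "x = (a, f, b)" by (cases x)
    have f: "f \<in> dual_space K A" and ab: "a \<in> carrier A" "b \<in> carrier A"
      using x by (auto simp: x_eq duplicated_algebra_def)
    have "(\<lambda>x\<in>carrier A. \<ominus> f x) \<in> dual_space K A"
      using f by (auto simp: dual_space_iff PiE_iff K.minus_add K.l_minus)
    then show "\<exists>y\<in>carrier (duplicated_algebra K A).
        y \<oplus>\<^bsub>duplicated_algebra K A\<^esub> x = \<zero>\<^bsub>duplicated_algebra K A\<^esub>"
      using ab f
      by (intro bexI[of _ "(\<ominus>\<^bsub>A\<^esub> a, (\<lambda>x\<in>carrier A. \<ominus> f x), \<ominus>\<^bsub>A\<^esub> b)"])
        (auto simp: x_eq duplicated_algebra_def A.M.l_neg K.l_neg dual_closed intro!: restrict_ext)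
  qed (auto simp: duplicated_algebra_def dual_add_closed dual_zero_closed A.M.a_ac K.a_ac
      dual_closed dual_ext cong: restrict_cong intro!: restrict_ext)
  show "monoid (duplicated_algebra K A)"
    by (rule monoidI)
      (auto simp: duplicated_algebra_def dual_mult_closed dual_zero_closed A.m_assoc K.a_ac
        dual_closed dual_ext cong: restrict_cong intro!: restrict_ext)
qed (auto simp: duplicated_algebra_def A.l_distr A.r_distr K.a_ac dual_closed dual_add
    intro!: restrict_ext)

end

text \<open>
  \<open>A\<^sub>0\<close>- and \<open>A\<^sub>1\<close>-modules become modules over the duplicated algebra via the two projections
  \<open>(a, f, b) \<mapsto> a\<close> and \<open>(a, f, b) \<mapsto> b\<close>, i.e. they are the triples \<open>(X, 0, 0)\<close> and \<open>(0, Y, 0)\<close>.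
\<close>

definition is_A0_module ::
  "('k, 'l) ring_scheme \<Rightarrow> ('k, 'a) module \<Rightarrow> ('a \<times> ('a \<Rightarrow> 'k) \<times> 'a, 'm) module \<Rightarrow> bool" where
  "is_A0_module K A M \<longleftrightarrow> (\<exists>V\<in>fin_modules A.
     mod_iso (duplicated_algebra K A) (change_scalars (\<lambda>(a, f, b). a) V) M)"

definition is_A1_module ::
  "('k, 'l) ring_scheme \<Rightarrow> ('k, 'a) module \<Rightarrow> ('a \<times> ('a \<Rightarrow> 'k) \<times> 'a, 'm) module \<Rightarrow> bool" where
  "is_A1_module K A M \<longleftrightarrow> (\<exists>V\<in>fin_modules A.
     mod_iso (duplicated_algebra K A) (change_scalars (\<lambda>(a, f, b). b) V) M)"

definition A01_ind ::
  "('k, 'l) ring_scheme \<Rightarrow> ('k, 'a) module \<Rightarrow> ('a \<times> ('a \<Rightarrow> 'k) \<times> 'a, nat) module set" where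
  "A01_ind K A = (let D = duplicated_algebra K A in
     {M \<in> fin_modules D. indecomposable D M \<and>
        (\<exists>S\<in>fin_modules D. simple_module D S \<and> is_A0_module K A S \<and> composition_factor D M S) \<and>
        (\<exists>S\<in>fin_modules D. simple_module D S \<and> is_A1_module K A S \<and> composition_factor D M S)})"

definition in_add ::
  "('r, 's) ring_scheme \<Rightarrow> ('r, nat) module set \<Rightarrow> ('r, 'm) module \<Rightarrow> bool" where
  "in_add R C M \<longleftrightarrow> (\<exists>(n::nat) N L L'. (\<forall>i<n. N i \<in> C) \<and>
     splits_as R (direct_sum {..<n} N) L L' \<and>
     mod_iso R (sub_mod (direct_sum {..<n} N) L) M)"

definition hall_A0 where
  "hall_A0 K A = hall_span (duplicated_algebra K A) (is_A0_module K A)"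

definition hall_A1 where
  "hall_A1 K A = hall_span (duplicated_algebra K A) (is_A1_module K A)"

definition hall_A01 where
  "hall_A01 K A =
     hall_span (duplicated_algebra K A) (in_add (duplicated_algebra K A) (A01_ind K A))"

end

theory Submission
  imports Defs
begin

text \<open>
  Write a module over the duplicated algebra as \<open>M = M\<^sub>0 \<oplus> M\<^sub>1\<close> with \<open>M\<^sub>1 DA \<subseteq> M\<^sub>0\<close>. As \<open>A\<close> is
  hereditary, \<open>M\<^sub>1 DA\<close>, a quotient of a power of \<open>DA\<close>, is injective and has a complement \<open>X\<close> in
  \<open>M\<^sub>0\<close>; and if \<open>Z\<close> is the part of \<open>M\<^sub>1\<close> annihilated by \<open>DA\<close>, then \<open>M\<^sub>1 / Z\<close> embeds into
  \<open>Hom(DA, M\<^sub>0)\<close>, hence into a free module, and is projective. So \<open>M = X \<oplus> E \<oplus> Z\<close> with \<open>X\<close> an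
  \<open>A\<^sub>0\<close>-module, \<open>Z\<close> an \<open>A\<^sub>1\<close>-module, and \<open>E\<close> generated by \<open>E\<^sub>1\<close> without nonzero elements of \<open>E\<^sub>1\<close>
  annihilated by \<open>DA\<close>. These two properties of \<open>E\<close> pass to direct summands and force both parts of
  a nonzero module to be nonzero, so \<open>E\<close> lies in \<open>add(A\<^sub>0\<^sub>1-ind)\<close>.

  The same splittings show that every extension of \<open>X\<close> by \<open>E\<close> and of \<open>X \<oplus> E\<close> by \<open>Z\<close> is trivial. In
  \<open>X \<oplus> E\<close> the submodule \<open>E\<close> is the one generated by the \<open>A\<^sub>1\<close>-part, and in \<open>M\<close> the submodule \<open>Z\<close> is
  the annihilated part, so both submodules are unique and \<open>u\<^bsub>[X]\<^esub> u\<^bsub>[E]\<^esub> u\<^bsub>[Z]\<^esub> = u\<^bsub>[M]\<^esub>\<close> without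
  any coefficient.
\<close>

section \<open>Right modules\<close>

text \<open>In \<open>G\<close> the second factor is the submodule, so the order of the three
  factors runs against the natural filtration, in which the \<open>A_0\<close>-part is the submodule
  and the \<open>A_1\<close>-part the quotient. Extensions along that filtration need not split. In
  the product the \<open>A_1\<close>-module is the submodule and the \<open>A_0\<close>-module the
  quotient, and this reversal is what lets injectivity of \<open>M_1 DA\<close> and projectivity of
  \<open>M_1 / Z\<close> split them. Heredity enters through one lifting property, that of a
  submodule \<open>U\<close> of a free module. For a complement of \<open>M_1 DA\<close>,
  \<open>U\<close> is a preimage of it and the lift leads to a power of \<open>DA\<close>, where
  maps extend because \<open>DA\<close> is coinduced from the ground field. For a complement of
  \<open>Z\<close>, \<open>U\<close> is the image of \<open>M_1\<close> under the embedding of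
  \<open>M_1 / Z\<close>. That embedding follows a map from \<open>DA\<close> to \<open>M_0\<close>
  with all \<open>K\<close>-linear functionals of \<open>M_0\<close>: each composite is an element
  of \<open>D(DA) = A\<close>, and together they detect zero. Isomorphism classes consist of modules
  on sets of natural numbers, while quotients and direct sums have other element types. The
  properties of \<open>E\<close> are therefore phrased by submodules and idempotents, which pass
  along isomorphisms without a choice of generators.\<close>

lemma mod_homI:
  assumes "f \<in> carrier M \<rightarrow>\<^sub>E carrier N"
    and "\<And>x y. x \<in> carrier M \<Longrightarrow> y \<in> carrier M \<Longrightarrow> f (x \<oplus>\<^bsub>M\<^esub> y) = f x \<oplus>\<^bsub>N\<^esub> f y"
    and "\<And>r x. r \<in> carrier R \<Longrightarrow> x \<in> carrier M \<Longrightarrow> f (r \<odot>\<^bsub>M\<^esub> x) = r \<odot>\<^bsub>N\<^esub> f x"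
  shows "f \<in> mod_hom R M N"
  using assms by (simp add: mod_hom_def)

lemma mod_hom_closed: "f \<in> mod_hom R M N \<Longrightarrow> x \<in> carrier M \<Longrightarrow> f x \<in> carrier N"
  by (auto simp: mod_hom_def)

lemma mod_hom_add:
  "f \<in> mod_hom R M N \<Longrightarrow> x \<in> carrier M \<Longrightarrow> y \<in> carrier M \<Longrightarrow> f (x \<oplus>\<^bsub>M\<^esub> y) = f x \<oplus>\<^bsub>N\<^esub> f y"
  by (auto simp: mod_hom_def)

lemma mod_hom_smult:
  "f \<in> mod_hom R M N \<Longrightarrow> r \<in> carrier R \<Longrightarrow> x \<in> carrier M \<Longrightarrow> f (r \<odot>\<^bsub>M\<^esub> x) = r \<odot>\<^bsub>N\<^esub> f x"
  by (auto simp: mod_hom_def)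

lemma mod_hom_extensional: "f \<in> mod_hom R M N \<Longrightarrow> f \<in> extensional (carrier M)"
  by (auto simp: mod_hom_def PiE_def)

lemma mod_hom_eqI:
  "f \<in> mod_hom R M N \<Longrightarrow> g \<in> mod_hom R M N \<Longrightarrow> (\<And>x. x \<in> carrier M \<Longrightarrow> f x = g x) \<Longrightarrow> f = g"
  by (meson extensionalityI mod_hom_extensional)

lemma sub_mod_simps [simp]:
  "carrier (sub_mod M L) = L" "ring.zero (sub_mod M L) = ring.zero M" "ring.add (sub_mod M L) = ring.add M"
  "smult (sub_mod M L) = smult M" "sub_mod (sub_mod M L) L' = sub_mod M L'"
  by (simp_all add: sub_mod_def)

lemma sub_mod_carrier: "sub_mod M (carrier M) = M"
  by (simp add: sub_mod_def)

lemma regular_simps [simp]: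
  "carrier (regular R) = carrier R" "ring.zero (regular R) = ring.zero R" "ring.add (regular R) = ring.add R"
  "r \<odot>\<^bsub>regular R\<^esub> x = x \<otimes>\<^bsub>R\<^esub> r"
  by (simp_all add: regular_def)

lemma change_scalars_simps [simp]:
  "carrier (change_scalars h M) = carrier M" "ring.zero (change_scalars h M) = ring.zero M"
  "ring.add (change_scalars h M) = ring.add M" "smult (change_scalars h M) = (\<lambda>q x. h q \<odot>\<^bsub>M\<^esub> x)"
  by (simp_all add: change_scalars_def)

section \<open>Submodules, homomorphisms and quotients of right modules\<close>

context right_module
begin

lemma act_zero [simp]: "r \<in> carrier R \<Longrightarrow> r \<odot>\<^bsub>M\<^esub> \<zero>\<^bsub>M\<^esub> = \<zero>\<^bsub>M\<^esub>"
  using act_add[of r "\<zero>\<^bsub>M\<^esub>" "\<zero>\<^bsub>M\<^esub>"] act_closed[of r "\<zero>\<^bsub>M\<^esub>"]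
  by (metis M.add.r_cancel_one' M.zero_closed M.l_zero)

lemma zero_act [simp]: "x \<in> carrier M \<Longrightarrow> \<zero> \<odot>\<^bsub>M\<^esub> x = \<zero>\<^bsub>M\<^esub>"
  using act_add_scalar[of \<zero> \<zero> x] act_closed[of \<zero> x]
  by (metis M.add.r_cancel_one' R.zero_closed R.l_zero)

lemma neg_one_act:
  assumes "x \<in> carrier M"
  shows "(\<ominus> \<one>) \<odot>\<^bsub>M\<^esub> x = \<ominus>\<^bsub>M\<^esub> x"
proof -
  have "(\<ominus> \<one>) \<odot>\<^bsub>M\<^esub> x \<oplus>\<^bsub>M\<^esub> x = \<zero>\<^bsub>M\<^esub>"
    using act_add_scalar[of "\<ominus> \<one>" \<one> x] assms by (simp add: act_one R.l_neg)
  then show ?thesis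
    using assms act_closed by (metis M.minus_equality R.add.inv_closed R.one_closed)
qed

lemma act_minus:
  assumes "r \<in> carrier R" "x \<in> carrier M"
  shows "r \<odot>\<^bsub>M\<^esub> (\<ominus>\<^bsub>M\<^esub> x) = \<ominus>\<^bsub>M\<^esub> (r \<odot>\<^bsub>M\<^esub> x)"
proof -
  have "r \<odot>\<^bsub>M\<^esub> (\<ominus>\<^bsub>M\<^esub> x) \<oplus>\<^bsub>M\<^esub> r \<odot>\<^bsub>M\<^esub> x = \<zero>\<^bsub>M\<^esub>"
    using assms by (simp flip: act_add add: M.l_neg)
  then show ?thesis
    using assms act_closed by (metis M.add.inv_closed M.minus_equality)
qed

text \<open>Negation is the action of \<open>\<ominus> \<one>\<close> (\<open>neg_one_act\<close>),
  so stability under the ring already contains closure under additive inverses.\<close>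

lemma sub_moduleI:
  assumes "L \<subseteq> carrier M" "\<zero>\<^bsub>M\<^esub> \<in> L" "\<And>x y. x \<in> L \<Longrightarrow> y \<in> L \<Longrightarrow> x \<oplus>\<^bsub>M\<^esub> y \<in> L"
    "\<And>r x. r \<in> carrier R \<Longrightarrow> x \<in> L \<Longrightarrow> r \<odot>\<^bsub>M\<^esub> x \<in> L"
  shows "submodule L R M"
proof (intro submodule.intro subgroup.intro submodule_axioms.intro)
  fix x assume x: "x \<in> L"
  have "\<ominus>\<^bsub>M\<^esub> x \<in> L"
    using assms(1,4) x neg_one_act[of x] by (metis R.add.inv_closed R.one_closed subsetD)
  then show "inv\<^bsub>add_monoid M\<^esub> x \<in> L" by (simp add: a_inv_def)
qed (use assms in auto)

lemma submoduleD:
  assumes "submodule L R M"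
  shows "L \<subseteq> carrier M" "\<zero>\<^bsub>M\<^esub> \<in> L" "x \<in> L \<Longrightarrow> y \<in> L \<Longrightarrow> x \<oplus>\<^bsub>M\<^esub> y \<in> L"
    "r \<in> carrier R \<Longrightarrow> x \<in> L \<Longrightarrow> r \<odot>\<^bsub>M\<^esub> x \<in> L" "x \<in> L \<Longrightarrow> \<ominus>\<^bsub>M\<^esub> x \<in> L"
    "x \<in> L \<Longrightarrow> x \<in> carrier M"
proof -
  interpret submodule L R M by fact
  show "L \<subseteq> carrier M" using subset by simp
  show "\<zero>\<^bsub>M\<^esub> \<in> L" using one_closed by simp
  show "x \<in> L \<Longrightarrow> y \<in> L \<Longrightarrow> x \<oplus>\<^bsub>M\<^esub> y \<in> L" using m_closed by simp
  show "r \<in> carrier R \<Longrightarrow> x \<in> L \<Longrightarrow> r \<odot>\<^bsub>M\<^esub> x \<in> L" by simp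
  show "x \<in> L \<Longrightarrow> \<ominus>\<^bsub>M\<^esub> x \<in> L" using m_inv_closed by (simp add: a_inv_def)
  show "x \<in> L \<Longrightarrow> x \<in> carrier M" using subset by auto
qed

lemma submodule_diff: "submodule L R M \<Longrightarrow> x \<in> L \<Longrightarrow> y \<in> L \<Longrightarrow> x \<ominus>\<^bsub>M\<^esub> y \<in> L"
  by (simp add: a_minus_def submoduleD)

lemma submodule_carrier: "submodule (carrier M) R M"
  by (rule sub_moduleI) (auto simp: act_closed)

lemma submodule_zero: "submodule {\<zero>\<^bsub>M\<^esub>} R M"
  by (rule sub_moduleI) auto

lemma submodule_Int: "submodule L R M \<Longrightarrow> submodule L' R M \<Longrightarrow> submodule (L \<inter> L') R M"
  by (rule sub_moduleI) (auto simp: submoduleD)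

lemma finite_submodules: "finite (carrier M) \<Longrightarrow> finite {P. submodule P R M \<and> Q P}"
  by (rule finite_subset[of _ "Pow (carrier M)"]) (auto dest: submoduleD(1))

lemma mem_set_add: "x \<in> set_add M L L' \<longleftrightarrow> (\<exists>a\<in>L. \<exists>b\<in>L'. x = a \<oplus>\<^bsub>M\<^esub> b)"
  by (auto simp: set_add_def')

lemma submodule_set_add:
  assumes "submodule L R M" "submodule L' R M"
  shows "submodule (set_add M L L') R M"
proof (rule sub_moduleI)
  note D = submoduleD[OF assms(1)] submoduleD[OF assms(2)]
  show "set_add M L L' \<subseteq> carrier M" using D by (auto simp: mem_set_add)
  show "\<zero>\<^bsub>M\<^esub> \<in> set_add M L L'"
    unfolding mem_set_add using D by (metis M.l_zero M.zero_closed)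
  fix x y assume "x \<in> set_add M L L'" "y \<in> set_add M L L'"
  then obtain a b c d where *: "a \<in> L" "b \<in> L'" "c \<in> L" "d \<in> L'" "x = a \<oplus>\<^bsub>M\<^esub> b" "y = c \<oplus>\<^bsub>M\<^esub> d"
    by (auto simp: mem_set_add)
  then have "x \<oplus>\<^bsub>M\<^esub> y = (a \<oplus>\<^bsub>M\<^esub> c) \<oplus>\<^bsub>M\<^esub> (b \<oplus>\<^bsub>M\<^esub> d)"
    using D by (simp add: M.a_ac)
  then show "x \<oplus>\<^bsub>M\<^esub> y \<in> set_add M L L'"
    unfolding mem_set_add using * D by metis
next
  note D = submoduleD[OF assms(1)] submoduleD[OF assms(2)]
  fix r x assume r: "r \<in> carrier R" and "x \<in> set_add M L L'"
  then obtain a b where "a \<in> L" "b \<in> L'" "x = a \<oplus>\<^bsub>M\<^esub> b" by (auto simp: mem_set_add)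
  then show "r \<odot>\<^bsub>M\<^esub> x \<in> set_add M L L'"
    unfolding mem_set_add using D r act_add by metis
qed

lemma abelian_group_subset:
  assumes "carrier Q \<subseteq> carrier M" "\<zero>\<^bsub>M\<^esub> \<in> carrier Q"
    "\<And>x y. x \<in> carrier Q \<Longrightarrow> y \<in> carrier Q \<Longrightarrow> x \<oplus>\<^bsub>M\<^esub> y \<in> carrier Q"
    "\<And>x. x \<in> carrier Q \<Longrightarrow> \<ominus>\<^bsub>M\<^esub> x \<in> carrier Q"
    and Q: "\<zero>\<^bsub>Q\<^esub> = \<zero>\<^bsub>M\<^esub>" "ring.add Q = ring.add M"
  shows "abelian_group Q"
proof (rule abelian_groupI)
  have sub: "x \<in> carrier M" if "x \<in> carrier Q" for x using assms(1) that by auto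
  show "\<exists>y\<in>carrier Q. y \<oplus>\<^bsub>Q\<^esub> x = \<zero>\<^bsub>Q\<^esub>" if "x \<in> carrier Q" for x
    using that assms(4) by (intro bexI[of _ "\<ominus>\<^bsub>M\<^esub> x"]) (auto simp: sub Q M.l_neg)
  show "x \<oplus>\<^bsub>Q\<^esub> y \<oplus>\<^bsub>Q\<^esub> z = x \<oplus>\<^bsub>Q\<^esub> (y \<oplus>\<^bsub>Q\<^esub> z)" if "x \<in> carrier Q" "y \<in> carrier Q" "z \<in> carrier Q" for x y z
    using that by (simp add: Q sub M.a_assoc)
  show "x \<oplus>\<^bsub>Q\<^esub> y = y \<oplus>\<^bsub>Q\<^esub> x" if "x \<in> carrier Q" "y \<in> carrier Q" for x y
    using that by (simp add: Q sub M.a_comm)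
qed (use assms in auto)

lemma right_module_sub_mod:
  assumes "submodule L R M" shows "right_module R (sub_mod M L)"
proof -
  note D = submoduleD[OF assms]
  have "abelian_group (sub_mod M L)" using D by (intro abelian_group_subset) auto
  moreover have "right_module_axioms R (sub_mod M L)"
    by (rule right_module_axioms.intro) (auto simp: D act_add_scalar act_add act_assoc act_one)
  ultimately show ?thesis using R.ring_axioms by (simp add: right_module_def)
qed

lemma submodule_sub_mod_iff:
  assumes "submodule L R M"
  shows "submodule N R (sub_mod M L) \<longleftrightarrow> submodule N R M \<and> N \<subseteq> L"
proof -
  interpret L: right_module R "sub_mod M L" by (rule right_module_sub_mod[OF assms])
  show ?thesis
  proof (intro iffI conjI)
    assume N: "submodule N R (sub_mod M L)"
    note D = L.submoduleD[OF N, simplified]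
    show "N \<subseteq> L" using D by blast
    then show "submodule N R M"
      using submoduleD(1)[OF assms] by (intro sub_moduleI) (auto simp: D)
  next
    assume N: "submodule N R M \<and> N \<subseteq> L"
    then show "submodule N R (sub_mod M L)"
      using submoduleD[of N] by (intro L.sub_moduleI) auto
  qed
qed

text \<open>The subset \<open>V\<close> and the weak unit condition are made for corners:
  \<open>h\<close> may send the unit to an idempotent, as long as that idempotent acts as the
  identity on \<open>V\<close>. For \<open>in0\<close> and \<open>in1\<close>, \<open>V\<close> is
  the part of \<open>M\<close> fixed by the idempotent.\<close>

lemma right_module_change_scalars:
  assumes "ring Q" and V: "V \<subseteq> carrier M" "\<zero>\<^bsub>M\<^esub> \<in> V" "\<And>x y. x \<in> V \<Longrightarrow> y \<in> V \<Longrightarrow> x \<oplus>\<^bsub>M\<^esub> y \<in> V"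
      "\<And>x. x \<in> V \<Longrightarrow> \<ominus>\<^bsub>M\<^esub> x \<in> V"
    and h: "\<And>q. q \<in> carrier Q \<Longrightarrow> h q \<in> carrier R"
      "\<And>q r. q \<in> carrier Q \<Longrightarrow> r \<in> carrier Q \<Longrightarrow> h (q \<oplus>\<^bsub>Q\<^esub> r) = h q \<oplus> h r"
      "\<And>q r. q \<in> carrier Q \<Longrightarrow> r \<in> carrier Q \<Longrightarrow> h (q \<otimes>\<^bsub>Q\<^esub> r) = h q \<otimes> h r"
      "\<And>x. x \<in> V \<Longrightarrow> h \<one>\<^bsub>Q\<^esub> \<odot>\<^bsub>M\<^esub> x = x"
      "\<And>q x. q \<in> carrier Q \<Longrightarrow> x \<in> V \<Longrightarrow> h q \<odot>\<^bsub>M\<^esub> x \<in> V"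
  shows "right_module Q (change_scalars h (sub_mod M V))"
proof -
  have sub: "x \<in> carrier M" if "x \<in> V" for x using V that by auto
  have "abelian_group (change_scalars h (sub_mod M V))"
    using V by (intro abelian_group_subset) auto
  moreover have "right_module_axioms Q (change_scalars h (sub_mod M V))"
    by (rule right_module_axioms.intro) (simp_all add: sub h act_add_scalar act_add act_assoc)
  ultimately show ?thesis using assms(1) by (simp add: right_module_def)
qed

text \<open>The axioms are equations, and negatives are images of negatives, so a surjection that
  respects the operations carries everything over, injective or not. It serves for quotient modules
  and for copies of a module on natural numbers alike.\<close>

lemma right_module_image:
  assumes q: "q ` carrier M = carrier Q" "\<zero>\<^bsub>Q\<^esub> = q \<zero>\<^bsub>M\<^esub>"
      "\<And>x y. x \<in> carrier M \<Longrightarrow> y \<in> carrier M \<Longrightarrow> q (x \<oplus>\<^bsub>M\<^esub> y) = q x \<oplus>\<^bsub>Q\<^esub> q y"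
      "\<And>r x. r \<in> carrier R \<Longrightarrow> x \<in> carrier M \<Longrightarrow> q (r \<odot>\<^bsub>M\<^esub> x) = r \<odot>\<^bsub>Q\<^esub> q x"
  shows "right_module R Q"
proof -
  have ex: "\<exists>a\<in>carrier M. x = q a" if "x \<in> carrier Q" for x
    using q(1) that by blast
  have cl: "q a \<in> carrier Q" if "a \<in> carrier M" for a
    using q(1) that by blast
  note q' = q(2) q(3,4)[symmetric]
  have "abelian_group Q"
  proof (rule abelian_groupI)
    fix x y assume "x \<in> carrier Q" "y \<in> carrier Q"
    then obtain a b where ab: "a \<in> carrier M" "x = q a" "b \<in> carrier M" "y = q b" using ex by blast
    then show "x \<oplus>\<^bsub>Q\<^esub> y \<in> carrier Q" by (simp add: q' cl)
    show "x \<oplus>\<^bsub>Q\<^esub> y = y \<oplus>\<^bsub>Q\<^esub> x" using ab by (simp add: q' M.a_comm)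
    show "\<zero>\<^bsub>Q\<^esub> \<oplus>\<^bsub>Q\<^esub> x = x" using ab by (simp add: q')
    show "\<exists>y\<in>carrier Q. y \<oplus>\<^bsub>Q\<^esub> x = \<zero>\<^bsub>Q\<^esub>"
      using ab by (intro bexI[of _ "q (\<ominus>\<^bsub>M\<^esub> a)"]) (simp_all add: q' M.l_neg cl)
    fix z assume "z \<in> carrier Q"
    then obtain c where "c \<in> carrier M" "z = q c" using ex by blast
    then show "x \<oplus>\<^bsub>Q\<^esub> y \<oplus>\<^bsub>Q\<^esub> z = x \<oplus>\<^bsub>Q\<^esub> (y \<oplus>\<^bsub>Q\<^esub> z)" using ab by (simp add: q' M.a_assoc)
  qed (simp add: q' cl)
  moreover have "right_module_axioms R Q"
  proof
    fix x assume "x \<in> carrier Q"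
    then obtain a where a: "a \<in> carrier M" "x = q a" using ex by blast
    then show "\<one> \<odot>\<^bsub>Q\<^esub> x = x" by (simp add: q' act_one)
    fix r assume r: "r \<in> carrier R"
    then show "r \<odot>\<^bsub>Q\<^esub> x \<in> carrier Q" using a by (simp add: q' act_closed cl)
    {
      fix s assume "s \<in> carrier R"
      then show "(r \<oplus> s) \<odot>\<^bsub>Q\<^esub> x = r \<odot>\<^bsub>Q\<^esub> x \<oplus>\<^bsub>Q\<^esub> s \<odot>\<^bsub>Q\<^esub> x"
        and "(r \<otimes> s) \<odot>\<^bsub>Q\<^esub> x = s \<odot>\<^bsub>Q\<^esub> (r \<odot>\<^bsub>Q\<^esub> x)"
        using a r by (simp_all add: q' act_closed act_add_scalar act_assoc)
    }
    fix y assume "y \<in> carrier Q"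
    then obtain b where "b \<in> carrier M" "y = q b" using ex by blast
    then show "r \<odot>\<^bsub>Q\<^esub> (x \<oplus>\<^bsub>Q\<^esub> y) = r \<odot>\<^bsub>Q\<^esub> x \<oplus>\<^bsub>Q\<^esub> r \<odot>\<^bsub>Q\<^esub> y"
      using a r by (simp add: q' act_closed act_add)
  qed
  ultimately show ?thesis using R.ring_axioms by (simp add: right_module_def)
qed

lemma mod_hom_zero:
  assumes "right_module R N" "f \<in> mod_hom R M N" shows "f \<zero>\<^bsub>M\<^esub> = \<zero>\<^bsub>N\<^esub>"
proof -
  interpret N: right_module R N by fact
  show ?thesis
    using mod_hom_add[OF assms(2), of "\<zero>\<^bsub>M\<^esub>" "\<zero>\<^bsub>M\<^esub>"] mod_hom_closed[OF assms(2), of "\<zero>\<^bsub>M\<^esub>"]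
    by (metis M.zero_closed M.l_zero N.M.add.r_cancel_one')
qed

lemma mod_hom_minus:
  assumes "right_module R N" "f \<in> mod_hom R M N" "x \<in> carrier M"
  shows "f (\<ominus>\<^bsub>M\<^esub> x) = \<ominus>\<^bsub>N\<^esub> f x"
proof -
  interpret N: right_module R N by fact
  show ?thesis
    using mod_hom_smult[OF assms(2) _ assms(3), of "\<ominus> \<one>"] mod_hom_closed[OF assms(2,3)]
    by (simp add: neg_one_act N.neg_one_act assms)
qed

lemma mod_hom_diff:
  assumes "right_module R N" "f \<in> mod_hom R M N" "x \<in> carrier M" "y \<in> carrier M"
  shows "f (x \<ominus>\<^bsub>M\<^esub> y) = f x \<ominus>\<^bsub>N\<^esub> f y"
  using assms by (simp add: a_minus_def mod_hom_add mod_hom_minus)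

lemma diff_zero_iff: "x \<in> carrier M \<Longrightarrow> y \<in> carrier M \<Longrightarrow> x \<ominus>\<^bsub>M\<^esub> y = \<zero>\<^bsub>M\<^esub> \<longleftrightarrow> x = y"
  by (metis M.add.inv_closed M.add.inv_solve_right' M.l_zero M.zero_closed a_minus_def M.r_neg)

lemma diff_add_cancel: "x \<in> carrier M \<Longrightarrow> y \<in> carrier M \<Longrightarrow> (x \<ominus>\<^bsub>M\<^esub> y) \<oplus>\<^bsub>M\<^esub> y = x"
  by (simp add: a_minus_def M.a_assoc M.l_neg)

lemma mod_hom_eq_iff:
  assumes "right_module R N" "f \<in> mod_hom R M N" "x \<in> carrier M" "y \<in> carrier M"
  shows "f x = f y \<longleftrightarrow> f (x \<ominus>\<^bsub>M\<^esub> y) = \<zero>\<^bsub>N\<^esub>"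
proof -
  interpret N: right_module R N by fact
  show ?thesis
    using assms by (simp add: mod_hom_diff N.diff_zero_iff mod_hom_closed[OF assms(2)])
qed

lemma mod_hom_inj_iff:
  assumes "right_module R N" "f \<in> mod_hom R M N"
  shows "inj_on f (carrier M) \<longleftrightarrow> (\<forall>x\<in>carrier M. f x = \<zero>\<^bsub>N\<^esub> \<longrightarrow> x = \<zero>\<^bsub>M\<^esub>)"
proof -
  interpret N: right_module R N by fact
  show ?thesis
  proof
    assume "inj_on f (carrier M)"
    then show "\<forall>x\<in>carrier M. f x = \<zero>\<^bsub>N\<^esub> \<longrightarrow> x = \<zero>\<^bsub>M\<^esub>"
      using mod_hom_zero[OF assms] by (metis M.zero_closed inj_onD)
  next
    assume *: "\<forall>x\<in>carrier M. f x = \<zero>\<^bsub>N\<^esub> \<longrightarrow> x = \<zero>\<^bsub>M\<^esub>"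
    show "inj_on f (carrier M)"
    proof (rule inj_onI)
      fix x y assume xy: "x \<in> carrier M" "y \<in> carrier M" "f x = f y"
      then have "f (x \<ominus>\<^bsub>M\<^esub> y) = \<zero>\<^bsub>N\<^esub>"
        by (intro mod_hom_eq_iff[OF assms, THEN iffD1]) simp_all
      then show "x = y" using * xy diff_zero_iff M.minus_closed by blast
    qed
  qed
qed

lemma submodule_image:
  assumes "right_module R N" "f \<in> mod_hom R M N" "submodule L R M"
  shows "submodule (f ` L) R N"
proof -
  interpret N: right_module R N by fact
  note D = submoduleD[OF assms(3)]
  show ?thesis
  proof (rule N.sub_moduleI)
    show "f ` L \<subseteq> carrier N" using D(6) mod_hom_closed[OF assms(2)] by (auto simp only:)
    show "\<zero>\<^bsub>N\<^esub> \<in> f ` L" using D(2) by (simp flip: mod_hom_zero[OF assms(1,2)])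
  next
    fix x y assume "x \<in> f ` L" "y \<in> f ` L"
    then obtain a b where "a \<in> L" "b \<in> L" "x = f a" "y = f b" by blast
    then show "x \<oplus>\<^bsub>N\<^esub> y \<in> f ` L"
      using D(3)[of a b] D(6) by (simp flip: mod_hom_add[OF assms(2)])
  next
    fix r x assume r: "r \<in> carrier R" and "x \<in> f ` L"
    then obtain a where "a \<in> L" "x = f a" by blast
    then show "r \<odot>\<^bsub>N\<^esub> x \<in> f ` L"
      using r D(4)[of r a] D(6) by (simp flip: mod_hom_smult[OF assms(2)])
  qed
qed

lemma submodule_vimage:
  assumes "right_module R N" "f \<in> mod_hom R M N" "submodule L R N"
  shows "submodule {x \<in> carrier M. f x \<in> L} R M"
proof -
  interpret N: right_module R N by fact
  note D = N.submoduleD[OF assms(3)]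
  show ?thesis
    using D by (intro sub_moduleI)
      (auto simp: mod_hom_zero[OF assms(1,2)] mod_hom_add[OF assms(2)] mod_hom_smult[OF assms(2)] act_closed)
qed

lemma factor_through_surj:
  assumes N: "right_module R N" and P: "right_module R P"
    and p: "p \<in> mod_hom R M P" "p ` carrier M = carrier P"
    and g: "g \<in> mod_hom R M N"
    and ker: "\<And>x. x \<in> carrier M \<Longrightarrow> p x = \<zero>\<^bsub>P\<^esub> \<Longrightarrow> g x = \<zero>\<^bsub>N\<^esub>"
  obtains h where "h \<in> mod_hom R P N" "\<And>x. x \<in> carrier M \<Longrightarrow> h (p x) = g x"
proof -
  interpret N: right_module R N by fact
  interpret P: right_module R P by fact
  \<comment> \<open>Any preimage will do: two of them differ by an element of the kernel of
    \<open>p\<close>, which \<open>g\<close> kills.\<close>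
  define h where "h = (\<lambda>y\<in>carrier P. g (SOME x. x \<in> carrier M \<and> p x = y))"
  have h: "h (p x) = g x" if x: "x \<in> carrier M" for x
  proof -
    let ?x = "SOME x'. x' \<in> carrier M \<and> p x' = p x"
    have x': "?x \<in> carrier M \<and> p ?x = p x" using x by (metis (mono_tags, lifting) someI)
    then have "p (?x \<ominus>\<^bsub>M\<^esub> x) = \<zero>\<^bsub>P\<^esub>"
      using x by (intro mod_hom_eq_iff[OF P p(1), THEN iffD1]) simp_all
    then have "g ?x = g x"
      using x x' ker by (intro mod_hom_eq_iff[OF N g, THEN iffD2]) simp_all
    then show ?thesis using x mod_hom_closed[OF p(1)] by (simp add: h_def)
  qed
  have "h \<in> mod_hom R P N"
  proof (rule mod_homI)
    have "h y \<in> carrier N" if "y \<in> carrier P" for y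
    proof -
      obtain x where "x \<in> carrier M" "y = p x" using \<open>y \<in> carrier P\<close> p(2) by blast
      then show ?thesis using h mod_hom_closed[OF g] by simp
    qed
    then show "h \<in> carrier P \<rightarrow>\<^sub>E carrier N" by (auto simp: h_def)
  next
    fix x y assume "x \<in> carrier P" "y \<in> carrier P"
    then obtain a b where "a \<in> carrier M" "b \<in> carrier M" "x = p a" "y = p b"
      using p(2) by blast
    then show "h (x \<oplus>\<^bsub>P\<^esub> y) = h x \<oplus>\<^bsub>N\<^esub> h y"
      by (metis M.add.m_closed h mod_hom_add[OF p(1)] mod_hom_add[OF g])
  next
    fix r x assume "r \<in> carrier R" "x \<in> carrier P"
    then obtain a where "a \<in> carrier M" "x = p a" "r \<in> carrier R"
      using p(2) by blast
    then show "h (r \<odot>\<^bsub>P\<^esub> x) = r \<odot>\<^bsub>N\<^esub> h x"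
      by (metis act_closed h mod_hom_smult[OF p(1)] mod_hom_smult[OF g])
  qed
  then show ?thesis using h that by blast
qed

end

lemma fin_modulesD: "M \<in> fin_modules R \<Longrightarrow> right_module R M" "M \<in> fin_modules R \<Longrightarrow> finite (carrier M)"
  by (simp_all add: fin_modules_def)

lemma quot_mod_simps [simp]:
  "carrier (quot_mod M L) = a_rcosets\<^bsub>M\<^esub> L" "\<zero>\<^bsub>quot_mod M L\<^esub> = L" "ring.add (quot_mod M L) = set_add M"
  "smult (quot_mod M L) = (\<lambda>r C. set_add M L ((\<lambda>x. r \<odot>\<^bsub>M\<^esub> x) ` C))"
  by (simp_all add: quot_mod_def)

context right_module
begin

text \<open>Restricted to the carrier because the elements of \<open>mod_hom\<close> are extensional
  functions.\<close>

definition quot_proj :: "'m set \<Rightarrow> 'm \<Rightarrow> 'm set" where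
  "quot_proj L = (\<lambda>x\<in>carrier M. L +>\<^bsub>M\<^esub> x)"

lemma
  assumes L: "submodule L R M"
  shows right_module_quot_mod: "right_module R (quot_mod M L)"
    and quot_proj_hom: "quot_proj L \<in> mod_hom R M (quot_mod M L)"
    and quot_proj_surj: "quot_proj L ` carrier M = carrier (quot_mod M L)"
    and quot_proj_ker: "x \<in> carrier M \<Longrightarrow> quot_proj L x = \<zero>\<^bsub>quot_mod M L\<^esub> \<longleftrightarrow> x \<in> L"
proof -
  note D = submoduleD[OF L]
  interpret L: abelian_subgroup L M
    using L by (intro abelian_subgroupI3 additive_subgroupI M.abelian_group_axioms submodule.axioms(1))
  have surj: "quot_proj L ` carrier M = carrier (quot_mod M L)"
    by (auto simp: quot_proj_def A_RCOSETS_def')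
  have zero: "\<zero>\<^bsub>quot_mod M L\<^esub> = quot_proj L \<zero>\<^bsub>M\<^esub>"
    using D(1) by (simp add: quot_proj_def)
  have add: "quot_proj L (x \<oplus>\<^bsub>M\<^esub> y) = quot_proj L x \<oplus>\<^bsub>quot_mod M L\<^esub> quot_proj L y"
    if "x \<in> carrier M" "y \<in> carrier M" for x y
    using that by (simp add: quot_proj_def L.a_rcos_sum)
  have mem: "z \<in> L +>\<^bsub>M\<^esub> x \<longleftrightarrow> (\<exists>l\<in>L. z = l \<oplus>\<^bsub>M\<^esub> x)" for z x
    by (auto simp: a_r_coset_def')
  have smult: "quot_proj L (r \<odot>\<^bsub>M\<^esub> x) = r \<odot>\<^bsub>quot_mod M L\<^esub> quot_proj L x"
    if r: "r \<in> carrier R" and x: "x \<in> carrier M" for r x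
  proof -
    \<comment> \<open>The elementwise multiple of a coset by \<open>r\<close> may fill only a
      portion of a coset; adding \<open>L\<close> in the action of \<open>quot_mod\<close> completes
      it.\<close>
    have "set_add M L ((\<lambda>y. r \<odot>\<^bsub>M\<^esub> y) ` (L +>\<^bsub>M\<^esub> x)) = L +>\<^bsub>M\<^esub> (r \<odot>\<^bsub>M\<^esub> x)"
    proof (rule Set.set_eqI, rule iffI)
      fix z assume "z \<in> set_add M L ((\<lambda>y. r \<odot>\<^bsub>M\<^esub> y) ` (L +>\<^bsub>M\<^esub> x))"
      then obtain a b where ab: "a \<in> L" "b \<in> L" "z = a \<oplus>\<^bsub>M\<^esub> r \<odot>\<^bsub>M\<^esub> (b \<oplus>\<^bsub>M\<^esub> x)"
        by (auto simp: mem_set_add mem)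
      then have "z = (a \<oplus>\<^bsub>M\<^esub> r \<odot>\<^bsub>M\<^esub> b) \<oplus>\<^bsub>M\<^esub> r \<odot>\<^bsub>M\<^esub> x"
        using r x D(6) by (simp add: act_add act_closed M.a_assoc)
      then show "z \<in> L +>\<^bsub>M\<^esub> (r \<odot>\<^bsub>M\<^esub> x)"
        unfolding mem using ab r D(3,4) by blast
    next
      fix z assume "z \<in> L +>\<^bsub>M\<^esub> (r \<odot>\<^bsub>M\<^esub> x)"
      then obtain a where a: "a \<in> L" "z = a \<oplus>\<^bsub>M\<^esub> r \<odot>\<^bsub>M\<^esub> x" by (auto simp: mem)
      moreover have "x \<in> L +>\<^bsub>M\<^esub> x" using x by (rule L.a_rcos_self)
      ultimately show "z \<in> set_add M L ((\<lambda>y. r \<odot>\<^bsub>M\<^esub> y) ` (L +>\<^bsub>M\<^esub> x))"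
        by (auto simp: mem_set_add)
    qed
    then show ?thesis using r x by (simp add: quot_proj_def act_closed)
  qed
  show "right_module R (quot_mod M L)"
    by (rule right_module_image[of "quot_proj L"]) (fact surj zero add smult)+
  show "quot_proj L \<in> mod_hom R M (quot_mod M L)"
  proof (rule mod_homI)
    show "quot_proj L \<in> carrier M \<rightarrow>\<^sub>E carrier (quot_mod M L)"
      using surj by (auto simp: quot_proj_def)
  qed (fact add smult)+
  show "quot_proj L ` carrier M = carrier (quot_mod M L)" by (fact surj)
  show "quot_proj L x = \<zero>\<^bsub>quot_mod M L\<^esub> \<longleftrightarrow> x \<in> L" if x: "x \<in> carrier M"
  proof
    assume "quot_proj L x = \<zero>\<^bsub>quot_mod M L\<^esub>"
    then show "x \<in> L" using x L.a_rcos_self[of x] by (simp add: quot_proj_def)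
  next
    assume "x \<in> L"
    then show "quot_proj L x = \<zero>\<^bsub>quot_mod M L\<^esub>" using x L.a_rcos_const by (simp add: quot_proj_def)
  qed
qed

end

section \<open>Isomorphisms and copies on natural numbers\<close>

lemma mod_hom_compose:
  assumes f: "f \<in> mod_hom R M N" and g: "g \<in> mod_hom R N P" and M: "right_module R M"
  shows "compose (carrier M) g f \<in> mod_hom R M P"
proof -
  interpret right_module R M by fact
  show ?thesis
    by (rule mod_homI) (auto simp: compose_def mod_hom_closed[OF f] mod_hom_closed[OF g]
        mod_hom_add[OF f] mod_hom_add[OF g] mod_hom_smult[OF f] mod_hom_smult[OF g] act_closed)
qed

lemma mod_hom_inverse:
  assumes f: "f \<in> mod_hom R M N" "bij_betw f (carrier M) (carrier N)" and M: "right_module R M"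
  obtains g where "g \<in> mod_hom R N M" "bij_betw g (carrier N) (carrier M)"
    "\<And>x. x \<in> carrier M \<Longrightarrow> g (f x) = x" "\<And>y. y \<in> carrier N \<Longrightarrow> f (g y) = y"
proof -
  interpret right_module R M by fact
  define g where "g = (\<lambda>y\<in>carrier N. inv_into (carrier M) f y)"
  have gf: "g (f x) = x" if "x \<in> carrier M" for x
    using that f(2) mod_hom_closed[OF f(1)] by (simp add: g_def bij_betw_def)
  have ex: "\<exists>x\<in>carrier M. y = f x" if "y \<in> carrier N" for y
    using f(2) that by (auto simp: bij_betw_def)
  have fg: "f (g y) = y" if "y \<in> carrier N" for y
    using ex[OF that] gf by auto
  have cl: "g y \<in> carrier M" if "y \<in> carrier N" for y
    using ex[OF that] gf by auto
  have "g \<in> mod_hom R N M"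
  proof (rule mod_homI)
    show "g \<in> carrier N \<rightarrow>\<^sub>E carrier M" using cl by (auto simp: g_def)
  next
    fix x y assume "x \<in> carrier N" "y \<in> carrier N"
    then obtain a b where ab: "a \<in> carrier M" "b \<in> carrier M" "x = f a" "y = f b" using ex by blast
    then have "g (f (a \<oplus>\<^bsub>M\<^esub> b)) = a \<oplus>\<^bsub>M\<^esub> b" by (intro gf) simp
    then show "g (x \<oplus>\<^bsub>N\<^esub> y) = g x \<oplus>\<^bsub>M\<^esub> g y" using ab by (simp add: gf mod_hom_add[OF f(1)])
  next
    fix r x assume "r \<in> carrier R" "x \<in> carrier N"
    then obtain a where a: "a \<in> carrier M" "x = f a" "r \<in> carrier R" using ex by blast
    then have "g (f (r \<odot>\<^bsub>M\<^esub> a)) = r \<odot>\<^bsub>M\<^esub> a" by (intro gf) (simp add: act_closed)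
    then show "g (r \<odot>\<^bsub>N\<^esub> x) = r \<odot>\<^bsub>M\<^esub> g x" using a by (simp add: gf mod_hom_smult[OF f(1)])
  qed
  moreover have "bij_betw g (carrier N) (carrier M)"
    by (rule bij_betw_byWitness[where f' = f]) (auto simp: fg gf cl mod_hom_closed[OF f(1)])
  ultimately show ?thesis using that fg gf by blast
qed

lemma mod_isoI: "f \<in> mod_hom R M N \<Longrightarrow> bij_betw f (carrier M) (carrier N) \<Longrightarrow> mod_iso R M N"
  by (auto simp: mod_iso_def)

lemma mod_iso_refl: assumes "right_module R M" shows "mod_iso R M M"
proof -
  interpret right_module R M by fact
  show ?thesis
    by (rule mod_isoI[of "\<lambda>x\<in>carrier M. x"])
      (auto intro!: mod_homI simp: act_closed bij_betw_def inj_on_def)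
qed

lemma mod_iso_sym: "mod_iso R M N \<Longrightarrow> right_module R M \<Longrightarrow> mod_iso R N M"
  unfolding mod_iso_def by (metis mod_hom_inverse)

lemma mod_iso_trans:
  "mod_iso R M N \<Longrightarrow> mod_iso R N P \<Longrightarrow> right_module R M \<Longrightarrow> mod_iso R M P"
proof -
  assume M: "right_module R M" and "mod_iso R M N" "mod_iso R N P"
  then obtain f g where fg: "f \<in> mod_hom R M N" "bij_betw f (carrier M) (carrier N)"
    "g \<in> mod_hom R N P" "bij_betw g (carrier N) (carrier P)" by (auto simp: mod_iso_def)
  have "bij_betw (compose (carrier M) g f) (carrier M) (carrier P)"
    using bij_betw_trans[OF fg(2,4)] by (rule bij_betw_cong[THEN iffD1, rotated]) (simp add: compose_def)
  then show ?thesis using mod_hom_compose[OF fg(1,3) M] by (rule mod_isoI[rotated])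
qed

text \<open>The structure is carried along an injection \<open>h\<close> of the finite carrier into
  the natural numbers, with left inverse \<open>k\<close>. This is the bridge from modules of any
  element type to \<open>fin_modules\<close>, where the isomorphism classes and the tests in
  \<open>projective\<close> live.\<close>

lemma ex_fin_module:
  fixes M :: "('r, 'm) module"
  assumes M: "right_module R M" "finite (carrier M)"
  obtains N where "N \<in> fin_modules R" "mod_iso R N M"
proof -
  interpret right_module R M by fact
  obtain h :: "'m \<Rightarrow> nat" where h: "inj_on h (carrier M)"
    using M(2) finite_imp_inj_to_nat_seg by metis
  define k where "k = inv_into (carrier M) h"
  have k: "k (h x) = x" if "x \<in> carrier M" for x using that h by (simp add: k_def)
  define N :: "('r, nat) module" where "N = \<lparr>carrier = h ` carrier M, monoid.mult = undefined, one = undefined,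
     ring.zero = h \<zero>\<^bsub>M\<^esub>, ring.add = (\<lambda>x y. h (k x \<oplus>\<^bsub>M\<^esub> k y)), smult = (\<lambda>r x. h (r \<odot>\<^bsub>M\<^esub> k x))\<rparr>"
  have N: "right_module R N"
    by (rule right_module_image[of h]) (simp_all add: N_def k)
  have "(\<lambda>x\<in>carrier M. h x) \<in> mod_hom R M N"
    by (rule mod_homI) (auto simp: N_def k act_closed)
  moreover have "bij_betw (\<lambda>x\<in>carrier M. h x) (carrier M) (carrier N)"
    using h by (auto simp: bij_betw_def N_def inj_on_def)
  ultimately have "mod_iso R M N" by (rule mod_isoI)
  then show ?thesis
    using that[of N] N M mod_iso_sym by (auto simp: fin_modules_def N_def)
qed

context right_module
begin

text \<open>The first isomorphism theorem: \<open>f\<close> descends along \<open>quot_proj\<close>,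
  and its kernel being exactly \<open>L\<close> makes the induced map injective.\<close>

lemma mod_iso_quot_mod:
  assumes N: "right_module R N" and f: "f \<in> mod_hom R M N" "f ` carrier M = carrier N"
    and L: "submodule L R M" "\<And>x. x \<in> carrier M \<Longrightarrow> f x = \<zero>\<^bsub>N\<^esub> \<longleftrightarrow> x \<in> L"
  shows "mod_iso R (quot_mod M L) N"
proof -
  note q = right_module_quot_mod[OF L(1)] quot_proj_hom[OF L(1)] quot_proj_surj[OF L(1)]
  interpret Q: right_module R "quot_mod M L" by (fact q)
  obtain h where h: "h \<in> mod_hom R (quot_mod M L) N" "\<And>x. x \<in> carrier M \<Longrightarrow> h (quot_proj L x) = f x"
    using factor_through_surj[OF N q f(1)] L quot_proj_ker[OF L(1)] by metis
  have "h ` carrier (quot_mod M L) = carrier N"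
    unfolding q(3)[symmetric] f(2)[symmetric] using h(2) by (auto simp: image_image)
  moreover have "inj_on h (carrier (quot_mod M L))"
    using L(2) h(2) quot_proj_ker[OF L(1)]
    by (subst Q.mod_hom_inj_iff[OF N h(1)], unfold q(3)[symmetric]) auto
  ultimately show ?thesis using h(1) by (auto simp: mod_iso_def bij_betw_def)
qed

lemma mod_iso_sub_mod_image:
  assumes "f \<in> mod_hom R M N" "submodule L R M" "inj_on f L"
  shows "mod_iso R (sub_mod M L) (sub_mod N (f ` L))"
proof (rule mod_isoI)
  note D = submoduleD[OF assms(2)]
  show "restrict f L \<in> mod_hom R (sub_mod M L) (sub_mod N (f ` L))"
    by (rule mod_homI) (auto simp: D mod_hom_add[OF assms(1)] mod_hom_smult[OF assms(1)])
  show "bij_betw (restrict f L) (carrier (sub_mod M L)) (carrier (sub_mod N (f ` L)))"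
    using assms(3) by (auto simp: bij_betw_def inj_on_def)
qed

lemma mod_iso_quot_mod_image:
  assumes N: "right_module R N" and f: "f \<in> mod_hom R M N" "bij_betw f (carrier M) (carrier N)"
    and L: "submodule L R M"
  shows "mod_iso R (quot_mod M L) (quot_mod N (f ` L))"
proof -
  interpret N: right_module R N by fact
  note fL = submodule_image[OF N f(1) L]
  note D = submoduleD[OF L]
  let ?g = "compose (carrier M) (N.quot_proj (f ` L)) f"
  have fM: "f ` carrier M = carrier N" and inj: "inj_on f (carrier M)"
    using f(2) by (auto simp: bij_betw_def)
  show ?thesis
  proof (rule mod_iso_quot_mod[where f = ?g])
    show "right_module R (quot_mod N (f ` L))" by (rule N.right_module_quot_mod[OF fL])
    show "?g \<in> mod_hom R M (quot_mod N (f ` L))"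
      by (rule mod_hom_compose[OF f(1) N.quot_proj_hom[OF fL] right_module_axioms])
    have "?g ` carrier M = N.quot_proj (f ` L) ` f ` carrier M"
      by (auto simp: compose_def image_image)
    then show "?g ` carrier M = carrier (quot_mod N (f ` L))"
      using N.quot_proj_surj[OF fL] fM by simp
    fix x assume x: "x \<in> carrier M"
    have "?g x = \<zero>\<^bsub>quot_mod N (f ` L)\<^esub> \<longleftrightarrow> f x \<in> f ` L"
      using x N.quot_proj_ker[OF fL, of "f x"] mod_hom_closed[OF f(1) x] by (simp add: compose_def)
    also have "\<dots> \<longleftrightarrow> x \<in> L" using inj_on_image_mem_iff[OF inj x D(1)] .
    finally show "?g x = \<zero>\<^bsub>quot_mod N (f ` L)\<^esub> \<longleftrightarrow> x \<in> L" .
  qed (fact L)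
qed

section \<open>Internal direct sums\<close>

lemma splits_asD:
  assumes "splits_as R M L L'"
  shows "submodule L R M" "submodule L' R M" "x \<in> L \<Longrightarrow> x \<in> L' \<Longrightarrow> x = \<zero>\<^bsub>M\<^esub>"
    "x \<in> carrier M \<Longrightarrow> \<exists>a\<in>L. \<exists>b\<in>L'. x = a \<oplus>\<^bsub>M\<^esub> b"
  using assms mem_set_add by (auto simp: splits_as_def)

lemma splits_asI:
  assumes L: "submodule L R M" and L': "submodule L' R M"
    and "\<And>x. x \<in> L \<Longrightarrow> x \<in> L' \<Longrightarrow> x = \<zero>\<^bsub>M\<^esub>"
    "\<And>x. x \<in> carrier M \<Longrightarrow> \<exists>a\<in>L. \<exists>b\<in>L'. x = a \<oplus>\<^bsub>M\<^esub> b"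
  shows "splits_as R M L L'"
  unfolding splits_as_def
proof (intro conjI L L' Set.set_eqI)
  fix x
  show "x \<in> L \<inter> L' \<longleftrightarrow> x \<in> {\<zero>\<^bsub>M\<^esub>}"
    using assms(3)[of x] submoduleD(2)[OF L] submoduleD(2)[OF L'] by blast
  show "x \<in> set_add M L L' \<longleftrightarrow> x \<in> carrier M"
    using assms(4)[of x] submoduleD(1)[OF submodule_set_add[OF L L']]
    unfolding mem_set_add[symmetric] by blast
qed

lemma splits_as_sym:
  assumes S: "splits_as R M L L'" shows "splits_as R M L' L"
proof (rule splits_asI)
  note S' = splits_asD[OF S]
  show "submodule L' R M" "submodule L R M" by (fact S')+
  show "x = \<zero>\<^bsub>M\<^esub>" if "x \<in> L'" "x \<in> L" for x using S'(3) that by blast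
  show "\<exists>a\<in>L'. \<exists>b\<in>L. x = a \<oplus>\<^bsub>M\<^esub> b" if x: "x \<in> carrier M" for x
  proof -
    obtain a b where "a \<in> L" "b \<in> L'" "x = a \<oplus>\<^bsub>M\<^esub> b" using S'(4)[OF x] by blast
    moreover from this have "x = b \<oplus>\<^bsub>M\<^esub> a"
      using submoduleD(6)[OF S'(1)] submoduleD(6)[OF S'(2)] by (simp add: M.a_comm)
    ultimately show ?thesis by blast
  qed
qed

lemma splits_as_proj:
  assumes S: "splits_as R M L L'"
  obtains p where "p \<in> mod_hom R M (sub_mod M L')" "\<forall>x\<in>L. p x = \<zero>\<^bsub>M\<^esub>" "\<forall>x\<in>L'. p x = x"
    "\<forall>x\<in>carrier M. p x = \<zero>\<^bsub>M\<^esub> \<longrightarrow> x \<in> L"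
proof -
  note S' = splits_asD[OF S]
  note D = submoduleD[OF S'(1)] and D' = submoduleD[OF S'(2)]
  have uniq: "b = d" if "a \<in> L" "b \<in> L'" "c \<in> L" "d \<in> L'" "a \<oplus>\<^bsub>M\<^esub> b = c \<oplus>\<^bsub>M\<^esub> d" for a b c d
  proof -
    have cM: "a \<in> carrier M" "b \<in> carrier M" "c \<in> carrier M" "d \<in> carrier M" using that D(6) D'(6) by auto
    \<comment> \<open>Two decompositions of the same element give b - d = c - a, which lies in
      \<open>L'\<close> and in \<open>L\<close> and is therefore zero.\<close>
    have "b \<ominus>\<^bsub>M\<^esub> d = \<ominus>\<^bsub>M\<^esub> a \<oplus>\<^bsub>M\<^esub> (a \<oplus>\<^bsub>M\<^esub> b) \<ominus>\<^bsub>M\<^esub> d"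
      using cM by (simp add: a_minus_def M.r_neg1)
    also have "\<dots> = \<ominus>\<^bsub>M\<^esub> a \<oplus>\<^bsub>M\<^esub> c"
      using cM by (simp add: that(5) a_minus_def M.a_assoc M.r_neg)
    also have "\<dots> = c \<ominus>\<^bsub>M\<^esub> a" using cM by (simp add: a_minus_def M.a_comm)
    finally have "b \<ominus>\<^bsub>M\<^esub> d \<in> L" using submodule_diff[OF S'(1)] that by simp
    moreover have "b \<ominus>\<^bsub>M\<^esub> d \<in> L'" using submodule_diff[OF S'(2)] that by simp
    ultimately have "b \<ominus>\<^bsub>M\<^esub> d = \<zero>\<^bsub>M\<^esub>" by (rule S'(3))
    then show ?thesis using cM by (simp only: diff_zero_iff)
  qed
  define p where "p = (\<lambda>x\<in>carrier M. SOME b. b \<in> L' \<and> (\<exists>a\<in>L. x = a \<oplus>\<^bsub>M\<^esub> b))"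
  have p1: "p x \<in> L' \<and> (\<exists>a\<in>L. x = a \<oplus>\<^bsub>M\<^esub> p x)" if "x \<in> carrier M" for x
  proof -
    have "\<exists>b. b \<in> L' \<and> (\<exists>a\<in>L. x = a \<oplus>\<^bsub>M\<^esub> b)" using S'(4)[OF that] by blast
    then show ?thesis using that by (simp add: p_def) (rule someI_ex)
  qed
  have p2: "p (a \<oplus>\<^bsub>M\<^esub> b) = b" if "a \<in> L" "b \<in> L'" for a b
  proof -
    have "a \<oplus>\<^bsub>M\<^esub> b \<in> carrier M" using that D(6) D'(6) by simp
    from p1[OF this] obtain c where
      "c \<in> L" "p (a \<oplus>\<^bsub>M\<^esub> b) \<in> L'" "a \<oplus>\<^bsub>M\<^esub> b = c \<oplus>\<^bsub>M\<^esub> p (a \<oplus>\<^bsub>M\<^esub> b)" by blast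
    from uniq[OF that this] show ?thesis by (rule sym)
  qed
  have "p \<in> mod_hom R M (sub_mod M L')"
  proof (rule mod_homI)
    show "p \<in> carrier M \<rightarrow>\<^sub>E carrier (sub_mod M L')"
      using p1 by (intro PiE_I) (simp_all, simp add: p_def)
  next
    fix x y assume "x \<in> carrier M" "y \<in> carrier M"
    with S'(4)[of x] S'(4)[of y]
    obtain a b c d where *: "a \<in> L" "b \<in> L'" "x = a \<oplus>\<^bsub>M\<^esub> b" "c \<in> L" "d \<in> L'" "y = c \<oplus>\<^bsub>M\<^esub> d"
      by blast
    then have "x \<oplus>\<^bsub>M\<^esub> y = (a \<oplus>\<^bsub>M\<^esub> c) \<oplus>\<^bsub>M\<^esub> (b \<oplus>\<^bsub>M\<^esub> d)"
      using D(6) D'(6) by (simp add: M.a_ac)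
    then show "p (x \<oplus>\<^bsub>M\<^esub> y) = p x \<oplus>\<^bsub>sub_mod M L'\<^esub> p y"
      using * D(3) D'(3) by (simp add: p2)
  next
    fix r x assume r: "r \<in> carrier R" and "x \<in> carrier M"
    then obtain a b where *: "a \<in> L" "b \<in> L'" "x = a \<oplus>\<^bsub>M\<^esub> b"
      using S'(4) by blast
    then show "p (r \<odot>\<^bsub>M\<^esub> x) = r \<odot>\<^bsub>sub_mod M L'\<^esub> p x"
      using r D(4,6) D'(4,6) by (simp add: p2 act_add)
  qed
  moreover have "p x = \<zero>\<^bsub>M\<^esub>" if "x \<in> L" for x using p2[OF that D'(2)] D(6)[OF that] by simp
  moreover have "p x = x" if "x \<in> L'" for x using p2[OF D(2) that] D'(6)[OF that] by simp
  moreover have "x \<in> L" if "x \<in> carrier M" "p x = \<zero>\<^bsub>M\<^esub>" for x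
  proof -
    from p1[OF \<open>x \<in> carrier M\<close>] obtain a where "a \<in> L" "x = a \<oplus>\<^bsub>M\<^esub> p x" by blast
    then show ?thesis using D(6) by (simp add: \<open>p x = \<zero>\<^bsub>M\<^esub>\<close>)
  qed
  ultimately show ?thesis using that by blast
qed

lemma splits_as_quot_iso:
  assumes S: "splits_as R M L L'"
  shows "mod_iso R (quot_mod M L) (sub_mod M L')"
proof -
  note S' = splits_asD[OF S]
  obtain p where p: "p \<in> mod_hom R M (sub_mod M L')" "\<forall>x\<in>L. p x = \<zero>\<^bsub>M\<^esub>"
    "\<forall>x\<in>L'. p x = x" "\<forall>x\<in>carrier M. p x = \<zero>\<^bsub>M\<^esub> \<longrightarrow> x \<in> L"
    by (rule splits_as_proj[OF S]) (rule that)
  show ?thesis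
  proof (rule mod_iso_quot_mod[OF right_module_sub_mod[OF S'(2)] p(1)])
    show "p ` carrier M = carrier (sub_mod M L')"
    proof (intro Set.equalityI subsetI)
      fix x assume x: "x \<in> carrier (sub_mod M L')"
      then have "p x = x" "x \<in> carrier M" using p(3) submoduleD(6)[OF S'(2)] by simp_all
      then show "x \<in> p ` carrier M" by (metis imageI)
    qed (use mod_hom_closed[OF p(1)] in blast)
    show "p x = \<zero>\<^bsub>sub_mod M L'\<^esub> \<longleftrightarrow> x \<in> L" if "x \<in> carrier M" for x
      using p(2,4) that by auto
  qed (fact S')
qed

text \<open>The map is \<open>f\<close> after the projection to \<open>L\<close> plus
  \<open>g\<close> after the projection to \<open>L'\<close>; its values are recorded on sums, the
  form in which elements of \<open>M\<close> are given.\<close>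

lemma splits_as_copair:
  assumes S: "splits_as R M L L'" and N: "right_module R N"
    and f: "f \<in> mod_hom R (sub_mod M L) N" and g: "g \<in> mod_hom R (sub_mod M L') N"
  obtains h where "h \<in> mod_hom R M N" "\<forall>a\<in>L. \<forall>b\<in>L'. h (a \<oplus>\<^bsub>M\<^esub> b) = f a \<oplus>\<^bsub>N\<^esub> g b"
proof -
  interpret N: right_module R N by fact
  note S' = splits_asD[OF S]
  note D = submoduleD[OF S'(1)] submoduleD[OF S'(2)]
  obtain p where p: "p \<in> mod_hom R M (sub_mod M L')" "\<forall>x\<in>L. p x = \<zero>\<^bsub>M\<^esub>"
    "\<forall>x\<in>L'. p x = x" "\<forall>x\<in>carrier M. p x = \<zero>\<^bsub>M\<^esub> \<longrightarrow> x \<in> L"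
    by (rule splits_as_proj[OF S]) (rule that)
  obtain q where q: "q \<in> mod_hom R M (sub_mod M L)" "\<forall>x\<in>L'. q x = \<zero>\<^bsub>M\<^esub>"
    "\<forall>x\<in>L. q x = x" "\<forall>x\<in>carrier M. q x = \<zero>\<^bsub>M\<^esub> \<longrightarrow> x \<in> L'"
    by (rule splits_as_proj[OF splits_as_sym[OF S]]) (rule that)
  define h where "h = (\<lambda>x\<in>carrier M. f (q x) \<oplus>\<^bsub>N\<^esub> g (p x))"
  have pc: "p x \<in> L'" if "x \<in> carrier M" for x using mod_hom_closed[OF p(1) that] by simp
  have qc: "q x \<in> L" if "x \<in> carrier M" for x using mod_hom_closed[OF q(1) that] by simp
  note fc = mod_hom_closed[OF f, simplified] and gc = mod_hom_closed[OF g, simplified]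
  note pqa = mod_hom_add[OF p(1)] mod_hom_add[OF q(1)] mod_hom_add[OF f] mod_hom_add[OF g]
    mod_hom_smult[OF p(1)] mod_hom_smult[OF q(1)] mod_hom_smult[OF f] mod_hom_smult[OF g]
  note simps = pqa[simplified]
  have "h \<in> mod_hom R M N"
  proof (rule mod_homI)
    show "h \<in> carrier M \<rightarrow>\<^sub>E carrier N"
      by (intro PiE_I) (simp_all add: h_def pc qc fc gc)
    show "h (x \<oplus>\<^bsub>M\<^esub> y) = h x \<oplus>\<^bsub>N\<^esub> h y" if "x \<in> carrier M" "y \<in> carrier M" for x y
      using that by (simp add: h_def simps pc qc fc gc N.M.a_ac)
    show "h (r \<odot>\<^bsub>M\<^esub> x) = r \<odot>\<^bsub>N\<^esub> h x" if "r \<in> carrier R" "x \<in> carrier M" for r x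
      using that by (simp add: h_def simps pc qc fc gc act_closed N.act_add)
  qed
  moreover have "h (a \<oplus>\<^bsub>M\<^esub> b) = f a \<oplus>\<^bsub>N\<^esub> g b" if "a \<in> L" "b \<in> L'" for a b
    using that D(6,12) by (simp add: h_def simps p(2,3) q(2,3))
  ultimately show ?thesis using that by blast
qed

text \<open>This turns the splitting of an extension into knowledge of its middle term: a module
  that splits into two given modules is determined up to isomorphism.\<close>

lemma splits_as_iso:
  assumes S: "splits_as R M L L'" and N: "right_module R N" and T: "splits_as R N P P'"
    and iso: "mod_iso R (sub_mod M L) (sub_mod N P)" "mod_iso R (sub_mod M L') (sub_mod N P')"
  shows "mod_iso R M N"
proof -
  interpret N: right_module R N by fact
  note S' = splits_asD[OF S] and T' = N.splits_asD[OF T]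
  note D = submoduleD[OF S'(1)] submoduleD[OF S'(2)] and E = N.submoduleD[OF T'(1)] N.submoduleD[OF T'(2)]
  obtain f where f: "f \<in> mod_hom R (sub_mod M L) (sub_mod N P)" "bij_betw f L P"
    using iso(1) by (auto simp: mod_iso_def)
  obtain g where g: "g \<in> mod_hom R (sub_mod M L') (sub_mod N P')" "bij_betw g L' P'"
    using iso(2) by (auto simp: mod_iso_def)
  have f': "f \<in> mod_hom R (sub_mod M L) N" and g': "g \<in> mod_hom R (sub_mod M L') N"
    using f(1) g(1) E(1,7) by (auto simp: mod_hom_def PiE_def Pi_def)
  obtain h where h: "h \<in> mod_hom R M N" "\<forall>a\<in>L. \<forall>b\<in>L'. h (a \<oplus>\<^bsub>M\<^esub> b) = f a \<oplus>\<^bsub>N\<^esub> g b"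
    by (rule splits_as_copair[OF S N f' g']) (rule that)
  obtain p where p: "p \<in> mod_hom R N (sub_mod N P')" "\<forall>x\<in>P. p x = \<zero>\<^bsub>N\<^esub>"
    "\<forall>x\<in>P'. p x = x" "\<forall>x\<in>carrier N. p x = \<zero>\<^bsub>N\<^esub> \<longrightarrow> x \<in> P"
    by (rule N.splits_as_proj[OF T]) (rule that)
  have fc: "a \<in> L \<Longrightarrow> f a \<in> P" and gc: "b \<in> L' \<Longrightarrow> g b \<in> P'" for a b
    using f(2) g(2) by (auto simp: bij_betw_def)
  interpret SL: right_module R "sub_mod M L" by (rule right_module_sub_mod[OF S'(1)])
  interpret SL': right_module R "sub_mod M L'" by (rule right_module_sub_mod[OF S'(2)])
  note f0 = SL.mod_hom_inj_iff[OF N f', simplified, THEN iffD1, OF bij_betw_imp_inj_on[OF f(2)], rule_format]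
  note g0 = SL'.mod_hom_inj_iff[OF N g', simplified, THEN iffD1, OF bij_betw_imp_inj_on[OF g(2)], rule_format]
  have inj: "inj_on h (carrier M)"
    unfolding mod_hom_inj_iff[OF N h(1)]
  proof (intro ballI impI)
    fix x assume x: "x \<in> carrier M" "h x = \<zero>\<^bsub>N\<^esub>"
    with S'(4)[of x] obtain a b where ab: "a \<in> L" "b \<in> L'" "x = a \<oplus>\<^bsub>M\<^esub> b" by blast
    then have 0: "f a \<oplus>\<^bsub>N\<^esub> g b = \<zero>\<^bsub>N\<^esub>" using x h(2) by simp
    have c: "f a \<in> carrier N" "g b \<in> carrier N" using fc[OF ab(1)] gc[OF ab(2)] E(6,12) by auto
    \<comment> \<open>The projection of \<open>N\<close> onto \<open>P'\<close> removes
      \<open>f a\<close> and isolates \<open>g b\<close>.\<close>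
    have "g b = p (f a \<oplus>\<^bsub>N\<^esub> g b)"
      using ab c fc gc by (simp add: mod_hom_add[OF p(1)] p(2,3))
    also have "\<dots> = \<zero>\<^bsub>N\<^esub>" using 0 p(2) E(2) by simp
    finally have gb: "g b = \<zero>\<^bsub>N\<^esub>" .
    then have "f a = \<zero>\<^bsub>N\<^esub>" using 0 c by simp
    then have "a = \<zero>\<^bsub>M\<^esub>" by (rule f0[OF ab(1)])
    moreover have "b = \<zero>\<^bsub>M\<^esub>" by (rule g0[OF ab(2) gb])
    ultimately show "x = \<zero>\<^bsub>M\<^esub>" using ab(3) by simp
  qed
  have "y \<in> h ` carrier M" if "y \<in> carrier N" for y
  proof -
    from T'(4)[OF that] obtain c d where cd: "c \<in> P" "d \<in> P'" "y = c \<oplus>\<^bsub>N\<^esub> d" by blast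
    then obtain a b where ab: "a \<in> L" "c = f a" "b \<in> L'" "d = g b"
      using f(2) g(2) by (auto simp: bij_betw_def)
    then have "y = h (a \<oplus>\<^bsub>M\<^esub> b)" using h(2) cd by simp
    then show ?thesis using ab D(6)[of a] D(12)[of b] by simp
  qed
  then have "h ` carrier M = carrier N" using mod_hom_closed[OF h(1)] by blast
  then show ?thesis using h(1) inj by (auto simp: mod_iso_def bij_betw_def)
qed

lemma splits_as_image:
  assumes S: "splits_as R M L L'" and N: "right_module R N"
    and f: "f \<in> mod_hom R M N" "bij_betw f (carrier M) (carrier N)"
  shows "splits_as R N (f ` L) (f ` L')"
proof -
  interpret N: right_module R N by fact
  note S' = splits_asD[OF S]
  note D = submoduleD[OF S'(1)] submoduleD[OF S'(2)]
  show ?thesis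
  proof (rule N.splits_asI)
    show "submodule (f ` L) R N" "submodule (f ` L') R N"
      using submodule_image[OF N f(1)] S'(1,2) by auto
  next
    fix x assume "x \<in> f ` L" "x \<in> f ` L'"
    then obtain a b where "a \<in> L" "b \<in> L'" "x = f a" "x = f b" by blast
    moreover from this have "a = b" using f(2) D(6,12) by (auto simp: bij_betw_def inj_on_def)
    ultimately show "x = \<zero>\<^bsub>N\<^esub>" using S'(3) mod_hom_zero[OF N f(1)] by auto
  next
    fix x assume "x \<in> carrier N"
    then obtain y where y: "y \<in> carrier M" "x = f y" using f(2) by (auto simp: bij_betw_def)
    with S'(4)[of y] obtain a b where ab: "a \<in> L" "b \<in> L'" "y = a \<oplus>\<^bsub>M\<^esub> b" by blast
    then have "x = f a \<oplus>\<^bsub>N\<^esub> f b" using y D(6,12) by (simp add: mod_hom_add[OF f(1)])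
    then show "\<exists>a\<in>f ` L. \<exists>b\<in>f ` L'. x = a \<oplus>\<^bsub>N\<^esub> b" using ab by blast
  qed
qed

end

section \<open>External direct sums\<close>

lemma direct_sum_simps [simp]:
  "carrier (direct_sum I M) = (\<Pi>\<^sub>E i\<in>I. carrier (M i))" "\<zero>\<^bsub>direct_sum I M\<^esub> = (\<lambda>i\<in>I. \<zero>\<^bsub>M i\<^esub>)"
  "x \<oplus>\<^bsub>direct_sum I M\<^esub> y = (\<lambda>i\<in>I. x i \<oplus>\<^bsub>M i\<^esub> y i)" "r \<odot>\<^bsub>direct_sum I M\<^esub> x = (\<lambda>i\<in>I. r \<odot>\<^bsub>M i\<^esub> x i)"
  by (simp_all add: direct_sum_def)

lemma right_module_direct_sum:
  assumes "ring R" and M: "\<And>i. i \<in> I \<Longrightarrow> right_module R (M i)"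
  shows "right_module R (direct_sum I M)"
proof -
  interpret R: ring R by fact
  have ag: "abelian_group (M i)" if "i \<in> I" for i using M[OF that] by (simp add: right_module_def)
  have am: "abelian_monoid (M i)" if "i \<in> I" for i using ag[OF that] by (simp add: abelian_group_def)
  note simps = abelian_monoid.a_closed[OF am] abelian_monoid.zero_closed[OF am] abelian_monoid.a_assoc[OF am]
    abelian_monoid.a_comm[OF am] abelian_monoid.a_lcomm[OF am] abelian_monoid.l_zero[OF am] abelian_monoid.r_zero[OF am] abelian_group.a_inv_closed[OF ag]
    abelian_group.l_neg[OF ag] abelian_group.r_neg[OF ag] right_module.act_closed[OF M] right_module.act_add_scalar[OF M]
    right_module.act_add[OF M] right_module.act_assoc[OF M] right_module.act_one[OF M]
  have mem: "x i \<in> carrier (M i)" if "x \<in> (\<Pi>\<^sub>E i\<in>I. carrier (M i))" "i \<in> I" for x i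
    using that by auto
  have "abelian_group (direct_sum I M)"
  proof (rule abelian_groupI)
    fix x assume "x \<in> carrier (direct_sum I M)"
    then show "\<exists>y\<in>carrier (direct_sum I M). y \<oplus>\<^bsub>direct_sum I M\<^esub> x = \<zero>\<^bsub>direct_sum I M\<^esub>"
      by (intro bexI[of _ "\<lambda>i\<in>I. \<ominus>\<^bsub>M i\<^esub> x i"]) (auto simp: simps mem intro!: restrict_ext)
    show "\<zero>\<^bsub>direct_sum I M\<^esub> \<oplus>\<^bsub>direct_sum I M\<^esub> x = x"
      using \<open>x \<in> _\<close> by (intro extensionalityI[of _ I]) (simp_all add: PiE_iff simps)
  qed (auto simp: simps mem intro!: restrict_ext)
  moreover have "right_module_axioms R (direct_sum I M)"
  proof
    fix x assume "x \<in> carrier (direct_sum I M)"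
    then show "\<one>\<^bsub>R\<^esub> \<odot>\<^bsub>direct_sum I M\<^esub> x = x"
      by (intro extensionalityI[of _ I]) (simp_all add: PiE_iff simps)
  qed (auto simp: simps mem intro!: restrict_ext)
  ultimately show ?thesis using assms(1) by (simp add: right_module_def)
qed

lemma mod_hom_component:
  "i \<in> I \<Longrightarrow> f \<in> mod_hom R P (direct_sum I M) \<Longrightarrow> (\<lambda>x\<in>carrier P. f x i) \<in> mod_hom R P (M i)"
  if "right_module R P"
proof -
  interpret right_module R P by fact
  assume i: "i \<in> I" and f: "f \<in> mod_hom R P (direct_sum I M)"
  show ?thesis
    using i mod_hom_closed[OF f] by (intro mod_homI)
      (auto simp: mod_hom_add[OF f] mod_hom_smult[OF f] act_closed)
qed

lemma mod_hom_pairing: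
  assumes "right_module R P" and f: "\<And>i. i \<in> I \<Longrightarrow> f i \<in> mod_hom R P (M i)"
  shows "(\<lambda>x\<in>carrier P. \<lambda>i\<in>I. f i x) \<in> mod_hom R P (direct_sum I M)"
proof -
  interpret right_module R P by fact
  show ?thesis
    by (intro mod_homI)
      (auto simp: mod_hom_closed[OF f] mod_hom_add[OF f] mod_hom_smult[OF f] act_closed intro!: restrict_ext)
qed

text \<open>The \<open>i\<close>-th canonical injection of a direct sum, evaluated at
  \<open>a\<close>; for \<open>i\<close> outside \<open>I\<close> it yields the zero vector.\<close>

definition single :: "'i set \<Rightarrow> ('i \<Rightarrow> ('r, 'n) module) \<Rightarrow> 'i \<Rightarrow> 'n \<Rightarrow> 'i \<Rightarrow> 'n" where
  "single I N i a = (\<lambda>j\<in>I. if j = i then a else \<zero>\<^bsub>N j\<^esub>)"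

lemma single_closed:
  assumes "\<And>i. i \<in> I \<Longrightarrow> right_module R (N i)" "a \<in> carrier (N i)"
  shows "single I N i a \<in> carrier (direct_sum I N)"
proof -
  have "\<zero>\<^bsub>N i\<^esub> \<in> carrier (N i)" if "i \<in> I" for i
    using assms(1)[OF that] by (simp add: right_module_def abelian_group_def abelian_monoid.zero_closed)
  then show ?thesis using assms(2) by (auto simp: single_def)
qed

context right_module
begin

lemma act_finsum:
  assumes "finite I" "r \<in> carrier R" "f \<in> I \<rightarrow> carrier M"
  shows "r \<odot>\<^bsub>M\<^esub> (\<Oplus>\<^bsub>M\<^esub>i\<in>I. f i) = (\<Oplus>\<^bsub>M\<^esub>i\<in>I. r \<odot>\<^bsub>M\<^esub> f i)"
  using assms
proof (induction I rule: finite_induct)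
  case (insert i I)
  then have "f i \<in> carrier M" "f \<in> I \<rightarrow> carrier M" by auto
  moreover from this insert have "(\<lambda>i. r \<odot>\<^bsub>M\<^esub> f i) \<in> I \<rightarrow> carrier M" by (auto simp: act_closed Pi_def)
  ultimately show ?case using insert by (simp add: act_add act_closed M.finsum_closed)
qed simp

text \<open>The map given by the coproduct property of a finite direct sum. The family
  \<open>N\<close> enters only through the domain to which the function is restricted.\<close>

definition copairing :: "'i set \<Rightarrow> ('i \<Rightarrow> ('r, 'n) module) \<Rightarrow> ('i \<Rightarrow> 'n \<Rightarrow> 'm) \<Rightarrow> ('i \<Rightarrow> 'n) \<Rightarrow> 'm" where
  "copairing I N h = (\<lambda>x\<in>carrier (direct_sum I N). \<Oplus>\<^bsub>M\<^esub>i\<in>I. h i (x i))"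

lemma copairing_hom:
  assumes "finite I" and N: "\<And>i. i \<in> I \<Longrightarrow> right_module R (N i)"
    and h: "\<And>i. i \<in> I \<Longrightarrow> h i \<in> mod_hom R (N i) M"
  shows "copairing I N h \<in> mod_hom R (direct_sum I N) M"
proof -
  interpret S: right_module R "direct_sum I N"
    using R.ring_axioms N by (rule right_module_direct_sum)
  have c: "(\<lambda>i. h i (x i)) \<in> I \<rightarrow> carrier M" if "x \<in> carrier (direct_sum I N)" for x
    using that mod_hom_closed[OF h] by auto
  show ?thesis
  proof (rule mod_homI)
    show "copairing I N h \<in> carrier (direct_sum I N) \<rightarrow>\<^sub>E carrier M"
      using c by (auto simp: copairing_def simp del: direct_sum_simps intro!: M.finsum_closed)
  next
    fix x y assume xy: "x \<in> carrier (direct_sum I N)" "y \<in> carrier (direct_sum I N)"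
    have "(\<Oplus>\<^bsub>M\<^esub>i\<in>I. h i ((x \<oplus>\<^bsub>direct_sum I N\<^esub> y) i)) = (\<Oplus>\<^bsub>M\<^esub>i\<in>I. h i (x i) \<oplus>\<^bsub>M\<^esub> h i (y i))"
      using xy c by (intro M.finsum_cong') (auto simp: mod_hom_add[OF h] Pi_def PiE_def)
    then show "copairing I N h (x \<oplus>\<^bsub>direct_sum I N\<^esub> y) = copairing I N h x \<oplus>\<^bsub>M\<^esub> copairing I N h y"
      using xy S.M.a_closed[OF xy] c by (simp add: copairing_def M.finsum_addf del: direct_sum_simps)
  next
    fix r x assume r: "r \<in> carrier R" and x: "x \<in> carrier (direct_sum I N)"
    have "(\<Oplus>\<^bsub>M\<^esub>i\<in>I. h i ((r \<odot>\<^bsub>direct_sum I N\<^esub> x) i)) = (\<Oplus>\<^bsub>M\<^esub>i\<in>I. r \<odot>\<^bsub>M\<^esub> h i (x i))"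
      using r x c by (intro M.finsum_cong') (auto simp: mod_hom_smult[OF h] Pi_def PiE_def act_closed)
    then show "copairing I N h (r \<odot>\<^bsub>direct_sum I N\<^esub> x) = r \<odot>\<^bsub>M\<^esub> copairing I N h x"
      using r x S.act_closed[OF r x] c assms(1) by (simp add: copairing_def act_finsum del: direct_sum_simps)
  qed
qed

lemma copairing_single:
  assumes "finite I" and N: "\<And>i. i \<in> I \<Longrightarrow> right_module R (N i)"
    and h: "\<And>i. i \<in> I \<Longrightarrow> h i \<in> mod_hom R (N i) M" and i: "i \<in> I" and a: "a \<in> carrier (N i)"
  shows "copairing I N h (single I N i a) = h i a"
proof -
  have "(\<Oplus>\<^bsub>M\<^esub>j\<in>I. h j (single I N i a j)) = (\<Oplus>\<^bsub>M\<^esub>j\<in>I. if i = j then h i a else \<zero>\<^bsub>M\<^esub>)"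
    using assms mod_hom_closed[OF h]
    by (intro M.finsum_cong')
      (auto simp: single_def right_module.mod_hom_zero[OF N right_module_axioms h])
  also have "\<dots> = h i a"
    using M.finsum_singleton[OF i assms(1), of "\<lambda>_. h i a"] mod_hom_closed[OF h[OF i] a] by simp
  finally show ?thesis using single_closed[where N = N, OF N a] by (simp add: copairing_def)
qed

end

text \<open>Vectors with at most one nonzero coordinate generate. The induction runs over a finite
  set \<open>J\<close> of indices outside of which \<open>x\<close> vanishes, and splits
  \<open>x\<close> into its coordinate at one index and the rest.\<close>

lemma direct_sum_hom_eqI:
  assumes "finite I" and N: "\<And>i. i \<in> I \<Longrightarrow> right_module R (N i)" and M: "right_module R M"
    and f: "f \<in> mod_hom R (direct_sum I N) M" and g: "g \<in> mod_hom R (direct_sum I N) M"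
    and eq: "\<And>i a. i \<in> I \<Longrightarrow> a \<in> carrier (N i) \<Longrightarrow>
      f (single I N i a) = g (single I N i a)"
  shows "f = g"
proof (rule mod_hom_eqI[OF f g])
  interpret M: right_module R M by fact
  interpret S: right_module R "direct_sum I N"
    using M.R.ring_axioms N by (rule right_module_direct_sum)
  have z: "\<zero>\<^bsub>N i\<^esub> \<in> carrier (N i)" if "i \<in> I" for i
    using N[OF that] by (simp add: right_module_def abelian_group_def abelian_monoid.zero_closed)
  have lr: "\<zero>\<^bsub>N i\<^esub> \<oplus>\<^bsub>N i\<^esub> x = x" "x \<oplus>\<^bsub>N i\<^esub> \<zero>\<^bsub>N i\<^esub> = x" if "i \<in> I" "x \<in> carrier (N i)" for i x
    using N[OF that(1)] that(2) by (simp_all add: right_module_def abelian_group_def abelian_monoid.l_zero abelian_monoid.r_zero)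
  have "f x = g x" if "finite J" "J \<subseteq> I" "x \<in> carrier (direct_sum I N)" "\<forall>i\<in>I - J. x i = \<zero>\<^bsub>N i\<^esub>" for J x
    using that
  proof (induction J arbitrary: x rule: finite_induct)
    case empty
    then have "x = \<zero>\<^bsub>direct_sum I N\<^esub>"
      by (intro extensionalityI[of _ I]) (auto simp: PiE_def)
    then show ?case by (simp only: S.mod_hom_zero[OF M f] S.mod_hom_zero[OF M g])
  next
    case (insert i J)
    let ?s = "\<lambda>j\<in>I. if j = i then x i else \<zero>\<^bsub>N j\<^esub>" and ?y = "\<lambda>j\<in>I. if j = i then \<zero>\<^bsub>N j\<^esub> else x j"
    have i: "i \<in> I" "x i \<in> carrier (N i)" using insert by auto
    have c: "?s \<in> carrier (direct_sum I N)" "?y \<in> carrier (direct_sum I N)"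
      using insert z by auto
    have x: "x = ?s \<oplus>\<^bsub>direct_sum I N\<^esub> ?y"
      using insert.prems i by (intro extensionalityI[of _ I]) (auto simp: PiE_def Pi_def lr)
    have "f ?y = g ?y" using insert c by (intro insert.IH) auto
    then have "f (?s \<oplus>\<^bsub>direct_sum I N\<^esub> ?y) = g (?s \<oplus>\<^bsub>direct_sum I N\<^esub> ?y)"
      using eq[OF i, unfolded single_def] by (simp only: mod_hom_add[OF f c] mod_hom_add[OF g c])
    then show ?case using x by argo
  qed
  then show "f x = g x" if "x \<in> carrier (direct_sum I N)" for x
    using that assms(1) by blast
qed

section \<open>Lifting along submodules of free modules\<close>

lemma right_module_regular:
  assumes "ring R" shows "right_module R (regular R)"
proof -
  interpret ring R by fact
  have "abelian_group (regular R)"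
    by (rule abelian_groupI) (auto simp: a_ac intro: exI[of _ "\<ominus>\<^bsub>R\<^esub> x" for x] l_neg bexI[rotated])
  then show ?thesis
    using assms by (simp add: right_module_def right_module_axioms_def l_distr r_distr m_assoc)
qed

text \<open>A map out of the regular module is determined by the image \<open>m\<close> of the unit;
  as \<open>regular\<close> carries multiplication from the right, the map is a \<mapsto> m
  a.\<close>

lemma (in right_module) act_hom:
  assumes "m \<in> carrier M"
  shows "(\<lambda>a\<in>carrier R. a \<odot>\<^bsub>M\<^esub> m) \<in> mod_hom R (regular R) M"
  using assms by (intro mod_homI) (auto simp: act_closed act_add_scalar act_assoc)

lemma free_lift:
  assumes M: "right_module R M" and N: "right_module R N" and I: "finite I"
    and g: "g \<in> mod_hom R M N" "g ` carrier M = carrier N"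
    and f: "f \<in> mod_hom R (direct_sum I (\<lambda>_. regular R)) N"
  shows "\<exists>h\<in>mod_hom R (direct_sum I (\<lambda>_. regular R)) M.
    \<forall>x\<in>carrier (direct_sum I (\<lambda>_. regular R)). g (h x) = f x"
proof -
  interpret M: right_module R M by fact
  interpret N: right_module R N by fact
  define F where "F = direct_sum I (\<lambda>_. regular R)"
  note reg = right_module_regular[OF M.R.ring_axioms]
  interpret F: right_module R F
    unfolding F_def using M.R.ring_axioms reg by (rule right_module_direct_sum)
  define s where "s = single I (\<lambda>_. regular R)"
  have s: "s i a \<in> carrier F" if "a \<in> carrier R" for i a
    unfolding s_def F_def using that by (intro single_closed[OF reg]) simp
  \<comment> \<open>The images of the basis vectors are lifted one by one. Indices outside
    \<open>I\<close> are harmless, since \<open>s i\<close> is then the zero vector, so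
    \<open>m\<close> may be a total function.\<close>
  have "\<exists>m\<in>carrier M. g m = f (s i \<one>\<^bsub>R\<^esub>)" for i
  proof -
    have "f (s i \<one>\<^bsub>R\<^esub>) \<in> g ` carrier M"
      unfolding g(2) using mod_hom_closed[OF f] s[of "\<one>\<^bsub>R\<^esub>" i] by (simp add: F_def)
    then show ?thesis by force
  qed
  then obtain m where m: "\<And>i. m i \<in> carrier M" "\<And>i. g (m i) = f (s i \<one>\<^bsub>R\<^esub>)" by metis
  note hm = M.act_hom[OF m(1)]
  define h where "h = M.copairing I (\<lambda>_. regular R) (\<lambda>i. \<lambda>a\<in>carrier R. a \<odot>\<^bsub>M\<^esub> m i)"
  have h: "h \<in> mod_hom R F M"
    unfolding h_def F_def using I reg hm by (rule M.copairing_hom)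
  have hs: "h (s i a) = a \<odot>\<^bsub>M\<^esub> m i" if "i \<in> I" "a \<in> carrier R" for i a
    using M.copairing_single[where N = "\<lambda>_. regular R" and h = "\<lambda>i. \<lambda>a\<in>carrier R. a \<odot>\<^bsub>M\<^esub> m i",
        OF I reg hm that(1), of a] that(2)
    by (simp add: h_def s_def)
  have "compose (carrier F) g h = f"
  proof (rule direct_sum_hom_eqI[OF I reg N, folded F_def])
    show "compose (carrier F) g h \<in> mod_hom R F N"
      by (rule mod_hom_compose[OF h g(1) F.right_module_axioms])
    show "f \<in> mod_hom R F N" using f by (simp add: F_def)
    fix i a assume i: "i \<in> I" and a: "a \<in> carrier (regular R)"
    have a': "a \<in> carrier R" using a by simp
    have "s i a = a \<odot>\<^bsub>F\<^esub> s i \<one>\<^bsub>R\<^esub>"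
      using a' by (auto simp: s_def single_def F_def intro!: restrict_ext)
    then have "f (s i a) = a \<odot>\<^bsub>N\<^esub> f (s i \<one>\<^bsub>R\<^esub>)"
      using mod_hom_smult[OF f[folded F_def] a' s] by simp
    also have "\<dots> = g (h (s i a))"
      using mod_hom_smult[OF g(1) a' m(1)] by (simp add: hs[OF i a'] m(2))
    finally show "compose (carrier F) g h (single I (\<lambda>_. regular R) i a) = f (single I (\<lambda>_. regular R) i a)"
      using s[OF a', of i] by (simp add: compose_def s_def)
  qed
  then have "g (h x) = f x" if "x \<in> carrier F" for x
    using that by (metis compose_eq)
  then show ?thesis using h unfolding F_def by blast
qed

text \<open>By definition, \<^const>\<open>projective\<close> only tests lifting against modules on sets of natural numbers.\<close>

lemma projective_lift:
  assumes P: "projective R P" and iso: "mod_iso R P U"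
    and M: "right_module R M" "finite (carrier M)" and N: "right_module R N" "finite (carrier N)"
    and g: "g \<in> mod_hom R M N" "g ` carrier M = carrier N" and f: "f \<in> mod_hom R U N"
    and U: "right_module R U"
  shows "\<exists>h\<in>mod_hom R U M. \<forall>x\<in>carrier U. g (h x) = f x"
proof -
  have rP: "right_module R P" using P by (simp add: projective_def)
  obtain M' where M': "M' \<in> fin_modules R" "mod_iso R M' M" by (rule ex_fin_module[OF M])
  obtain N' where N': "N' \<in> fin_modules R" "mod_iso R N' N" by (rule ex_fin_module[OF N])
  note rM' = fin_modulesD(1)[OF M'(1)] and rN' = fin_modulesD(1)[OF N'(1)]
  obtain m where m: "m \<in> mod_hom R M' M" "bij_betw m (carrier M') (carrier M)"
    using M'(2) by (auto simp: mod_iso_def)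
  obtain n where n: "n \<in> mod_hom R N' N" "bij_betw n (carrier N') (carrier N)"
    using N'(2) by (auto simp: mod_iso_def)
  obtain n' where n': "n' \<in> mod_hom R N N'" "bij_betw n' (carrier N) (carrier N')"
    "\<And>x. x \<in> carrier N' \<Longrightarrow> n' (n x) = x" "\<And>x. x \<in> carrier N \<Longrightarrow> n (n' x) = x"
    using mod_hom_inverse[OF n rN'] by blast
  obtain p where p: "p \<in> mod_hom R P U" "bij_betw p (carrier P) (carrier U)"
    using iso by (auto simp: mod_iso_def)
  obtain p' where p': "p' \<in> mod_hom R U P" "bij_betw p' (carrier U) (carrier P)"
    "\<And>x. x \<in> carrier P \<Longrightarrow> p' (p x) = x" "\<And>x. x \<in> carrier U \<Longrightarrow> p (p' x) = x"
    using mod_hom_inverse[OF p rP] by blast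
  \<comment> \<open>\<open>g'\<close> and \<open>f'\<close> are \<open>g\<close> and
    \<open>f\<close> moved to the copies on natural numbers, where projectivity of \<open>P\<close>
    can be tested; the lift found there is moved back by \<open>m\<close> and
    \<open>p'\<close>.\<close>
  define g' where "g' = compose (carrier M') n' (compose (carrier M') g m)"
  define f' where "f' = compose (carrier P) n' (compose (carrier P) f p)"
  have g': "g' \<in> mod_hom R M' N'"
    unfolding g'_def by (rule mod_hom_compose[OF mod_hom_compose[OF m(1) g(1) rM'] n'(1) rM'])
  have f': "f' \<in> mod_hom R P N'"
    unfolding f'_def by (rule mod_hom_compose[OF mod_hom_compose[OF p(1) f rP] n'(1) rP])
  have "g' ` carrier M' = n' ` g ` m ` carrier M'"
    unfolding g'_def by (auto simp: compose_def image_image)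
  then have surj: "g' ` carrier M' = carrier N'"
    using m(2) g(2) n'(2) by (simp add: bij_betw_def)
  obtain h where h: "h \<in> mod_hom R P M'" "\<And>x. x \<in> carrier P \<Longrightarrow> g' (h x) = f' x"
    using P M'(1) N'(1) g' f' surj unfolding projective_def by meson
  have "g (m (h (p' x))) = f x" if x: "x \<in> carrier U" for x
  proof -
    have c: "p' x \<in> carrier P" using mod_hom_closed[OF p'(1) x] .
    have c1: "h (p' x) \<in> carrier M'" using mod_hom_closed[OF h(1) c] .
    have c2: "g (m (h (p' x))) \<in> carrier N"
      using mod_hom_closed[OF g(1) mod_hom_closed[OF m(1) c1]] .
    have "n' (g (m (h (p' x)))) = g' (h (p' x))" using c1 by (simp add: g'_def compose_def)
    also have "\<dots> = n' (f x)"
      using h(2)[OF c] c p'(4)[OF x] by (simp add: f'_def compose_def)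
    finally have "n (n' (g (m (h (p' x))))) = n (n' (f x))" by (rule arg_cong)
    then show ?thesis unfolding n'(4)[OF c2] n'(4)[OF mod_hom_closed[OF f x]] .
  qed
  moreover have "compose (carrier U) m (compose (carrier U) h p') \<in> mod_hom R U M"
    by (rule mod_hom_compose[OF mod_hom_compose[OF p'(1) h(1) U] m(1) U])
  ultimately show ?thesis
    by (intro bexI[of _ "compose (carrier U) m (compose (carrier U) h p')"]) (auto simp: compose_def)
qed

text \<open>\<open>hereditary\<close> speaks of modules on natural numbers only. So the free module
  is copied to \<open>F'\<close>, projectivity of \<open>F'\<close> is read off from
  \<open>free_lift\<close>, heredity is applied to the image of \<open>U\<close> in it, and
  \<open>projective_lift\<close> brings the lifting property back to \<open>U\<close>.\<close>

lemma hereditary_lift: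
  assumes her: "hereditary R" and R: "ring R" "finite (carrier R)" and I: "finite I"
    and U: "submodule U R (direct_sum I (\<lambda>_. regular R))"
    and M: "right_module R M" "finite (carrier M)" and N: "right_module R N" "finite (carrier N)"
    and g: "g \<in> mod_hom R M N" "g ` carrier M = carrier N"
    and f: "f \<in> mod_hom R (sub_mod (direct_sum I (\<lambda>_. regular R)) U) N"
  shows "\<exists>h\<in>mod_hom R (sub_mod (direct_sum I (\<lambda>_. regular R)) U) M. \<forall>x\<in>U. g (h x) = f x"
proof -
  define F where "F = direct_sum I (\<lambda>_. regular R)"
  interpret F: right_module R F
    unfolding F_def by (rule right_module_direct_sum[OF R(1) right_module_regular[OF R(1)]])
  have finF: "finite (carrier F)" using I R(2) by (auto simp: F_def intro!: finite_PiE)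
  obtain F' where F': "F' \<in> fin_modules R" "mod_iso R F' F"
    by (rule ex_fin_module[OF F.right_module_axioms finF])
  note rF' = fin_modulesD(1)[OF F'(1)]
  obtain p where p: "p \<in> mod_hom R F F'" "bij_betw p (carrier F) (carrier F')"
    using mod_iso_sym[OF F'(2) rF'] by (auto simp: mod_iso_def)
  obtain p' where p': "p' \<in> mod_hom R F' F" "bij_betw p' (carrier F') (carrier F)"
    "\<And>x. x \<in> carrier F \<Longrightarrow> p' (p x) = x" "\<And>x. x \<in> carrier F' \<Longrightarrow> p (p' x) = x"
    using mod_hom_inverse[OF p F.right_module_axioms] by blast
  have "projective R F'"
    unfolding projective_def
  proof (intro conjI ballI impI)
    fix M N g f
    assume M: "M \<in> fin_modules R" and N: "N \<in> fin_modules R" and g: "g \<in> mod_hom R M N"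
      "g ` carrier M = carrier N" and f: "f \<in> mod_hom R F' N"
    obtain h where h: "h \<in> mod_hom R F M" "\<forall>x\<in>carrier F. g (h x) = compose (carrier F) f p x"
      using free_lift[OF fin_modulesD(1)[OF M] fin_modulesD(1)[OF N] I g
          mod_hom_compose[OF p(1) f F.right_module_axioms, unfolded F_def]]
      unfolding F_def by blast
    have "g (h (p' x)) = f x" if "x \<in> carrier F'" for x
      using h(2) mod_hom_closed[OF p'(1) that] p'(4)[OF that] by (simp add: compose_def)
    then show "\<exists>h\<in>mod_hom R F' M. \<forall>x\<in>carrier F'. g (h x) = f x"
      by (intro bexI[OF _ mod_hom_compose[OF p'(1) h(1) rF']]) (simp add: compose_def)
  qed (fact rF')
  moreover have U': "submodule U R F" using U by (simp add: F_def)
  ultimately have "projective R (sub_mod F' (p ` U))"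
    using her F'(1) F.submodule_image[OF rF' p(1) U'] by (auto simp: hereditary_def)
  moreover have UF: "U \<subseteq> carrier F" by (rule F.submoduleD(1)[OF U'])
  then have "mod_iso R (sub_mod F U) (sub_mod F' (p ` U))"
    using p by (intro F.mod_iso_sub_mod_image U') (auto simp: bij_betw_def inj_on_subset)
  then have "mod_iso R (sub_mod F' (p ` U)) (sub_mod F U)"
    by (rule mod_iso_sym[OF _ F.right_module_sub_mod[OF U']])
  ultimately show ?thesis
    using projective_lift[OF _ _ M N g f[folded F_def] F.right_module_sub_mod[OF U']]
    by (simp add: F_def)
qed


section \<open>Linear functionals\<close>

text \<open>Finiteness of the carrier stands in for bases and dimension: subspaces maximal with a
  given property exist, and they supply both hyperplanes and an induction principle.\<close>

locale finite_space = right_module K V + field K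
  for K :: "('k, 'l) ring_scheme" (structure) and V :: "('k, 'v) module" (structure) +
  assumes finite_V: "finite (carrier V)"
begin

definition line :: "'v \<Rightarrow> 'v set" where
  "line v = (\<lambda>c. c \<odot>\<^bsub>V\<^esub> v) ` carrier K"

abbreviation functionals :: "('v \<Rightarrow> 'k) set" where
  "functionals \<equiv> mod_hom K V (regular K)"

lemma right_module_K: "right_module K (regular K)"
  by (rule right_module_regular[OF R.ring_axioms])

lemma submodule_line:
  assumes v: "v \<in> carrier V" shows "submodule (line v) K V"
proof (rule sub_moduleI)
  show "line v \<subseteq> carrier V" using v by (auto simp: line_def act_closed)
  show "\<zero>\<^bsub>V\<^esub> \<in> line v" using v by (auto simp: line_def image_iff intro!: bexI[of _ \<zero>])
  show "x \<oplus>\<^bsub>V\<^esub> y \<in> line v" if "x \<in> line v" "y \<in> line v" for x y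
    using that v unfolding line_def by (auto simp flip: act_add_scalar)
  show "r \<odot>\<^bsub>V\<^esub> x \<in> line v" if "r \<in> carrier K" "x \<in> line v" for r x
    using that v unfolding line_def by (auto simp flip: act_assoc)
qed

lemma mem_add_line:
  "x \<in> set_add V W (line v) \<longleftrightarrow> (\<exists>w\<in>W. \<exists>c\<in>carrier K. x = w \<oplus>\<^bsub>V\<^esub> c \<odot>\<^bsub>V\<^esub> v)"
  by (auto simp: mem_set_add line_def)

lemma subset_add_line:
  assumes "W \<subseteq> carrier V" "v \<in> carrier V" shows "W \<subseteq> set_add V W (line v)"
proof
  fix x assume "x \<in> W"
  then show "x \<in> set_add V W (line v)"
    unfolding mem_add_line using assms
    by (intro bexI[of _ x] bexI[of _ \<zero>]) auto
qed

lemma self_add_line: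
  assumes "submodule W K V" "v \<in> carrier V" shows "v \<in> set_add V W (line v)"
  unfolding mem_add_line using submoduleD(2)[OF assms(1)] assms(2)
  by (intro bexI[of _ "\<zero>\<^bsub>V\<^esub>"] bexI[of _ \<one>]) (auto simp: act_one)

lemma diff_zero: "x \<in> carrier V \<Longrightarrow> x \<ominus>\<^bsub>V\<^esub> \<zero>\<^bsub>V\<^esub> = x"
  by (simp add: a_minus_def)

lemma ex_maximal_submodule:
  assumes "submodule W K V" "P W"
  obtains H where "submodule H K V" "P H" "\<And>L. submodule L K V \<Longrightarrow> P L \<Longrightarrow> H \<subseteq> L \<Longrightarrow> L = H"
proof -
  obtain H where H: "H \<in> {W. submodule W K V \<and> P W}" "\<forall>L\<in>{W. submodule W K V \<and> P W}. H \<le> L \<longrightarrow> H = L"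
    using finite_has_maximal[OF finite_submodules[OF finite_V], of P] assms by blast
  have "L = H" if "submodule L K V" "P L" "H \<subseteq> L" for L using H(2) that by blast
  moreover have "submodule H K V" "P H" using H(1) by simp_all
  ultimately show ?thesis using that by blast
qed

text \<open>A subspace \<open>H\<close> maximal among those that contain \<open>W\<close> and avoid
  \<open>v\<close> is a hyperplane complementary to the line of \<open>v\<close>. The functional is
  the coordinate along \<open>v\<close> modulo \<open>H\<close>.\<close>

lemma ex_separating_functional:
  assumes W: "submodule W K V" and v: "v \<in> carrier V" "v \<notin> W"
  shows "\<exists>l\<in>functionals. (\<forall>w\<in>W. l w = \<zero>) \<and> l v = \<one>"
proof -
  obtain H where H: "submodule H K V" "W \<subseteq> H \<and> v \<notin> H"
    and max: "\<And>L. submodule L K V \<Longrightarrow> W \<subseteq> L \<and> v \<notin> L \<Longrightarrow> H \<subseteq> L \<Longrightarrow> L = H"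
    using ex_maximal_submodule[of W "\<lambda>H. W \<subseteq> H \<and> v \<notin> H"] W v by blast
  note D = submoduleD[OF H(1)]
  have scale: "u \<in> H" if u: "u \<in> carrier V" and c: "c \<in> carrier K" "c \<noteq> \<zero>" "c \<odot>\<^bsub>V\<^esub> u \<in> H" for u c
  proof -
    have "inv c \<odot>\<^bsub>V\<^esub> (c \<odot>\<^bsub>V\<^esub> u) = u"
      using u c by (simp flip: act_assoc add: act_one field_Units)
    then show ?thesis using D(4)[of "inv c", OF _ c(3)] c(1,2) by (simp add: field_Units)
  qed
  have ex: "\<exists>c\<in>carrier K. u \<ominus>\<^bsub>V\<^esub> c \<odot>\<^bsub>V\<^esub> v \<in> H" if u: "u \<in> carrier V" for u
  proof (cases "u \<in> H")
    case True
    then show ?thesis using v u by (intro bexI[of _ \<zero>]) (auto simp: diff_zero)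
  next
    case False
    \<comment> \<open>By maximality \<open>v\<close> lies in the sum of \<open>H\<close> and the
      line of \<open>u\<close>, so v = h + d u with \<open>d\<close> nonzero. Modulo
      \<open>H\<close> this makes \<open>inv d\<close> the coordinate of \<open>u\<close>.\<close>
    let ?L = "set_add V H (line u)"
    have L: "submodule ?L K V" by (rule submodule_set_add[OF H(1) submodule_line[OF u]])
    have HL: "H \<subseteq> ?L" by (rule subset_add_line[OF D(1) u])
    have "?L \<noteq> H" using self_add_line[OF H(1) u] False by blast
    then have "v \<in> ?L" using max[OF L] HL H(2) by blast
    then obtain h d where hd: "h \<in> H" "d \<in> carrier K" "v = h \<oplus>\<^bsub>V\<^esub> d \<odot>\<^bsub>V\<^esub> u"
      by (auto simp: mem_add_line)
    have d: "d \<noteq> \<zero>" using hd H(2) u D(6)[OF hd(1)] by auto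
    have "d \<odot>\<^bsub>V\<^esub> (u \<ominus>\<^bsub>V\<^esub> inv d \<odot>\<^bsub>V\<^esub> v) = d \<odot>\<^bsub>V\<^esub> u \<ominus>\<^bsub>V\<^esub> d \<odot>\<^bsub>V\<^esub> (inv d \<odot>\<^bsub>V\<^esub> v)"
      using u v d hd(2) by (simp add: a_minus_def act_add act_closed act_minus field_Units)
    also have "d \<odot>\<^bsub>V\<^esub> (inv d \<odot>\<^bsub>V\<^esub> v) = v"
      using v d hd(2) by (simp flip: act_assoc add: act_one field_Units)
    also have "d \<odot>\<^bsub>V\<^esub> u \<ominus>\<^bsub>V\<^esub> v = \<ominus>\<^bsub>V\<^esub> h"
      using D(6)[OF hd(1)] act_closed[OF hd(2) u] unfolding hd(3)
      by (simp add: a_minus_def M.minus_add M.a_ac M.r_neg)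
    also have "\<dots> \<in> H" using D(5)[OF hd(1)] .
    finally have "u \<ominus>\<^bsub>V\<^esub> inv d \<odot>\<^bsub>V\<^esub> v \<in> H"
      using scale[OF _ hd(2) d] u v d hd(2) by (simp add: act_closed field_Units)
    then show ?thesis using d hd(2) by (intro bexI[of _ "inv d"]) (auto simp: field_Units)
  qed
  have uniq: "c = d" if "u \<in> carrier V" "c \<in> carrier K" "d \<in> carrier K"
    "u \<ominus>\<^bsub>V\<^esub> c \<odot>\<^bsub>V\<^esub> v \<in> H" "u \<ominus>\<^bsub>V\<^esub> d \<odot>\<^bsub>V\<^esub> v \<in> H" for u c d
  proof (rule ccontr)
    assume "c \<noteq> d"
    have "c = (c \<ominus> d) \<oplus> d" using that(2,3) by algebra
    then have ne: "c \<ominus> d \<noteq> \<zero>" using \<open>c \<noteq> d\<close> that(3) by auto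
    \<comment> \<open>The difference of the two elements assumed in \<open>H\<close> is (c - d) v;
      as a nonzero multiple of \<open>v\<close> it would put \<open>v\<close> itself into
      \<open>H\<close>.\<close>
    have "(c \<ominus> d) \<odot>\<^bsub>V\<^esub> v = c \<odot>\<^bsub>V\<^esub> v \<ominus>\<^bsub>V\<^esub> d \<odot>\<^bsub>V\<^esub> v"
    proof -
      have "(\<ominus> d) \<odot>\<^bsub>V\<^esub> v \<oplus>\<^bsub>V\<^esub> d \<odot>\<^bsub>V\<^esub> v = \<zero>\<^bsub>V\<^esub>"
        using that v by (simp flip: act_add_scalar add: R.l_neg)
      then have "(\<ominus> d) \<odot>\<^bsub>V\<^esub> v = \<ominus>\<^bsub>V\<^esub> (d \<odot>\<^bsub>V\<^esub> v)"
        using that v by (intro M.minus_equality[symmetric]) (simp_all add: act_closed)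
      then show ?thesis using that v by (simp add: a_minus_def act_add_scalar)
    qed
    also have "\<dots> = (u \<ominus>\<^bsub>V\<^esub> d \<odot>\<^bsub>V\<^esub> v) \<ominus>\<^bsub>V\<^esub> (u \<ominus>\<^bsub>V\<^esub> c \<odot>\<^bsub>V\<^esub> v)"
      using that v by (simp add: a_minus_def M.minus_add act_closed M.a_ac M.r_neg1 M.r_neg2)
    also have "\<dots> \<in> H" using submodule_diff[OF H(1)] that by simp
    finally have "v \<in> H" using scale[OF v(1) _ ne] that by simp
    then show False using H(2) by simp
  qed
  define l where "l = (\<lambda>u\<in>carrier V. THE c. c \<in> carrier K \<and> u \<ominus>\<^bsub>V\<^esub> c \<odot>\<^bsub>V\<^esub> v \<in> H)"
  have lI: "l u = c" if "u \<in> carrier V" "c \<in> carrier K" "u \<ominus>\<^bsub>V\<^esub> c \<odot>\<^bsub>V\<^esub> v \<in> H" for u c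
  proof -
    have "(THE c. c \<in> carrier K \<and> u \<ominus>\<^bsub>V\<^esub> c \<odot>\<^bsub>V\<^esub> v \<in> H) = c"
      by (rule the_equality, intro conjI that(2,3), elim conjE, rule uniq[OF that(1) _ that(2) _ that(3)])
    then show ?thesis using that(1) by (simp add: l_def)
  qed
  have l: "l u \<in> carrier K" "u \<ominus>\<^bsub>V\<^esub> l u \<odot>\<^bsub>V\<^esub> v \<in> H" if "u \<in> carrier V" for u
  proof -
    obtain c where c: "c \<in> carrier K" "u \<ominus>\<^bsub>V\<^esub> c \<odot>\<^bsub>V\<^esub> v \<in> H" using ex[OF \<open>u \<in> carrier V\<close>] by blast
    show "l u \<in> carrier K" "u \<ominus>\<^bsub>V\<^esub> l u \<odot>\<^bsub>V\<^esub> v \<in> H"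
      using c lI[OF \<open>u \<in> carrier V\<close> c] by simp_all
  qed
  have "l \<in> functionals"
  proof (rule mod_homI)
    show "l \<in> carrier V \<rightarrow>\<^sub>E carrier (regular K)"
      using l(1) by (intro PiE_I) (simp_all, simp add: l_def)
  next
    fix x y assume xy: "x \<in> carrier V" "y \<in> carrier V"
    have "(x \<oplus>\<^bsub>V\<^esub> y) \<ominus>\<^bsub>V\<^esub> (l x \<oplus> l y) \<odot>\<^bsub>V\<^esub> v = (x \<ominus>\<^bsub>V\<^esub> l x \<odot>\<^bsub>V\<^esub> v) \<oplus>\<^bsub>V\<^esub> (y \<ominus>\<^bsub>V\<^esub> l y \<odot>\<^bsub>V\<^esub> v)"
      using xy v l(1) by (simp add: act_add_scalar a_minus_def M.minus_add act_closed M.a_ac)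
    also have "\<dots> \<in> H" using D(3) l(2) xy by blast
    finally show "l (x \<oplus>\<^bsub>V\<^esub> y) = l x \<oplus>\<^bsub>regular K\<^esub> l y"
      using xy l(1) by (simp add: lI)
  next
    fix r x assume rx: "r \<in> carrier K" "x \<in> carrier V"
    have "r \<odot>\<^bsub>V\<^esub> x \<ominus>\<^bsub>V\<^esub> (l x \<otimes> r) \<odot>\<^bsub>V\<^esub> v = r \<odot>\<^bsub>V\<^esub> (x \<ominus>\<^bsub>V\<^esub> l x \<odot>\<^bsub>V\<^esub> v)"
      using rx v l(1) by (simp add: act_assoc a_minus_def act_add act_closed act_minus)
    also have "\<dots> \<in> H" using D(4) l(2) rx by blast
    finally show "l (r \<odot>\<^bsub>V\<^esub> x) = r \<odot>\<^bsub>regular K\<^esub> l x"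
      using rx l(1) by (simp add: lI act_closed)
  qed
  moreover have "l w = \<zero>" if "w \<in> W" for w
    using that H(2) D(6)[of w] v by (intro lI) (auto simp: diff_zero)
  moreover have "l v = \<one>"
    using v D(2) by (intro lI) (auto simp: act_one M.r_neg a_minus_def)
  ultimately show ?thesis by blast
qed

lemma functional_separates:
  assumes "v \<in> carrier V" "\<And>l. l \<in> functionals \<Longrightarrow> l v = \<zero>"
  shows "v = \<zero>\<^bsub>V\<^esub>"
proof (rule ccontr)
  assume "v \<noteq> \<zero>\<^bsub>V\<^esub>"
  then obtain l where "l \<in> functionals" "l v = \<one>"
    using ex_separating_functional[OF submodule_zero assms(1)] by blast
  then show False using assms(2)[of l] by simp
qed

text \<open>A subspace of \<open>T\<close> that is maximal with property \<open>P\<close> must be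
  \<open>T\<close>, since otherwise a vector of \<open>T\<close> outside it could be adjoined. This
  replaces induction on the dimension.\<close>

lemma subspace_induct [consumes 1, case_names zero add]:
  assumes T: "submodule T K V" and zero: "P {\<zero>\<^bsub>V\<^esub>}"
    and add: "\<And>W v. submodule W K V \<Longrightarrow> P W \<Longrightarrow> v \<in> carrier V \<Longrightarrow> v \<notin> W \<Longrightarrow> P (set_add V W (line v))"
  shows "P T"
proof -
  note D = submoduleD[OF T]
  obtain W where W: "submodule W K V" "W \<subseteq> T \<and> P W"
    and max: "\<And>L. submodule L K V \<Longrightarrow> L \<subseteq> T \<and> P L \<Longrightarrow> W \<subseteq> L \<Longrightarrow> L = W"
    using ex_maximal_submodule[of "{\<zero>\<^bsub>V\<^esub>}" "\<lambda>L. L \<subseteq> T \<and> P L"] submodule_zero zero D(2) by blast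
  have "T = W"
  proof (rule ccontr)
    assume "T \<noteq> W"
    then obtain v where v: "v \<in> T" "v \<notin> W" using W(2) by blast
    have vV: "v \<in> carrier V" using D(6) v by simp
    let ?L = "set_add V W (line v)"
    have "?L \<subseteq> T"
    proof
      fix x assume "x \<in> ?L"
      then obtain w c where "w \<in> W" "c \<in> carrier K" "x = w \<oplus>\<^bsub>V\<^esub> c \<odot>\<^bsub>V\<^esub> v"
        unfolding mem_add_line by blast
      then show "x \<in> T" using W(2) v(1) D(3)[of w "c \<odot>\<^bsub>V\<^esub> v"] D(4) by blast
    qed
    moreover have "P ?L" using add[OF W(1) _ vV v(2)] W(2) by simp
    moreover have "submodule ?L K V" by (rule submodule_set_add[OF W(1) submodule_line[OF vV]])
    moreover have "W \<subseteq> ?L" using subset_add_line[OF submoduleD(1)[OF W(1)] vV] .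
    ultimately have "?L = W" using max by simp
    then show False using self_add_line[OF W(1) vV] v(2) by simp
  qed
  then show ?thesis using W(2) by simp
qed

lemma functional_add_scaled:
  assumes "f \<in> functionals" "g \<in> functionals" "c \<in> carrier K"
  shows "(\<lambda>x\<in>carrier V. f x \<oplus> c \<otimes> g x) \<in> functionals"
proof (rule mod_homI)
  note fg = mod_hom_closed[OF assms(1), simplified] mod_hom_closed[OF assms(2), simplified]
  show "(\<lambda>x\<in>carrier V. f x \<oplus> c \<otimes> g x) \<in> carrier V \<rightarrow>\<^sub>E carrier (regular K)"
    using assms(3) by (intro PiE_I) (simp_all add: fg)
qed (use assms(3) mod_hom_closed[OF assms(1), simplified] mod_hom_closed[OF assms(2), simplified] in
  \<open>simp_all add: mod_hom_add[OF assms(1)] mod_hom_add[OF assms(2)] mod_hom_smult[OF assms(1)]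
    mod_hom_smult[OF assms(2)] act_closed r_distr l_distr R.a_ac R.m_assoc\<close>)

text \<open>By \<open>subspace_induct\<close>: an extension of the restriction to \<open>W\<close>
  is corrected at the new vector \<open>v\<close> by a multiple of a functional that vanishes on
  \<open>W\<close> and takes the value \<open>\<one>\<close> at \<open>v\<close>.\<close>

lemma functional_extends:
  assumes "submodule W K V" "f \<in> mod_hom K (sub_mod V W) (regular K)"
  shows "\<exists>F\<in>functionals. \<forall>w\<in>W. F w = f w"
  using assms
proof (induction arbitrary: f rule: subspace_induct)
  case zero
  interpret Z: right_module K "sub_mod V {\<zero>\<^bsub>V\<^esub>}" by (rule right_module_sub_mod[OF submodule_zero])
  have "f \<zero>\<^bsub>V\<^esub> = \<zero>" using Z.mod_hom_zero[OF right_module_K zero.prems] by simp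
  then show ?case by (intro bexI[of _ "\<lambda>x\<in>carrier V. \<zero>"]) (auto intro!: mod_homI simp: act_closed)
next
  case (add W v)
  let ?W = "set_add V W (line v)"
  note D = submoduleD[OF add.hyps(1)]
  note W' = submodule_set_add[OF add.hyps(1) submodule_line[OF add.hyps(2)]]
  have sub: "W \<subseteq> ?W" using subset_add_line[OF D(1) add.hyps(2)] .
  have vW: "v \<in> ?W" using self_add_line[OF add.hyps(1,2)] .
  have "restrict f W \<in> mod_hom K (sub_mod V W) (regular K)"
    using sub D(3,4) mod_hom_closed[OF add.prems] mod_hom_add[OF add.prems] mod_hom_smult[OF add.prems]
    by (intro mod_homI) (auto simp: subset_iff)
  then obtain F where F: "F \<in> functionals" "\<forall>w\<in>W. F w = f w" using add.IH by force
  obtain l where l: "l \<in> functionals" "\<forall>w\<in>W. l w = \<zero>" "l v = \<one>"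
    using ex_separating_functional[OF add.hyps] by blast
  have c: "F v \<in> carrier K" "f v \<in> carrier K"
    using mod_hom_closed[OF F(1) add.hyps(2)] mod_hom_closed[OF add.prems] vW by auto
  define G where "G = (\<lambda>x\<in>carrier V. F x \<oplus> (f v \<ominus> F v) \<otimes> l x)"
  have G: "G \<in> functionals"
    unfolding G_def using c by (intro functional_add_scaled F l) simp
  have "G x = f x" if "x \<in> ?W" for x
  proof -
    obtain w d where wd: "w \<in> W" "d \<in> carrier K" "x = w \<oplus>\<^bsub>V\<^esub> d \<odot>\<^bsub>V\<^esub> v"
      using \<open>x \<in> ?W\<close> unfolding mem_add_line by blast
    have wV: "w \<in> carrier V" using D(6)[OF wd(1)] .
    have dv: "d \<odot>\<^bsub>V\<^esub> v \<in> ?W" using submoduleD(4)[OF W' wd(2) vW] .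
    have fw: "f w \<in> carrier K" using mod_hom_closed[OF add.prems] wd(1) sub by auto
    have "f x = f w \<oplus> f v \<otimes> d"
      using mod_hom_add[OF add.prems, of w "d \<odot>\<^bsub>V\<^esub> v"] mod_hom_smult[OF add.prems wd(2), of v] wd sub dv vW
      by auto
    moreover have "G w = f w"
      using F(2) l(2) wd(1) wV c fw by (simp add: G_def)
    moreover have "G v = f v"
  proof -
    have "G v = F v \<oplus> (f v \<ominus> F v) \<otimes> \<one>" using l(3) add.hyps(2) by (simp add: G_def)
    also have "\<dots> = f v" using c by algebra
    finally show ?thesis .
  qed
    ultimately show ?thesis
      using mod_hom_add[OF G wV act_closed[OF wd(2) add.hyps(2)]] mod_hom_smult[OF G wd(2) add.hyps(2)] wd(3)
      by simp
  qed
  then show ?case using G by blast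
qed

text \<open>The form relative to \<open>W\<close>, with \<open>\<psi>\<close> killing all
  functionals that vanish on \<open>W\<close>, is what makes \<open>subspace_induct\<close>
  applicable to the surjectivity of the map from a space to its double dual;
  \<open>double_dual\<close> is the case of the whole space.\<close>

lemma double_dual_aux:
  assumes "submodule W K V"
    and "\<And>f g c. f \<in> functionals \<Longrightarrow> g \<in> functionals \<Longrightarrow> c \<in> carrier K \<Longrightarrow>
      \<psi> (\<lambda>x\<in>carrier V. f x \<oplus> c \<otimes> g x) = \<psi> f \<oplus> c \<otimes> \<psi> g"
    and "\<And>f. f \<in> functionals \<Longrightarrow> \<psi> f \<in> carrier K"
    and "\<And>f. f \<in> functionals \<Longrightarrow> (\<forall>w\<in>W. f w = \<zero>) \<Longrightarrow> \<psi> f = \<zero>"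
  shows "\<exists>a\<in>W. \<forall>f\<in>functionals. \<psi> f = f a"
  using assms
proof (induction arbitrary: \<psi> rule: subspace_induct)
  case zero
  have "f \<zero>\<^bsub>V\<^esub> = \<zero>" if "f \<in> functionals" for f
    using mod_hom_zero[OF right_module_K that] by simp
  then show ?case using zero(3) by simp
next
  case (add W v)
  let ?W = "set_add V W (line v)"
  note D = submoduleD[OF add.hyps(1)]
  note W' = submodule_set_add[OF add.hyps(1) submodule_line[OF add.hyps(2)]]
  obtain l where l: "l \<in> functionals" "\<forall>w\<in>W. l w = \<zero>" "l v = \<one>"
    using ex_separating_functional[OF add.hyps] by blast
  note lin = add.prems(1) and closed = add.prems(2) and van = add.prems(3)
  have cl: "f x \<in> carrier K" if "f \<in> functionals" "x \<in> carrier V" for f x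
    using mod_hom_closed[OF that] by simp
  have v: "v \<in> carrier V" by (fact add.hyps)
  \<comment> \<open>Subtracting \<open>\<psi> l\<close> times the evaluation at \<open>v\<close>
    makes the induction hypothesis for \<open>W\<close> applicable. The point found in
    \<open>W\<close> is later shifted by \<open>\<psi> l\<close> times \<open>v\<close>.\<close>
  define \<psi>' where "\<psi>' = (\<lambda>f. \<psi> f \<ominus> \<psi> l \<otimes> f v)"
  have "\<exists>a\<in>W. \<forall>f\<in>functionals. \<psi>' f = f a"
  proof (rule add.IH)
    fix f g c assume fg: "f \<in> functionals" "g \<in> functionals" "c \<in> carrier K"
    then have c: "\<psi> f \<in> carrier K" "\<psi> g \<in> carrier K" "\<psi> l \<in> carrier K" "f v \<in> carrier K" "g v \<in> carrier K"
      using closed l(1) cl v by auto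
    have "\<psi>' (\<lambda>x\<in>carrier V. f x \<oplus> c \<otimes> g x) = \<psi> f \<oplus> c \<otimes> \<psi> g \<ominus> \<psi> l \<otimes> (f v \<oplus> c \<otimes> g v)"
      using fg v by (simp add: \<psi>'_def lin)
    also have "\<dots> = \<psi>' f \<oplus> c \<otimes> \<psi>' g"
      using fg c unfolding \<psi>'_def by algebra
    finally show "\<psi>' (\<lambda>x\<in>carrier V. f x \<oplus> c \<otimes> g x) = \<psi>' f \<oplus> c \<otimes> \<psi>' g" .
  next
    fix f assume f: "f \<in> functionals"
    then show "\<psi>' f \<in> carrier K" using closed l(1) cl v by (simp add: \<psi>'_def)
    assume fW: "\<forall>w\<in>W. f w = \<zero>"
    \<comment> \<open>\<open>f\<close> is known to vanish on \<open>W\<close> only; \<open>g\<close>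
      is corrected by a multiple of \<open>l\<close> so as to vanish at \<open>v\<close> too. Then
      \<open>\<psi> g = \<zero>\<close> reads
      \<open>\<psi> f = f v \<otimes> \<psi> l\<close>.\<close>
    define g where "g = (\<lambda>x\<in>carrier V. f x \<oplus> (\<ominus> f v) \<otimes> l x)"
    have c: "f v \<in> carrier K" "\<psi> f \<in> carrier K" "\<psi> l \<in> carrier K" using f cl v closed l(1) by auto
    have g: "g \<in> functionals" unfolding g_def using c by (intro functional_add_scaled f l) simp
    have "g x = \<zero>" if "x \<in> ?W" for x
    proof -
      obtain w d where wd: "w \<in> W" "d \<in> carrier K" "x = w \<oplus>\<^bsub>V\<^esub> d \<odot>\<^bsub>V\<^esub> v"
        using \<open>x \<in> ?W\<close> by (auto simp: mem_add_line)
      have wV: "w \<in> carrier V" using D(6)[OF wd(1)] .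
      have "g w = \<zero>" using fW l(2) wd(1) wV c by (simp add: g_def)
      moreover have "g v = \<zero>" using v c l(3) by (simp add: g_def R.r_neg)
      ultimately show ?thesis
        using wd(2) by (simp add: wd(3) mod_hom_add[OF g wV act_closed[OF wd(2) v]] mod_hom_smult[OF g wd(2) v])
    qed
    then have "\<psi> g = \<zero>" using van[OF g] by simp
    then have "\<psi> f \<oplus> (\<ominus> f v) \<otimes> \<psi> l = \<zero>" using lin[OF f l(1), of "\<ominus> f v"] c by (simp add: g_def)
    then show "\<psi>' f = \<zero>" using c unfolding \<psi>'_def by algebra
  qed
  then obtain a where a: "a \<in> W" "\<forall>f\<in>functionals. \<psi>' f = f a" by blast
  have aV: "a \<in> carrier V" using D(6)[OF a(1)] .
  have pl: "\<psi> l \<in> carrier K" using closed l(1) by simp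
  have "\<psi> f = f (a \<oplus>\<^bsub>V\<^esub> \<psi> l \<odot>\<^bsub>V\<^esub> v)" if f: "f \<in> functionals" for f
  proof -
    have "\<psi> f = (\<psi> f \<ominus> \<psi> l \<otimes> f v) \<oplus> f v \<otimes> \<psi> l"
      using closed[OF f] pl cl[OF f v] by algebra
    also have "\<psi> f \<ominus> \<psi> l \<otimes> f v = f a" using a(2) f by (auto simp: \<psi>'_def)
    finally have "\<psi> f = f a \<oplus> f v \<otimes> \<psi> l" .
    then show ?thesis
      by (simp add: mod_hom_add[OF f aV act_closed[OF pl v]] mod_hom_smult[OF f pl v])
  qed
  moreover have "a \<oplus>\<^bsub>V\<^esub> \<psi> l \<odot>\<^bsub>V\<^esub> v \<in> ?W" unfolding mem_add_line using a(1) pl by blast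
  ultimately show ?case by blast
qed

lemma double_dual:
  assumes add: "\<And>f g. f \<in> functionals \<Longrightarrow> g \<in> functionals \<Longrightarrow> \<psi> (\<lambda>x\<in>carrier V. f x \<oplus> g x) = \<psi> f \<oplus> \<psi> g"
    and smult: "\<And>f c. f \<in> functionals \<Longrightarrow> c \<in> carrier K \<Longrightarrow> \<psi> (\<lambda>x\<in>carrier V. c \<otimes> f x) = c \<otimes> \<psi> f"
    and closed: "\<And>f. f \<in> functionals \<Longrightarrow> \<psi> f \<in> carrier K"
  shows "\<exists>a\<in>carrier V. \<forall>f\<in>functionals. \<psi> f = f a"
proof (rule double_dual_aux[OF submodule_carrier _ closed])
  have z: "(\<lambda>x\<in>carrier V. \<zero>) \<in> functionals" by (auto intro!: mod_homI simp: act_closed)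
  fix f g c assume fg: "f \<in> functionals" "g \<in> functionals" "c \<in> carrier K"
  note cl = mod_hom_closed[OF fg(2), simplified]
  have "(\<lambda>x\<in>carrier V. (\<lambda>x\<in>carrier V. \<zero>) x \<oplus> c \<otimes> g x) = (\<lambda>x\<in>carrier V. c \<otimes> g x)"
    using fg(3) by (intro restrict_ext) (simp add: cl)
  then have cg: "(\<lambda>x\<in>carrier V. c \<otimes> g x) \<in> functionals"
    using functional_add_scaled[OF z fg(2,3)] by simp
  have "(\<lambda>x\<in>carrier V. f x \<oplus> c \<otimes> g x) = (\<lambda>x\<in>carrier V. f x \<oplus> (\<lambda>x\<in>carrier V. c \<otimes> g x) x)"
    by (intro restrict_ext) simp
  then show "\<psi> (\<lambda>x\<in>carrier V. f x \<oplus> c \<otimes> g x) = \<psi> f \<oplus> c \<otimes> \<psi> g"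
    using add[OF fg(1) cg] smult[OF fg(2,3)] by simp
next
  fix f assume f: "f \<in> functionals" and "\<forall>w\<in>carrier V. f w = \<zero>"
  \<comment> \<open>A functional that vanishes everywhere is \<open>\<zero>\<close> times itself, so
    compatibility of \<open>\<psi>\<close> with scalars gives
    \<open>\<psi> f = \<zero>\<close>.\<close>
  then have "f = (\<lambda>x\<in>carrier V. \<zero> \<otimes> f x)"
    using mod_hom_extensional[OF f] by (intro extensionalityI[of _ "carrier V"]) auto
  then have "\<psi> f = \<zero> \<otimes> \<psi> f" using smult[OF f R.zero_closed] by simp
  then show "\<psi> f = \<zero>" using closed[OF f] by simp
qed

end

section \<open>Modules over a finite hereditary algebra\<close>

locale finite_hereditary = fd_algebra K A
  for K :: "('k, 'l) ring_scheme" (structure) and A :: "('k, 'a) module" (structure) +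
  assumes finite_K: "finite (carrier K)"
    and hereditary_A: "hereditary A"
begin

lemma finite_A: "finite (carrier A)"
proof -
  obtain B where B: "finite B" "spanning_set K A B" using finite_dim by blast
  have BA: "B \<subseteq> carrier A" using B(2) by (simp add: spanning_set_def)
  have "carrier A \<subseteq> (\<lambda>c. \<Oplus>\<^bsub>A\<^esub>b\<in>B. c b \<odot>\<^bsub>A\<^esub> b) ` (B \<rightarrow>\<^sub>E carrier K)"
  proof
    fix v assume "v \<in> carrier A"
    then obtain c where c: "c \<in> B \<rightarrow> carrier K" "v = (\<Oplus>\<^bsub>A\<^esub>b\<in>B. c b \<odot>\<^bsub>A\<^esub> b)"
      using B(2) unfolding spanning_set_def by blast
    have "v = (\<Oplus>\<^bsub>A\<^esub>b\<in>B. restrict c B b \<odot>\<^bsub>A\<^esub> b)"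
      unfolding c(2) using c(1) BA by (intro A.M.finsum_cong') (auto simp: Pi_def subset_iff)
    moreover have "restrict c B \<in> B \<rightarrow>\<^sub>E carrier K" using c(1) by auto
    ultimately show "v \<in> (\<lambda>c. \<Oplus>\<^bsub>A\<^esub>b\<in>B. c b \<odot>\<^bsub>A\<^esub> b) ` (B \<rightarrow>\<^sub>E carrier K)" by blast
  qed
  then show ?thesis
    by (rule finite_subset) (simp add: B(1) finite_K finite_PiE)
qed

lemma finite_dual: "finite (dual_space K A)"
  by (rule finite_subset[of _ "carrier A \<rightarrow>\<^sub>E carrier K"])
    (auto simp: dual_space_iff finite_A finite_K finite_PiE)

text \<open>The central copy of \<open>K\<close> in \<open>A\<close>; through it every
  \<open>A\<close>-module becomes a \<open>K\<close>-space and functionals become available.\<close>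

definition scalar :: "'k \<Rightarrow> 'a" where
  "scalar c = c \<odot>\<^bsub>A\<^esub> \<one>\<^bsub>A\<^esub>"

lemma scalar_closed: "c \<in> carrier K \<Longrightarrow> scalar c \<in> carrier A"
  by (simp add: scalar_def)

lemma mult_scalar: "c \<in> carrier K \<Longrightarrow> x \<in> carrier A \<Longrightarrow> x \<otimes>\<^bsub>A\<^esub> scalar c = c \<odot>\<^bsub>A\<^esub> x"
  and scalar_mult: "c \<in> carrier K \<Longrightarrow> x \<in> carrier A \<Longrightarrow> scalar c \<otimes>\<^bsub>A\<^esub> x = c \<odot>\<^bsub>A\<^esub> x"
  by (simp_all add: scalar_def flip: smult_mult_left smult_mult_right)

lemma scalar_hom:
  assumes "c \<in> carrier K" "d \<in> carrier K"
  shows "scalar (c \<oplus> d) = scalar c \<oplus>\<^bsub>A\<^esub> scalar d" "scalar (c \<otimes> d) = scalar c \<otimes>\<^bsub>A\<^esub> scalar d"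
    "scalar \<one> = \<one>\<^bsub>A\<^esub>"
  using assms by (simp_all add: scalar_def A.smult_l_distr A.smult_assoc1 flip: smult_mult_left)

lemma finite_space_scalars:
  assumes M: "right_module A M" and "finite (carrier M)"
  shows "finite_space K (change_scalars scalar M)"
proof -
  interpret M: right_module A M by fact
  have "right_module K (change_scalars scalar (sub_mod M (carrier M)))"
    by (rule M.right_module_change_scalars)
      (simp_all add: K.ring_axioms scalar_closed scalar_hom M.act_closed, simp add: scalar_def M.act_one)
  then show ?thesis
    using assms(2) by (simp add: sub_mod_carrier finite_space_def finite_space_axioms_def K.field_axioms)
qed

lemma finite_space_A: "finite_space K A"
proof -
  \<comment> \<open>The law of left modules over \<open>K\<close> turns into that of right modules
    because \<open>K\<close> is commutative.\<close>
  have "(r \<otimes> s) \<odot>\<^bsub>A\<^esub> x = s \<odot>\<^bsub>A\<^esub> (r \<odot>\<^bsub>A\<^esub> x)"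
    if "r \<in> carrier K" "s \<in> carrier K" "x \<in> carrier A" for r s x
    using that A.smult_assoc1[of s r x] by (simp add: K.m_comm)
  then have "right_module_axioms K A"
    by (intro right_module_axioms.intro) (simp_all add: A.smult_l_distr A.smult_r_distr)
  then have "right_module K A"
    by (simp add: right_module_def K.ring_axioms A.M.abelian_group_axioms)
  then show ?thesis
    by (simp add: finite_space_def finite_space_axioms_def K.field_axioms finite_A)
qed

text \<open>This is \<open>DA\<close> with its right action only; the left action of
  \<open>A\<close> enters through the products of \<open>in1 b\<close> and
  \<open>inD f\<close>.\<close>

definition dual_mod :: "('a, 'a \<Rightarrow> 'k) module" where
  "dual_mod = \<lparr>carrier = dual_space K A, monoid.mult = undefined, one = undefined,
     ring.zero = (\<lambda>x\<in>carrier A. \<zero>), ring.add = (\<lambda>f g. \<lambda>x\<in>carrier A. f x \<oplus> g x),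
     smult = (\<lambda>a f. \<lambda>x\<in>carrier A. f (a \<otimes>\<^bsub>A\<^esub> x))\<rparr>"

lemma dual_mod_simps [simp]:
  "carrier dual_mod = dual_space K A" "\<zero>\<^bsub>dual_mod\<^esub> = (\<lambda>x\<in>carrier A. \<zero>)"
  "f \<oplus>\<^bsub>dual_mod\<^esub> g = (\<lambda>x\<in>carrier A. f x \<oplus> g x)"
  "a \<odot>\<^bsub>dual_mod\<^esub> f = (\<lambda>x\<in>carrier A. f (a \<otimes>\<^bsub>A\<^esub> x))"
  by (simp_all add: dual_mod_def)

lemma right_module_dual_mod: "right_module A dual_mod"
proof -
  have ext: "f = (\<lambda>x\<in>carrier A. f x)" if "f \<in> dual_space K A" for f using dual_ext[OF that] by simp
  have "abelian_group dual_mod"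
  proof (rule abelian_groupI)
    fix f assume "f \<in> carrier dual_mod"
    then have f: "f \<in> dual_space K A" by simp
    have "(\<lambda>x\<in>carrier A. \<ominus> f x) \<in> dual_space K A"
      using f by (auto simp: dual_space_iff PiE_iff K.minus_add K.l_minus)
    then show "\<exists>g\<in>carrier dual_mod. g \<oplus>\<^bsub>dual_mod\<^esub> f = \<zero>\<^bsub>dual_mod\<^esub>"
      using f by (intro bexI[of _ "\<lambda>x\<in>carrier A. \<ominus> f x"])
        (auto simp: dual_closed K.l_neg intro!: restrict_ext)
    show "\<zero>\<^bsub>dual_mod\<^esub> \<oplus>\<^bsub>dual_mod\<^esub> f = f"
      by (subst (2) ext[OF f]) (auto simp: dual_closed[OF f] intro!: restrict_ext)
  qed (auto simp: dual_add_closed dual_zero_closed dual_closed K.a_ac intro!: restrict_ext)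
  moreover have "right_module_axioms A dual_mod"
  proof
    fix f assume "f \<in> carrier dual_mod"
    then have f: "f \<in> dual_space K A" by simp
    show "\<one>\<^bsub>A\<^esub> \<odot>\<^bsub>dual_mod\<^esub> f = f"
      by (subst (2) ext[OF f]) (auto intro!: restrict_ext)
  qed (auto simp: dual_act_right dual_add dual_closed A.l_distr A.m_assoc intro!: restrict_ext)
  ultimately show ?thesis by (simp add: right_module_def A.ring_axioms)
qed

text \<open>\<open>DA\<close> is coinduced from \<open>K\<close>: \<open>A\<close>-linear maps into
  it correspond to \<open>K\<close>-linear functionals, by evaluation at the unit in one direction
  and by x \<mapsto> (a \<mapsto> l (x a)) in the other. Extending a map thus reduces to extending a
  functional.\<close>

lemma dual_mod_hom_extends:
  assumes F: "right_module A F" "finite (carrier F)" and U: "submodule U A F"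
    and h: "h \<in> mod_hom A (sub_mod F U) dual_mod"
  shows "\<exists>H\<in>mod_hom A F dual_mod. \<forall>u\<in>U. H u = h u"
proof -
  interpret F: right_module A F by fact
  interpret V: finite_space K "change_scalars scalar F" by (rule finite_space_scalars[OF F])
  note D = F.submoduleD[OF U]
  have UV: "submodule U K (change_scalars scalar F)"
    using D by (intro V.sub_moduleI) (auto simp: scalar_closed)
  have hd: "h u \<in> dual_space K A" if "u \<in> U" for u
    using mod_hom_closed[OF h] that by simp
  have "(\<lambda>u\<in>U. h u \<one>\<^bsub>A\<^esub>) \<in> mod_hom K (sub_mod (change_scalars scalar F) U) (regular K)"
  proof (rule mod_homI)
    show "(\<lambda>u\<in>U. h u \<one>\<^bsub>A\<^esub>) \<in> carrier (sub_mod (change_scalars scalar F) U) \<rightarrow>\<^sub>E carrier (regular K)"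
      by (auto simp: dual_closed[OF hd])
  next
    fix x y assume "x \<in> carrier (sub_mod (change_scalars scalar F) U)" "y \<in> carrier (sub_mod (change_scalars scalar F) U)"
    then have xy: "x \<in> U" "y \<in> U" by simp_all
    then show "(\<lambda>u\<in>U. h u \<one>\<^bsub>A\<^esub>) (x \<oplus>\<^bsub>sub_mod (change_scalars scalar F) U\<^esub> y) =
        (\<lambda>u\<in>U. h u \<one>\<^bsub>A\<^esub>) x \<oplus>\<^bsub>regular K\<^esub> (\<lambda>u\<in>U. h u \<one>\<^bsub>A\<^esub>) y"
      using mod_hom_add[OF h, of x y] D(3) by simp
  next
    fix c x assume "c \<in> carrier K" "x \<in> carrier (sub_mod (change_scalars scalar F) U)"
    then have cx: "c \<in> carrier K" "x \<in> U" by simp_all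
    then have "h (scalar c \<odot>\<^bsub>F\<^esub> x) = (\<lambda>y\<in>carrier A. h x (scalar c \<otimes>\<^bsub>A\<^esub> y))"
      using mod_hom_smult[OF h, of "scalar c" x] by (simp add: scalar_closed)
    moreover have "h x (scalar c \<otimes>\<^bsub>A\<^esub> \<one>\<^bsub>A\<^esub>) = h x \<one>\<^bsub>A\<^esub> \<otimes> c"
      using dual_smult[OF hd[OF cx(2)] cx(1), of "\<one>\<^bsub>A\<^esub>"] cx(1) by (simp add: scalar_mult)
    ultimately show "(\<lambda>u\<in>U. h u \<one>\<^bsub>A\<^esub>) (c \<odot>\<^bsub>sub_mod (change_scalars scalar F) U\<^esub> x) =
        c \<odot>\<^bsub>regular K\<^esub> (\<lambda>u\<in>U. h u \<one>\<^bsub>A\<^esub>) x"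
      using D(4)[OF scalar_closed[OF cx(1)] cx(2)] cx by simp
  qed
  then obtain l where l: "l \<in> mod_hom K (change_scalars scalar F) (regular K)" "\<forall>u\<in>U. l u = h u \<one>\<^bsub>A\<^esub>"
    using V.functional_extends[OF UV] by force
  have l': "l x \<in> carrier K" "l (x \<oplus>\<^bsub>F\<^esub> y) = l x \<oplus> l y" "c \<in> carrier K \<Longrightarrow> l (scalar c \<odot>\<^bsub>F\<^esub> x) = l x \<otimes> c"
    if "x \<in> carrier F" "y \<in> carrier F" for x y c
    using that mod_hom_closed[OF l(1)] mod_hom_add[OF l(1)] mod_hom_smult[OF l(1)] by simp_all
  define H where "H = (\<lambda>x\<in>carrier F. \<lambda>a\<in>carrier A. l (a \<odot>\<^bsub>F\<^esub> x))"
  have "H \<in> mod_hom A F dual_mod"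
  proof (rule mod_homI)
    have "(\<lambda>a\<in>carrier A. l (a \<odot>\<^bsub>F\<^esub> x)) \<in> dual_space K A" if x: "x \<in> carrier F" for x
      unfolding dual_space_iff
    proof (intro conjI ballI)
      show "(\<lambda>a\<in>carrier A. l (a \<odot>\<^bsub>F\<^esub> x)) \<in> carrier A \<rightarrow>\<^sub>E carrier K"
        using x by (auto simp: l' F.act_closed)
      show "(\<lambda>a\<in>carrier A. l (a \<odot>\<^bsub>F\<^esub> x)) (a \<oplus>\<^bsub>A\<^esub> b) =
          (\<lambda>a\<in>carrier A. l (a \<odot>\<^bsub>F\<^esub> x)) a \<oplus> (\<lambda>a\<in>carrier A. l (a \<odot>\<^bsub>F\<^esub> x)) b"
        if "a \<in> carrier A" "b \<in> carrier A" for a b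
        using x that by (simp add: F.act_add_scalar l' F.act_closed)
      show "(\<lambda>a\<in>carrier A. l (a \<odot>\<^bsub>F\<^esub> x)) (c \<odot>\<^bsub>A\<^esub> a) = (\<lambda>a\<in>carrier A. l (a \<odot>\<^bsub>F\<^esub> x)) a \<otimes> c"
        if "c \<in> carrier K" "a \<in> carrier A" for c a
      proof -
        have "(c \<odot>\<^bsub>A\<^esub> a) \<odot>\<^bsub>F\<^esub> x = scalar c \<odot>\<^bsub>F\<^esub> (a \<odot>\<^bsub>F\<^esub> x)"
          using that x by (simp add: scalar_closed flip: F.act_assoc mult_scalar)
        then show ?thesis using that x l'(3)[OF F.act_closed[OF that(2) x] x that(1)] by simp
      qed
    qed
    then show "H \<in> carrier F \<rightarrow>\<^sub>E carrier dual_mod" by (auto simp: H_def)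
  next
    fix x y assume "x \<in> carrier F" "y \<in> carrier F"
    then show "H (x \<oplus>\<^bsub>F\<^esub> y) = H x \<oplus>\<^bsub>dual_mod\<^esub> H y"
      by (auto simp: H_def F.act_add l' F.act_closed intro!: restrict_ext)
  next
    fix b x assume "b \<in> carrier A" "x \<in> carrier F"
    then show "H (b \<odot>\<^bsub>F\<^esub> x) = b \<odot>\<^bsub>dual_mod\<^esub> H x"
      by (auto simp: H_def F.act_closed F.act_assoc intro!: restrict_ext)
  qed
  moreover have "H u = h u" if u: "u \<in> U" for u
  proof -
    \<comment> \<open>By \<open>A\<close>-linearity the value of \<open>h u\<close> at
      \<open>a\<close> is the value of \<open>h\<close> at u a, taken at the unit, so
      \<open>h\<close> is recovered from what \<open>l\<close> extends.\<close>
    have "H u = (\<lambda>a\<in>carrier A. h (a \<odot>\<^bsub>F\<^esub> u) \<one>\<^bsub>A\<^esub>)"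
      using u D(4,6) l(2) by (auto simp: H_def intro!: restrict_ext)
    also have "\<dots> = (\<lambda>a\<in>carrier A. h u a)"
      using mod_hom_smult[OF h _ , of _ u] u by (auto intro!: restrict_ext)
    also have "\<dots> = h u" by (rule dual_ext[OF hd[OF u]])
    finally show ?thesis .
  qed
  ultimately show ?thesis by blast
qed

text \<open>
  A quotient \<open>J\<close> of \<open>(DA)\<^sup>n\<close> is injective: a map to \<open>J\<close> from a submodule \<open>U\<close> of a free module \<open>F\<close> lifts to
  \<open>(DA)\<^sup>n\<close>, as \<open>U\<close> is projective, and then extends to \<open>F\<close>.
\<close>

lemma dual_quotient_splits:
  assumes V: "right_module A V" "finite (carrier V)" and J: "submodule J A V" and Y: "finite Y"
    and s: "s \<in> mod_hom A (direct_sum Y (\<lambda>_. dual_mod)) (sub_mod V J)"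
      "s ` carrier (direct_sum Y (\<lambda>_. dual_mod)) = J"
  shows "\<exists>X. splits_as A V X J"
proof -
  interpret V: right_module A V by fact
  note JD = V.submoduleD[OF J] and rJ = V.right_module_sub_mod[OF J]
  interpret J: right_module A "sub_mod V J" by (fact rJ)
  define Q where "Q = direct_sum Y (\<lambda>_. dual_mod)"
  note s = s[folded Q_def]
  note reg = right_module_regular[OF A.ring_axioms]
  have rQ: "right_module A Q"
    unfolding Q_def by (rule right_module_direct_sum[OF A.ring_axioms right_module_dual_mod])
  interpret Q: right_module A Q by (fact rQ)
  have finQ: "finite (carrier Q)" using Y finite_dual by (simp add: Q_def finite_PiE)
  have finJ: "finite (carrier (sub_mod V J))" using JD(1) V(2) finite_subset by auto
  \<comment> \<open>The free module on all elements of \<open>V\<close>: finite because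
    \<open>V\<close> is, and mapped onto \<open>V\<close> tautologically by
    \<open>p\<close>.\<close>
  define F where "F = direct_sum (carrier V) (\<lambda>_. regular A)"
  have rF: "right_module A F"
    unfolding F_def by (rule right_module_direct_sum[OF A.ring_axioms reg])
  interpret F: right_module A F by (fact rF)
  have finF: "finite (carrier F)" using V(2) finite_A by (simp add: F_def finite_PiE)
  define p where "p = V.copairing (carrier V) (\<lambda>_. regular A) (\<lambda>v. \<lambda>a\<in>carrier A. a \<odot>\<^bsub>V\<^esub> v)"
  have p: "p \<in> mod_hom A F V"
    unfolding p_def F_def by (rule V.copairing_hom[OF V(2) reg V.act_hom])
  have psurj: "p ` carrier F = carrier V"
  proof (intro Set.equalityI subsetI)
    fix v assume v: "v \<in> carrier V"
    let ?x = "single (carrier V) (\<lambda>_. regular A) v \<one>\<^bsub>A\<^esub>"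
    have "?x \<in> carrier F" unfolding F_def by (rule single_closed[OF reg]) simp
    moreover have "p ?x = v"
      unfolding p_def using V.copairing_single[where N = "\<lambda>_. regular A" and h = "\<lambda>v. \<lambda>a\<in>carrier A. a \<odot>\<^bsub>V\<^esub> v",
          OF V(2) reg V.act_hom v, of "\<one>\<^bsub>A\<^esub>"] v by (simp add: V.act_one)
    ultimately show "v \<in> p ` carrier F" by (metis imageI)
  qed (use mod_hom_closed[OF p] in blast)
  define U where "U = {x \<in> carrier F. p x \<in> J}"
  have U: "submodule U A F" unfolding U_def by (rule F.submodule_vimage[OF V(1) p J])
  note UD = F.submoduleD[OF U]
  interpret U: right_module A "sub_mod F U" by (rule F.right_module_sub_mod[OF U])
  have pU: "restrict p U \<in> mod_hom A (sub_mod F U) (sub_mod V J)"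
    using UD(3,4) by (intro mod_homI) (auto simp: U_def mod_hom_add[OF p] mod_hom_smult[OF p])
  obtain h where h: "h \<in> mod_hom A (sub_mod F U) Q" "\<forall>x\<in>U. s (h x) = p x"
    using hereditary_lift[OF hereditary_A A.ring_axioms finite_A V(2) U[unfolded F_def] rQ finQ rJ finJ s(1) _
        pU[unfolded F_def]] s(2) unfolding F_def by auto
  \<comment> \<open>The extension from \<open>U\<close> to \<open>F\<close> is made in each
    coordinate of \<open>Q\<close> separately, since each of them is a copy of
    \<open>DA\<close>.\<close>
  have "\<exists>H\<in>mod_hom A F dual_mod. \<forall>u\<in>U. H u = h u y" if y: "y \<in> Y" for y
  proof -
    have "(\<lambda>x\<in>carrier (sub_mod F U). h x y) \<in> mod_hom A (sub_mod F U) dual_mod"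
      using mod_hom_component[OF U.right_module_axioms y h(1)[unfolded Q_def]] .
    then show ?thesis using dual_mod_hom_extends[OF rF finF U] by fastforce
  qed
  then obtain H where H: "\<And>y. y \<in> Y \<Longrightarrow> H y \<in> mod_hom A F dual_mod"
    "\<And>y u. y \<in> Y \<Longrightarrow> u \<in> U \<Longrightarrow> H y u = h u y" by metis
  define G where "G = (\<lambda>x\<in>carrier F. \<lambda>y\<in>Y. H y x)"
  have G: "G \<in> mod_hom A F Q"
    unfolding G_def Q_def by (rule mod_hom_pairing[OF rF H(1)])
  have GU: "G u = h u" if u: "u \<in> U" for u
  proof -
    have "h u \<in> extensional Y" using mod_hom_closed[OF h(1)] u by (simp add: Q_def PiE_iff)
    then show ?thesis
      using u UD(6) H(2) by (intro extensionalityI[of _ Y]) (auto simp: G_def)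
  qed
  have g: "compose (carrier F) s G \<in> mod_hom A F (sub_mod V J)" by (rule mod_hom_compose[OF G s(1) rF])
  have gU: "compose (carrier F) s G u = p u" if "u \<in> U" for u
    using that UD(6) GU h(2) by (simp add: compose_def)
  \<comment> \<open>The kernel of \<open>p\<close> lies in \<open>U\<close>, where the extended map
    agrees with \<open>p\<close>. Hence the map descends along \<open>p\<close> to a retraction
    \<open>r\<close> of \<open>V\<close> onto \<open>J\<close>, and the kernel of \<open>r\<close>
    is the complement.\<close>
  have ker: "compose (carrier F) s G x = \<zero>\<^bsub>sub_mod V J\<^esub>" if "x \<in> carrier F" "p x = \<zero>\<^bsub>V\<^esub>" for x
    using gU[of x] that JD(2) by (simp add: U_def)
  obtain r where r: "r \<in> mod_hom A V (sub_mod V J)" "\<And>x. x \<in> carrier F \<Longrightarrow> r (p x) = compose (carrier F) s G x"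
    using F.factor_through_surj[OF rJ V(1) p psurj g ker] by blast
  have rJ': "r v = v" if v: "v \<in> J" for v
  proof -
    obtain x where x: "x \<in> carrier F" "v = p x" using psurj v JD(6) by blast
    then have "x \<in> U" using v by (simp add: U_def)
    then show ?thesis using r(2)[OF x(1)] gU x(2) by simp
  qed
  have "splits_as A V {x \<in> carrier V. r x \<in> {\<zero>\<^bsub>sub_mod V J\<^esub>}} J"
  proof (rule V.splits_asI[OF _ J])
    show "submodule {x \<in> carrier V. r x \<in> {\<zero>\<^bsub>sub_mod V J\<^esub>}} A V"
      by (rule V.submodule_vimage[OF rJ r(1) J.submodule_zero])
    show "x = \<zero>\<^bsub>V\<^esub>" if "x \<in> {x \<in> carrier V. r x \<in> {\<zero>\<^bsub>sub_mod V J\<^esub>}}" "x \<in> J" for x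
      using that rJ' by simp
    fix x assume x: "x \<in> carrier V"
    have rx: "r x \<in> J" "r x \<in> carrier V" using mod_hom_closed[OF r(1) x] JD(6) by auto
    have "r (x \<ominus>\<^bsub>V\<^esub> r x) = r x \<ominus>\<^bsub>sub_mod V J\<^esub> r (r x)"
      by (rule V.mod_hom_diff[OF rJ r(1) x rx(2)])
    also have "\<dots> = \<zero>\<^bsub>sub_mod V J\<^esub>"
      using rx rJ'[OF rx(1)] J.diff_zero_iff[of "r x" "r x"] by simp
    finally have "x \<ominus>\<^bsub>V\<^esub> r x \<in> {x \<in> carrier V. r x \<in> {\<zero>\<^bsub>sub_mod V J\<^esub>}}" using x rx by simp
    then show "\<exists>a\<in>{x \<in> carrier V. r x \<in> {\<zero>\<^bsub>sub_mod V J\<^esub>}}. \<exists>b\<in>J. x = a \<oplus>\<^bsub>V\<^esub> b"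
      by (rule bexI[rotated]) (rule bexI[OF _ rx(1)], rule V.diff_add_cancel[OF x rx(2), symmetric])
  qed
  then show ?thesis by blast
qed

text \<open>The image \<open>U\<close> of \<open>\<theta>\<close> is a submodule of a free module,
  so the identity of \<open>U\<close> lifts through \<open>\<theta>\<close> to a section
  \<open>h\<close>. The image of the section is the complement of the kernel.\<close>

lemma kernel_splits:
  assumes V: "right_module A V" "finite (carrier V)" and I: "finite I"
    and \<theta>: "\<theta> \<in> mod_hom A V (direct_sum I (\<lambda>_. regular A))"
  shows "\<exists>P. splits_as A V {x \<in> carrier V. \<theta> x = \<zero>\<^bsub>direct_sum I (\<lambda>_. regular A)\<^esub>} P"
proof -
  interpret V: right_module A V by fact
  define F where "F = direct_sum I (\<lambda>_. regular A)"
  have rF: "right_module A F"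
    unfolding F_def by (rule right_module_direct_sum[OF A.ring_axioms right_module_regular[OF A.ring_axioms]])
  interpret F: right_module A F by (fact rF)
  note \<theta> = \<theta>[folded F_def]
  define U where "U = \<theta> ` carrier V"
  have U: "submodule U A F" unfolding U_def by (rule V.submodule_image[OF rF \<theta> V.submodule_carrier])
  note UD = F.submoduleD[OF U] and rU = F.right_module_sub_mod[OF U]
  have finU: "finite (carrier (sub_mod F U))" using V(2) by (simp add: U_def)
  interpret U: right_module A "sub_mod F U" by (fact rU)
  have \<theta>U: "\<theta> \<in> mod_hom A V (sub_mod F U)"
    using \<theta> by (auto simp: mod_hom_def U_def PiE_def)
  have idU: "(\<lambda>x\<in>U. x) \<in> mod_hom A (sub_mod F U) (sub_mod F U)"
    using UD(3,4) by (intro mod_homI) auto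
  obtain h where h: "h \<in> mod_hom A (sub_mod F U) V" "\<forall>x\<in>U. \<theta> (h x) = x"
    using hereditary_lift[OF hereditary_A A.ring_axioms finite_A I U[unfolded F_def] V rU[unfolded F_def]
        finU[unfolded F_def] \<theta>U[unfolded F_def] _ idU[unfolded F_def]] unfolding F_def U_def by auto
  have "splits_as A V {x \<in> carrier V. \<theta> x \<in> {\<zero>\<^bsub>F\<^esub>}} (h ` U)"
  proof (rule V.splits_asI)
    show "submodule {x \<in> carrier V. \<theta> x \<in> {\<zero>\<^bsub>F\<^esub>}} A V"
      by (rule V.submodule_vimage[OF rF \<theta> F.submodule_zero])
    show "submodule (h ` U) A V"
      using U.submodule_image[OF V(1) h(1) U.submodule_carrier] by simp
    show "x = \<zero>\<^bsub>V\<^esub>" if "x \<in> {x \<in> carrier V. \<theta> x \<in> {\<zero>\<^bsub>F\<^esub>}}" "x \<in> h ` U" for x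
      using that h(2) U.mod_hom_zero[OF V(1) h(1)] by auto
    fix x assume x: "x \<in> carrier V"
    have \<theta>x: "\<theta> x \<in> U" using x by (simp add: U_def)
    have hx: "h (\<theta> x) \<in> carrier V" "h (\<theta> x) \<in> h ` U" using mod_hom_closed[OF h(1)] \<theta>x by auto
    have "\<theta> (x \<ominus>\<^bsub>V\<^esub> h (\<theta> x)) = \<theta> x \<ominus>\<^bsub>F\<^esub> \<theta> (h (\<theta> x))"
      by (rule V.mod_hom_diff[OF rF \<theta> x hx(1)])
    also have "\<dots> = \<zero>\<^bsub>F\<^esub>" using h(2) \<theta>x UD(6)[OF \<theta>x] F.diff_zero_iff[of "\<theta> x" "\<theta> x"] by simp
    finally have "x \<ominus>\<^bsub>V\<^esub> h (\<theta> x) \<in> {x \<in> carrier V. \<theta> x \<in> {\<zero>\<^bsub>F\<^esub>}}" using x hx by simp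
    then show "\<exists>a\<in>{x \<in> carrier V. \<theta> x \<in> {\<zero>\<^bsub>F\<^esub>}}. \<exists>b\<in>h ` U. x = a \<oplus>\<^bsub>V\<^esub> b"
      by (rule bexI[rotated]) (rule bexI[OF _ hx(2)], rule V.diff_add_cancel[OF x hx(1), symmetric])
  qed
  then show ?thesis by (auto simp: F_def)
qed

end

section \<open>Modules over the duplicated algebra\<close>

context finite_hereditary
begin

abbreviation D where "D \<equiv> duplicated_algebra K A"

text \<open>The three entries of the matrix get separate embeddings. \<open>in0\<close> and
  \<open>in1\<close> respect sums and products but not the unit: they send the unit of
  \<open>A\<close> to the diagonal idempotents e and e'.\<close>

definition in0 :: "'a \<Rightarrow> 'a \<times> ('a \<Rightarrow> 'k) \<times> 'a" where
  "in0 a = (a, \<lambda>x\<in>carrier A. \<zero>, \<zero>\<^bsub>A\<^esub>)"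

definition in1 :: "'a \<Rightarrow> 'a \<times> ('a \<Rightarrow> 'k) \<times> 'a" where
  "in1 b = (\<zero>\<^bsub>A\<^esub>, \<lambda>x\<in>carrier A. \<zero>, b)"

definition inD :: "('a \<Rightarrow> 'k) \<Rightarrow> 'a \<times> ('a \<Rightarrow> 'k) \<times> 'a" where
  "inD f = (\<zero>\<^bsub>A\<^esub>, f, \<zero>\<^bsub>A\<^esub>)"

lemma carrier_D: "(a, f, b) \<in> carrier D \<longleftrightarrow> a \<in> carrier A \<and> f \<in> dual_space K A \<and> b \<in> carrier A"
  by (simp add: duplicated_algebra_def)

lemma add_D: "(a, f, b) \<oplus>\<^bsub>D\<^esub> (a', f', b') = (a \<oplus>\<^bsub>A\<^esub> a', \<lambda>x\<in>carrier A. f x \<oplus> f' x, b \<oplus>\<^bsub>A\<^esub> b')"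
  by (simp add: duplicated_algebra_def)

lemma mult_D: "(a, f, b) \<otimes>\<^bsub>D\<^esub> (a', f', b') =
    (a \<otimes>\<^bsub>A\<^esub> a', \<lambda>x\<in>carrier A. f (a' \<otimes>\<^bsub>A\<^esub> x) \<oplus> f' (x \<otimes>\<^bsub>A\<^esub> b), b \<otimes>\<^bsub>A\<^esub> b')"
  by (simp add: duplicated_algebra_def)

lemma zero_D: "\<zero>\<^bsub>D\<^esub> = (\<zero>\<^bsub>A\<^esub>, \<lambda>x\<in>carrier A. \<zero>, \<zero>\<^bsub>A\<^esub>)"
  and one_D: "\<one>\<^bsub>D\<^esub> = (\<one>\<^bsub>A\<^esub>, \<lambda>x\<in>carrier A. \<zero>, \<one>\<^bsub>A\<^esub>)"
  by (simp_all add: duplicated_algebra_def)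

lemma dual_zero: "f \<in> dual_space K A \<Longrightarrow> f \<zero>\<^bsub>A\<^esub> = \<zero>"
  using dual_smult[of f \<zero> "\<zero>\<^bsub>A\<^esub>"] dual_closed[of f "\<zero>\<^bsub>A\<^esub>"] by simp

lemma dual_eqI: "f \<in> dual_space K A \<Longrightarrow> (\<And>x. x \<in> carrier A \<Longrightarrow> g x = f x) \<Longrightarrow> (\<lambda>x\<in>carrier A. g x) = f"
  using dual_ext[of f] by (metis restrict_ext)

lemma in_closed:
  "a \<in> carrier A \<Longrightarrow> in0 a \<in> carrier D" "b \<in> carrier A \<Longrightarrow> in1 b \<in> carrier D"
  "f \<in> dual_space K A \<Longrightarrow> inD f \<in> carrier D"
  by (simp_all add: in0_def in1_def inD_def carrier_D dual_zero_closed)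

lemma e_closed: "in0 \<one>\<^bsub>A\<^esub> \<in> carrier D" "in1 \<one>\<^bsub>A\<^esub> \<in> carrier D"
  by (simp_all add: in_closed)

lemma in0_hom:
  assumes "a \<in> carrier A" "b \<in> carrier A"
  shows "in0 (a \<oplus>\<^bsub>A\<^esub> b) = in0 a \<oplus>\<^bsub>D\<^esub> in0 b" "in0 (a \<otimes>\<^bsub>A\<^esub> b) = in0 a \<otimes>\<^bsub>D\<^esub> in0 b"
  using assms by (auto simp: in0_def add_D mult_D intro!: restrict_ext)

lemma in1_hom:
  assumes "a \<in> carrier A" "b \<in> carrier A"
  shows "in1 (a \<oplus>\<^bsub>A\<^esub> b) = in1 a \<oplus>\<^bsub>D\<^esub> in1 b" "in1 (a \<otimes>\<^bsub>A\<^esub> b) = in1 a \<otimes>\<^bsub>D\<^esub> in1 b"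
  using assms by (auto simp: in1_def add_D mult_D intro!: restrict_ext)

lemma inD_add: "inD (\<lambda>x\<in>carrier A. f x \<oplus> g x) = inD f \<oplus>\<^bsub>D\<^esub> inD g"
  by (simp add: inD_def add_D)

lemma inD_in0:
  assumes "f \<in> dual_space K A" "a \<in> carrier A"
  shows "inD f \<otimes>\<^bsub>D\<^esub> in0 a = inD (\<lambda>x\<in>carrier A. f (a \<otimes>\<^bsub>A\<^esub> x))"
  using assms by (auto simp: inD_def in0_def mult_D dual_closed intro!: restrict_ext)

lemma in1_inD:
  assumes "f \<in> dual_space K A" "b \<in> carrier A"
  shows "in1 b \<otimes>\<^bsub>D\<^esub> inD f = inD (\<lambda>x\<in>carrier A. f (x \<otimes>\<^bsub>A\<^esub> b))"
  using assms by (auto simp: inD_def in1_def mult_D dual_closed intro!: restrict_ext)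

text \<open>In a right module \<open>r \<otimes> s\<close> acts as \<open>r\<close> first and
  \<open>s\<close> afterwards. So an idempotent multiplied from the left shows how an element acts
  on one part of a module, and from the right which component of the result is kept.\<close>

lemma idem_mult:
  assumes "a \<in> carrier A" "f \<in> dual_space K A" "b \<in> carrier A"
  shows "in0 \<one>\<^bsub>A\<^esub> \<otimes>\<^bsub>D\<^esub> (a, f, b) = in0 a" "(a, f, b) \<otimes>\<^bsub>D\<^esub> in1 \<one>\<^bsub>A\<^esub> = in1 b"
    "in1 \<one>\<^bsub>A\<^esub> \<otimes>\<^bsub>D\<^esub> (a, f, b) = inD f \<oplus>\<^bsub>D\<^esub> in1 b" "(a, f, b) \<otimes>\<^bsub>D\<^esub> in0 \<one>\<^bsub>A\<^esub> = in0 a \<oplus>\<^bsub>D\<^esub> inD f"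
  using assms
  by (auto simp: inD_def in0_def in1_def add_D mult_D dual_closed dual_zero intro!: restrict_ext)

lemma in0_in1: "in0 \<one>\<^bsub>A\<^esub> \<otimes>\<^bsub>D\<^esub> in1 \<one>\<^bsub>A\<^esub> = \<zero>\<^bsub>D\<^esub>" "in1 \<one>\<^bsub>A\<^esub> \<otimes>\<^bsub>D\<^esub> in0 \<one>\<^bsub>A\<^esub> = \<zero>\<^bsub>D\<^esub>"
  by (auto simp: in0_def in1_def mult_D zero_D intro!: restrict_ext)

lemma idem_sum: "in0 \<one>\<^bsub>A\<^esub> \<oplus>\<^bsub>D\<^esub> in1 \<one>\<^bsub>A\<^esub> = \<one>\<^bsub>D\<^esub>"
  by (auto simp: in0_def in1_def add_D one_D intro!: restrict_ext)

text \<open>The image \<open>M e\<close> of an idempotent is its set of fixed points; in this form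
  the part of a submodule is an intersection.\<close>

definition part0 :: "('a \<times> ('a \<Rightarrow> 'k) \<times> 'a, 'm) module \<Rightarrow> 'm set" where
  "part0 M = {m \<in> carrier M. in0 \<one>\<^bsub>A\<^esub> \<odot>\<^bsub>M\<^esub> m = m}"

definition part1 :: "('a \<times> ('a \<Rightarrow> 'k) \<times> 'a, 'm) module \<Rightarrow> 'm set" where
  "part1 M = {m \<in> carrier M. in1 \<one>\<^bsub>A\<^esub> \<odot>\<^bsub>M\<^esub> m = m}"

text \<open>For a triple \<open>(X, Y, \<phi>)\<close> this is the kernel of the map from
  \<open>Y\<close> to \<open>Hom(DA, X)\<close> adjoint to \<phi>, the largest submodule of
  \<open>M\<close> that is an \<open>A_1\<close>-module.\<close>

definition annihilated :: "('a \<times> ('a \<Rightarrow> 'k) \<times> 'a, 'm) module \<Rightarrow> 'm set" where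
  "annihilated M = {m \<in> part1 M. \<forall>f\<in>dual_space K A. inD f \<odot>\<^bsub>M\<^esub> m = \<zero>\<^bsub>M\<^esub>}"

text \<open>For a triple \<open>(X, Y, \<phi>)\<close> this says that \<phi> is surjective, that is,
  that \<open>part1 M\<close> generates \<open>M\<close>. Expressed through submodules, it passes to
  quotients by taking preimages.\<close>

definition full :: "('a \<times> ('a \<Rightarrow> 'k) \<times> 'a, 'm) module \<Rightarrow> bool" where
  "full M \<longleftrightarrow> (\<forall>L. submodule L D M \<longrightarrow> part1 M \<subseteq> L \<longrightarrow> L = carrier M)"

lemma part_sub_mod:
  assumes "L \<subseteq> carrier M"
  shows "part0 (sub_mod M L) = part0 M \<inter> L" "part1 (sub_mod M L) = part1 M \<inter> L"
    "annihilated (sub_mod M L) = annihilated M \<inter> L"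
  using assms by (auto simp: part0_def part1_def annihilated_def)

end

section \<open>The two parts of a module over the duplicated algebra\<close>

locale dup_module = finite_hereditary K A + M: right_module "duplicated_algebra K A" M
  for K :: "('k, 'l) ring_scheme" (structure) and A :: "('k, 'a) module" (structure)
    and M :: "('a \<times> ('a \<Rightarrow> 'k) \<times> 'a, 'm) module" (structure)
begin

abbreviation e0 where "e0 \<equiv> in0 \<one>\<^bsub>A\<^esub>"
abbreviation e1 where "e1 \<equiv> in1 \<one>\<^bsub>A\<^esub>"

lemma part_sub: "part0 M \<subseteq> carrier M" "part1 M \<subseteq> carrier M"
  by (auto simp: part0_def part1_def)

lemma part_closed: "m \<in> part0 M \<Longrightarrow> m \<in> carrier M" "m \<in> part1 M \<Longrightarrow> m \<in> carrier M"
  by (auto simp: part0_def part1_def)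

lemma part_act: "m \<in> part0 M \<Longrightarrow> e0 \<odot>\<^bsub>M\<^esub> m = m" "m \<in> part1 M \<Longrightarrow> e1 \<odot>\<^bsub>M\<^esub> m = m"
  by (auto simp: part0_def part1_def)

lemma e_mult_self: "e0 \<otimes>\<^bsub>D\<^esub> e0 = e0" "e1 \<otimes>\<^bsub>D\<^esub> e1 = e1"
  by (simp_all flip: in0_hom in1_hom)

lemma e_act_part: "m \<in> carrier M \<Longrightarrow> e0 \<odot>\<^bsub>M\<^esub> m \<in> part0 M" "m \<in> carrier M \<Longrightarrow> e1 \<odot>\<^bsub>M\<^esub> m \<in> part1 M"
  by (simp_all add: part0_def part1_def M.act_closed e_closed e_mult_self flip: M.act_assoc)

lemma decompose: "m \<in> carrier M \<Longrightarrow> m = e0 \<odot>\<^bsub>M\<^esub> m \<oplus>\<^bsub>M\<^esub> e1 \<odot>\<^bsub>M\<^esub> m"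
  by (simp add: e_closed idem_sum M.act_one flip: M.act_add_scalar)

lemma e_act_other: "m \<in> part0 M \<Longrightarrow> e1 \<odot>\<^bsub>M\<^esub> m = \<zero>\<^bsub>M\<^esub>" "m \<in> part1 M \<Longrightarrow> e0 \<odot>\<^bsub>M\<^esub> m = \<zero>\<^bsub>M\<^esub>"
proof -
  assume m: "m \<in> part0 M"
  have "e1 \<odot>\<^bsub>M\<^esub> (e0 \<odot>\<^bsub>M\<^esub> m) = \<zero>\<^bsub>M\<^esub>"
    using part_closed(1)[OF m] by (simp add: e_closed in0_in1 flip: M.act_assoc)
  then show "e1 \<odot>\<^bsub>M\<^esub> m = \<zero>\<^bsub>M\<^esub>" using part_act(1)[OF m] by simp
next
  assume m: "m \<in> part1 M"
  have "e0 \<odot>\<^bsub>M\<^esub> (e1 \<odot>\<^bsub>M\<^esub> m) = \<zero>\<^bsub>M\<^esub>"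
    using part_closed(2)[OF m] by (simp add: e_closed in0_in1 flip: M.act_assoc)
  then show "e0 \<odot>\<^bsub>M\<^esub> m = \<zero>\<^bsub>M\<^esub>" using part_act(2)[OF m] by simp
qed

lemma part_Int: "m \<in> part0 M \<Longrightarrow> m \<in> part1 M \<Longrightarrow> m = \<zero>\<^bsub>M\<^esub>"
  using e_act_other(1) part_act(2) by metis

text \<open>\<open>e0\<close> times \<open>(a, f, b)\<close> is \<open>in0 a\<close>, so on this
  part the algebra acts through \<open>A_0\<close>, and the part is stable.\<close>

lemma act_part0:
  assumes "m \<in> part0 M" "a \<in> carrier A" "f \<in> dual_space K A" "b \<in> carrier A"
  shows "(a, f, b) \<odot>\<^bsub>M\<^esub> m = in0 a \<odot>\<^bsub>M\<^esub> m" "in0 a \<odot>\<^bsub>M\<^esub> m \<in> part0 M"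
proof -
  note m = part_closed(1)[OF assms(1)]
  have "(a, f, b) \<odot>\<^bsub>M\<^esub> (e0 \<odot>\<^bsub>M\<^esub> m) = (e0 \<otimes>\<^bsub>D\<^esub> (a, f, b)) \<odot>\<^bsub>M\<^esub> m"
    using M.act_assoc[OF e_closed(1) _ m, of "(a, f, b)"] assms by (simp add: carrier_D)
  then show "(a, f, b) \<odot>\<^bsub>M\<^esub> m = in0 a \<odot>\<^bsub>M\<^esub> m" using assms by (simp add: part_act idem_mult)
  have "e0 \<odot>\<^bsub>M\<^esub> (in0 a \<odot>\<^bsub>M\<^esub> m) = in0 a \<odot>\<^bsub>M\<^esub> m"
    using assms m by (simp add: in_closed flip: M.act_assoc in0_hom)
  then show "in0 a \<odot>\<^bsub>M\<^esub> m \<in> part0 M"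
    using assms m by (simp add: part0_def M.act_closed in_closed)
qed

text \<open>\<open>e1\<close> times \<open>(a, f, b)\<close> is \<open>inD f\<close> plus
  \<open>in1 b\<close>: the entry \<open>f\<close> leads from the second part into the first, which
  is why the second part is in general only a quotient of \<open>M\<close>.\<close>

lemma act_part1:
  assumes "m \<in> part1 M" "a \<in> carrier A" "f \<in> dual_space K A" "b \<in> carrier A"
  shows "(a, f, b) \<odot>\<^bsub>M\<^esub> m = inD f \<odot>\<^bsub>M\<^esub> m \<oplus>\<^bsub>M\<^esub> in1 b \<odot>\<^bsub>M\<^esub> m"
    "in1 b \<odot>\<^bsub>M\<^esub> m \<in> part1 M" "inD f \<odot>\<^bsub>M\<^esub> m \<in> part0 M"
proof -
  note m = part_closed(2)[OF assms(1)]
  have "(a, f, b) \<odot>\<^bsub>M\<^esub> (e1 \<odot>\<^bsub>M\<^esub> m) = (e1 \<otimes>\<^bsub>D\<^esub> (a, f, b)) \<odot>\<^bsub>M\<^esub> m"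
    using M.act_assoc[OF e_closed(2) _ m, of "(a, f, b)"] assms by (simp add: carrier_D)
  then show "(a, f, b) \<odot>\<^bsub>M\<^esub> m = inD f \<odot>\<^bsub>M\<^esub> m \<oplus>\<^bsub>M\<^esub> in1 b \<odot>\<^bsub>M\<^esub> m"
    using assms m by (simp add: part_act idem_mult M.act_add_scalar in_closed)
  have "e1 \<odot>\<^bsub>M\<^esub> (in1 b \<odot>\<^bsub>M\<^esub> m) = in1 b \<odot>\<^bsub>M\<^esub> m"
    using assms m by (simp add: in_closed flip: M.act_assoc in1_hom)
  then show "in1 b \<odot>\<^bsub>M\<^esub> m \<in> part1 M"
    using assms m by (simp add: part1_def M.act_closed in_closed)
  have "inD f \<otimes>\<^bsub>D\<^esub> e0 = inD f"
    using assms(3) by (simp add: inD_in0 dual_closed dual_ext cong: restrict_cong)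
  then have "e0 \<odot>\<^bsub>M\<^esub> (inD f \<odot>\<^bsub>M\<^esub> m) = inD f \<odot>\<^bsub>M\<^esub> m"
    using assms m by (simp add: in_closed flip: M.act_assoc)
  then show "inD f \<odot>\<^bsub>M\<^esub> m \<in> part0 M"
    using assms m by (simp add: part0_def M.act_closed in_closed)
qed

lemma e_act_general:
  assumes "m \<in> carrier M" "a \<in> carrier A" "f \<in> dual_space K A" "b \<in> carrier A"
  shows "e1 \<odot>\<^bsub>M\<^esub> ((a, f, b) \<odot>\<^bsub>M\<^esub> m) = in1 b \<odot>\<^bsub>M\<^esub> (e1 \<odot>\<^bsub>M\<^esub> m)"
    "e0 \<odot>\<^bsub>M\<^esub> ((a, f, b) \<odot>\<^bsub>M\<^esub> m) = in0 a \<odot>\<^bsub>M\<^esub> (e0 \<odot>\<^bsub>M\<^esub> m) \<oplus>\<^bsub>M\<^esub> inD f \<odot>\<^bsub>M\<^esub> (e1 \<odot>\<^bsub>M\<^esub> m)"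
proof -
  have c: "(a, f, b) \<in> carrier D" using assms by (simp add: carrier_D)
  have "e1 \<odot>\<^bsub>M\<^esub> ((a, f, b) \<odot>\<^bsub>M\<^esub> m) = ((a, f, b) \<otimes>\<^bsub>D\<^esub> e1) \<odot>\<^bsub>M\<^esub> m"
    using M.act_assoc[OF c e_closed(2) assms(1)] by simp
  also have "\<dots> = (e1 \<otimes>\<^bsub>D\<^esub> in1 b) \<odot>\<^bsub>M\<^esub> m" using assms by (simp add: idem_mult flip: in1_hom)
  also have "\<dots> = in1 b \<odot>\<^bsub>M\<^esub> (e1 \<odot>\<^bsub>M\<^esub> m)" using assms by (simp add: M.act_assoc in_closed)
  finally show "e1 \<odot>\<^bsub>M\<^esub> ((a, f, b) \<odot>\<^bsub>M\<^esub> m) = in1 b \<odot>\<^bsub>M\<^esub> (e1 \<odot>\<^bsub>M\<^esub> m)" .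
  have "e0 \<odot>\<^bsub>M\<^esub> ((a, f, b) \<odot>\<^bsub>M\<^esub> m) = ((a, f, b) \<otimes>\<^bsub>D\<^esub> e0) \<odot>\<^bsub>M\<^esub> m"
    using M.act_assoc[OF c e_closed(1) assms(1)] by simp
  also have "\<dots> = (e0 \<otimes>\<^bsub>D\<^esub> in0 a \<oplus>\<^bsub>D\<^esub> e1 \<otimes>\<^bsub>D\<^esub> inD f) \<odot>\<^bsub>M\<^esub> m"
    using assms by (simp add: idem_mult in1_inD dual_closed dual_ext flip: in0_hom cong: restrict_cong)
  also have "\<dots> = in0 a \<odot>\<^bsub>M\<^esub> (e0 \<odot>\<^bsub>M\<^esub> m) \<oplus>\<^bsub>M\<^esub> inD f \<odot>\<^bsub>M\<^esub> (e1 \<odot>\<^bsub>M\<^esub> m)"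
    using assms by (simp add: M.act_add_scalar M.act_assoc in_closed)
  finally show "e0 \<odot>\<^bsub>M\<^esub> ((a, f, b) \<odot>\<^bsub>M\<^esub> m) =
      in0 a \<odot>\<^bsub>M\<^esub> (e0 \<odot>\<^bsub>M\<^esub> m) \<oplus>\<^bsub>M\<^esub> inD f \<odot>\<^bsub>M\<^esub> (e1 \<odot>\<^bsub>M\<^esub> m)" .
qed

lemma part_subgroup:
  "\<zero>\<^bsub>M\<^esub> \<in> part0 M" "x \<in> part0 M \<Longrightarrow> y \<in> part0 M \<Longrightarrow> x \<oplus>\<^bsub>M\<^esub> y \<in> part0 M" "x \<in> part0 M \<Longrightarrow> \<ominus>\<^bsub>M\<^esub> x \<in> part0 M"
  "\<zero>\<^bsub>M\<^esub> \<in> part1 M" "x \<in> part1 M \<Longrightarrow> y \<in> part1 M \<Longrightarrow> x \<oplus>\<^bsub>M\<^esub> y \<in> part1 M" "x \<in> part1 M \<Longrightarrow> \<ominus>\<^bsub>M\<^esub> x \<in> part1 M"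
  by (simp_all add: part0_def part1_def e_closed M.act_add M.act_minus)

lemma submodule_part0: "X \<subseteq> part0 M \<Longrightarrow> \<zero>\<^bsub>M\<^esub> \<in> X \<Longrightarrow> (\<And>x y. x \<in> X \<Longrightarrow> y \<in> X \<Longrightarrow> x \<oplus>\<^bsub>M\<^esub> y \<in> X) \<Longrightarrow>
    (\<And>a x. a \<in> carrier A \<Longrightarrow> x \<in> X \<Longrightarrow> in0 a \<odot>\<^bsub>M\<^esub> x \<in> X) \<Longrightarrow> submodule X D M"
proof (rule M.sub_moduleI)
  fix r x assume X: "X \<subseteq> part0 M" and a: "\<And>a x. a \<in> carrier A \<Longrightarrow> x \<in> X \<Longrightarrow> in0 a \<odot>\<^bsub>M\<^esub> x \<in> X"
    and "r \<in> carrier D" and x: "x \<in> X"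
  obtain a f b where r: "r = (a, f, b)" "a \<in> carrier A" "f \<in> dual_space K A" "b \<in> carrier A"
    using \<open>r \<in> carrier D\<close> by (cases r) (simp add: carrier_D)
  show "r \<odot>\<^bsub>M\<^esub> x \<in> X" using act_part0(1)[OF _ r(2-4)] X x a[OF r(2) x] unfolding r(1) by auto
qed (use part_sub in auto)

text \<open>Stability under \<open>A_1\<close> rests on the left action on \<open>DA\<close>: (m b)
  f = m (b f), and b f is again an element of \<open>DA\<close>.\<close>

lemma submodule_annihilated: "submodule (annihilated M) D M"
proof (rule M.sub_moduleI)
  show "annihilated M \<subseteq> carrier M" using part_sub by (auto simp: annihilated_def)
  show "\<zero>\<^bsub>M\<^esub> \<in> annihilated M" by (simp add: annihilated_def part_subgroup in_closed)
  show "x \<oplus>\<^bsub>M\<^esub> y \<in> annihilated M" if "x \<in> annihilated M" "y \<in> annihilated M" for x y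
    using that by (simp add: annihilated_def part_subgroup in_closed M.act_add part_closed)
  fix r x assume "r \<in> carrier D" and x: "x \<in> annihilated M"
  obtain a f b where r: "r = (a, f, b)" "a \<in> carrier A" "f \<in> dual_space K A" "b \<in> carrier A"
    using \<open>r \<in> carrier D\<close> by (cases r) (simp add: carrier_D)
  have x1: "x \<in> part1 M" and x2: "\<And>g. g \<in> dual_space K A \<Longrightarrow> inD g \<odot>\<^bsub>M\<^esub> x = \<zero>\<^bsub>M\<^esub>"
    using x by (simp_all add: annihilated_def)
  have xM: "x \<in> carrier M" using part_closed(2)[OF x1] .
  have rx: "r \<odot>\<^bsub>M\<^esub> x = in1 b \<odot>\<^bsub>M\<^esub> x"
    using act_part1(1)[OF x1 r(2-4)] x2 r xM by (simp add: M.act_closed in_closed)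
  have "inD g \<odot>\<^bsub>M\<^esub> (in1 b \<odot>\<^bsub>M\<^esub> x) = \<zero>\<^bsub>M\<^esub>" if g: "g \<in> dual_space K A" for g
    using x2[OF dual_act_left[OF g r(4)]] M.act_assoc[OF in_closed(2)[OF r(4)] in_closed(3)[OF g] xM]
    by (simp add: in1_inD[OF g r(4)])
  then show "r \<odot>\<^bsub>M\<^esub> x \<in> annihilated M"
    using act_part1(2)[OF x1 r(2-4)] by (simp add: rx annihilated_def)
qed

definition mod0 :: "('a, 'm) module" where "mod0 = change_scalars in0 (sub_mod M (part0 M))"
definition mod1 :: "('a, 'm) module" where "mod1 = change_scalars in1 (sub_mod M (part1 M))"

lemma mod0_simps [simp]:
  "carrier mod0 = part0 M" "\<zero>\<^bsub>mod0\<^esub> = \<zero>\<^bsub>M\<^esub>" "ring.add mod0 = ring.add M" "smult mod0 = (\<lambda>a x. in0 a \<odot>\<^bsub>M\<^esub> x)"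
  by (simp_all add: mod0_def)

lemma mod1_simps [simp]:
  "carrier mod1 = part1 M" "\<zero>\<^bsub>mod1\<^esub> = \<zero>\<^bsub>M\<^esub>" "ring.add mod1 = ring.add M" "smult mod1 = (\<lambda>a x. in1 a \<odot>\<^bsub>M\<^esub> x)"
  by (simp_all add: mod1_def)

lemma right_module_mod0: "right_module A mod0"
  unfolding mod0_def
  by (rule M.right_module_change_scalars)
    (simp_all add: A.ring_axioms part_sub part_subgroup in_closed in0_hom part_act
      act_part0(2)[OF _ _ dual_zero_closed A.M.zero_closed])

lemma right_module_mod1: "right_module A mod1"
  unfolding mod1_def
  by (rule M.right_module_change_scalars)
    (simp_all add: A.ring_axioms part_sub part_subgroup in_closed in1_hom part_act
      act_part1(2)[OF _ A.M.zero_closed dual_zero_closed])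

text \<open>As \<open>L\<close> contains \<open>part1 M\<close> and is generated by it, the first
  part of \<open>L\<close> is \<open>part1 M\<close> times \<open>DA\<close>, a quotient of a finite
  power of \<open>DA\<close>; \<open>dual_quotient_splits\<close> then gives it a complement
  \<open>X\<close> in the first part of \<open>M\<close>. This \<open>X\<close> is also a complement
  of \<open>L\<close> in \<open>M\<close>, because \<open>L\<close> contains the whole second
  part.\<close>

lemma full_splits:
  assumes fin: "finite (carrier M)" and L: "submodule L D M" and sub: "part1 M \<subseteq> L"
    and full: "full (sub_mod M L)"
  shows "\<exists>X. splits_as D M X L \<and> X \<subseteq> part0 M"
proof -
  note LD = M.submoduleD[OF L]
  interpret V: right_module A mod0 by (rule right_module_mod0)
  interpret SL: right_module D "sub_mod M L" by (rule M.right_module_sub_mod[OF L])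
  define J where "J = L \<inter> part0 M"
  have J: "submodule J A mod0"
  proof (rule V.sub_moduleI)
    show "r \<odot>\<^bsub>mod0\<^esub> x \<in> J" if "r \<in> carrier A" "x \<in> J" for r x
      using that LD(4)[OF in_closed(1)] act_part0(2)[OF _ _ dual_zero_closed A.M.zero_closed]
      by (simp add: J_def)
  qed (use LD(2,3) part_subgroup in \<open>auto simp: J_def\<close>)
  note JD = V.submoduleD[OF J]
  have rJ: "right_module A (sub_mod mod0 J)" by (rule V.right_module_sub_mod[OF J])
  interpret J: right_module A "sub_mod mod0 J" by (rule rJ)
  \<comment> \<open>One copy of \<open>DA\<close> is taken for every element \<open>y\<close> of the
    second part and mapped by f \<mapsto> y f.\<close>
  define Y where "Y = part1 M"
  have Y: "finite Y" using fin part_sub(2) finite_subset by (auto simp: Y_def)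
  have Yc: "y \<in> carrier M" if "y \<in> Y" for y using that part_closed by (simp add: Y_def)
  define t where "t = (\<lambda>y. \<lambda>f\<in>dual_space K A. inD f \<odot>\<^bsub>M\<^esub> y)"
  have t: "t y \<in> mod_hom A dual_mod (sub_mod mod0 J)" if y: "y \<in> Y" for y
  proof (rule mod_homI)
    have yL: "y \<in> L" "y \<in> part1 M" using y sub by (auto simp: Y_def)
    have "inD f \<odot>\<^bsub>M\<^esub> y \<in> J" if "f \<in> dual_space K A" for f
      using LD(4)[OF in_closed(3)[OF that] yL(1)] act_part1(3)[OF yL(2) A.M.zero_closed that A.M.zero_closed]
      by (simp add: J_def)
    then show "t y \<in> carrier dual_mod \<rightarrow>\<^sub>E carrier (sub_mod mod0 J)" by (auto simp: t_def)
    show "t y (f \<oplus>\<^bsub>dual_mod\<^esub> g) = t y f \<oplus>\<^bsub>sub_mod mod0 J\<^esub> t y g"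
      if "f \<in> carrier dual_mod" "g \<in> carrier dual_mod" for f g
      using that Yc[OF y] by (simp add: t_def dual_add_closed inD_add M.act_add_scalar in_closed)
    show "t y (a \<odot>\<^bsub>dual_mod\<^esub> f) = a \<odot>\<^bsub>sub_mod mod0 J\<^esub> t y f"
      if "a \<in> carrier A" "f \<in> carrier dual_mod" for a f
      using that Yc[OF y] M.act_assoc[of "inD f" "in0 a" y]
      by (simp add: t_def dual_act_right in_closed inD_in0)
  qed
  define s where "s = J.copairing Y (\<lambda>_. dual_mod) t"
  have s: "s \<in> mod_hom A (direct_sum Y (\<lambda>_. dual_mod)) (sub_mod mod0 J)"
    unfolding s_def by (rule J.copairing_hom[OF Y right_module_dual_mod t])
  interpret Q: right_module A "direct_sum Y (\<lambda>_. dual_mod)"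
    by (rule right_module_direct_sum[OF A.ring_axioms right_module_dual_mod])
  define J' where "J' = s ` carrier (direct_sum Y (\<lambda>_. dual_mod))"
  have J'J: "J' \<subseteq> J" using mod_hom_closed[OF s] by (auto simp: J'_def simp del: direct_sum_simps)
  have J': "submodule J' A (sub_mod mod0 J)"
    unfolding J'_def by (rule Q.submodule_image[OF rJ s Q.submodule_carrier])
  note J'D = J.submoduleD[OF J']
  have gen: "inD f \<odot>\<^bsub>M\<^esub> y \<in> J'" if y: "y \<in> Y" and f: "f \<in> dual_space K A" for y f
  proof -
    have "s (single Y (\<lambda>_. dual_mod) y f) = t y f"
      unfolding s_def using y f by (intro J.copairing_single[OF Y right_module_dual_mod t]) simp_all
    moreover have "single Y (\<lambda>_. dual_mod) y f \<in> carrier (direct_sum Y (\<lambda>_. dual_mod))"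
      using f by (intro single_closed[OF right_module_dual_mod]) simp
    moreover have "t y f = inD f \<odot>\<^bsub>M\<^esub> y" using f by (simp add: t_def)
    ultimately show ?thesis unfolding J'_def by (intro image_eqI) simp_all
  qed
  \<comment> \<open>\<open>J'\<close> consists of the sums of products y f, and \<open>W\<close> of
    the elements of \<open>L\<close> whose first component is such a sum. It is a submodule
    containing the second part, so fullness makes it all of \<open>L\<close>, and \<open>J\<close>
    is contained in \<open>J'\<close>.\<close>
  define W where "W = {m \<in> L. e0 \<odot>\<^bsub>M\<^esub> m \<in> J'}"
  have "submodule W D (sub_mod M L)"
  proof (rule SL.sub_moduleI)
    show "W \<subseteq> carrier (sub_mod M L)" by (auto simp: W_def)
    show "\<zero>\<^bsub>sub_mod M L\<^esub> \<in> W" using LD(2) J'D(2) by (simp add: W_def e_closed)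
    show "x \<oplus>\<^bsub>sub_mod M L\<^esub> y \<in> W" if "x \<in> W" "y \<in> W" for x y
      using that LD(3,6) J'D(3) by (simp add: W_def M.act_add e_closed)
    fix r x assume "r \<in> carrier D" and x: "x \<in> W"
    obtain a f b where r: "r = (a, f, b)" "a \<in> carrier A" "f \<in> dual_space K A" "b \<in> carrier A"
      using \<open>r \<in> carrier D\<close> by (cases r) (simp add: carrier_D)
    have xL: "x \<in> L" "x \<in> carrier M" "e0 \<odot>\<^bsub>M\<^esub> x \<in> J'" using x LD(6) by (auto simp: W_def)
    have "e0 \<odot>\<^bsub>M\<^esub> (r \<odot>\<^bsub>M\<^esub> x) = in0 a \<odot>\<^bsub>M\<^esub> (e0 \<odot>\<^bsub>M\<^esub> x) \<oplus>\<^bsub>M\<^esub> inD f \<odot>\<^bsub>M\<^esub> (e1 \<odot>\<^bsub>M\<^esub> x)"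
      unfolding r(1) by (rule e_act_general(2)[OF xL(2) r(2-4)])
    also have "\<dots> \<in> J'"
      using J'D(3)[of "in0 a \<odot>\<^bsub>M\<^esub> (e0 \<odot>\<^bsub>M\<^esub> x)"] J'D(4)[OF r(2) xL(3)]
        gen[OF _ r(3), of "e1 \<odot>\<^bsub>M\<^esub> x"] e_act_part(2)[OF xL(2)]
      by (simp add: Y_def)
    finally show "r \<odot>\<^bsub>sub_mod M L\<^esub> x \<in> W"
      using LD(4)[OF \<open>r \<in> carrier D\<close> xL(1)] by (simp add: W_def)
  qed
  moreover have "part1 (sub_mod M L) \<subseteq> W"
    using e_act_other(2) J'D(2) by (auto simp: part_sub_mod[OF LD(1)] W_def)
  ultimately have W: "W = L" using full unfolding full_def by auto
  have "J \<subseteq> J'"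
  proof
    fix x assume "x \<in> J"
    then have "x \<in> W" "e0 \<odot>\<^bsub>M\<^esub> x = x" unfolding W by (simp_all add: J_def part_act)
    then show "x \<in> J'" by (simp add: W_def)
  qed
  then have surj: "s ` carrier (direct_sum Y (\<lambda>_. dual_mod)) = J" using J'J J'_def by simp
  have finV: "finite (carrier mod0)" using fin part_sub(1) finite_subset by auto
  obtain X where X: "splits_as A mod0 X J"
    using dual_quotient_splits[OF right_module_mod0 finV J Y s surj] by blast
  note XS = V.splits_asD[OF X] and XD = V.submoduleD[OF V.splits_asD(1)[OF X]]
  have "splits_as D M X L"
  proof (rule M.splits_asI[OF _ L])
    show "submodule X D M"
      using XD(1,2,3,4) by (intro submodule_part0) simp_all
    show "x = \<zero>\<^bsub>M\<^esub>" if "x \<in> X" "x \<in> L" for x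
      using XS(3)[of x] XD(1) that by (auto simp: J_def)
    fix m assume m: "m \<in> carrier M"
    obtain x j where xj: "x \<in> X" "j \<in> J" "e0 \<odot>\<^bsub>M\<^esub> m = x \<oplus>\<^bsub>M\<^esub> j"
      using XS(4)[of "e0 \<odot>\<^bsub>M\<^esub> m"] e_act_part(1)[OF m] by auto
    have c: "x \<in> carrier M" "j \<in> carrier M" "e1 \<odot>\<^bsub>M\<^esub> m \<in> carrier M" "j \<in> L" "e1 \<odot>\<^bsub>M\<^esub> m \<in> L"
      using xj XD(1) part_sub(1) e_act_part(2)[OF m] sub by (auto simp: J_def part_closed)
    have "m = x \<oplus>\<^bsub>M\<^esub> (j \<oplus>\<^bsub>M\<^esub> e1 \<odot>\<^bsub>M\<^esub> m)"
      using decompose[OF m] xj(3) c by (simp add: M.a_assoc)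
    then show "\<exists>a\<in>X. \<exists>b\<in>L. m = a \<oplus>\<^bsub>M\<^esub> b" using xj(1) LD(3)[OF c(4,5)] by blast
  qed
  then show ?thesis using XD(1) by auto
qed

text \<open>The part of \<open>M\<^sub>1\<close> not annihilated by \<open>DA\<close> embeds into a free module by way of \<open>D(DA) = A\<close>,
  hence is projective.\<close>

lemma annihilated_splits:
  assumes fin: "finite (carrier M)"
  shows "\<exists>T. splits_as D M T (annihilated M) \<and> part0 M \<subseteq> T"
proof -
  interpret V: right_module A mod1 by (rule right_module_mod1)
  have fin0: "finite (carrier mod0)" and fin1: "finite (carrier mod1)"
    using fin part_sub finite_subset by auto
  interpret V0: finite_space K "change_scalars scalar mod0"
    by (rule finite_space_scalars[OF right_module_mod0 fin0])
  interpret VA: finite_space K A by (rule finite_space_A)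
  \<comment> \<open>The free module is indexed by the \<open>K\<close>-linear functionals of the
    first part: finitely many, and enough of them to detect zero.\<close>
  define I where "I = V0.functionals"
  have I: "finite I"
    by (rule finite_subset[of _ "part0 M \<rightarrow>\<^sub>E carrier K"])
      (use fin0 in \<open>auto simp: I_def mod_hom_def finite_K finite_PiE\<close>)
  have fc: "inD f \<odot>\<^bsub>M\<^esub> y \<in> part0 M" if "y \<in> part1 M" "f \<in> dual_space K A" for y f
    by (rule act_part1(3)[OF that(1) A.M.zero_closed that(2) A.M.zero_closed])
  have l: "l x \<in> carrier K" "l (x \<oplus>\<^bsub>M\<^esub> y) = l x \<oplus> l y" "c \<in> carrier K \<Longrightarrow> l (in0 (scalar c) \<odot>\<^bsub>M\<^esub> x) = l x \<otimes> c"
    if "l \<in> I" "x \<in> part0 M" "y \<in> part0 M" for l x y c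
  proof -
    have "l \<in> V0.functionals" using that(1) by (simp add: I_def)
    note mod_hom_closed[OF this] mod_hom_add[OF this] mod_hom_smult[OF this]
    then show "l x \<in> carrier K" "l (x \<oplus>\<^bsub>M\<^esub> y) = l x \<oplus> l y" "c \<in> carrier K \<Longrightarrow> l (in0 (scalar c) \<odot>\<^bsub>M\<^esub> x) = l x \<otimes> c"
      using that(2,3) by simp_all
  qed
  \<comment> \<open>For fixed \<open>l\<close> and \<open>y\<close> the map f \<mapsto> l (y f) is
    \<open>K\<close>-linear on \<open>DA\<close>, hence it is evaluation at an element of
    \<open>A\<close>.\<close>
  have ex: "\<exists>a\<in>carrier A. \<forall>f\<in>dual_space K A. l (inD f \<odot>\<^bsub>M\<^esub> y) = f a"
    if lI: "l \<in> I" and y: "y \<in> part1 M" for l y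
  proof (rule VA.double_dual[where \<psi> = "\<lambda>f. l (inD f \<odot>\<^bsub>M\<^esub> y)", folded dual_space_def])
    have yM: "y \<in> carrier M" using part_closed(2)[OF y] .
    fix f assume f: "f \<in> dual_space K A"
    show "l (inD f \<odot>\<^bsub>M\<^esub> y) \<in> carrier K" by (rule l(1)[OF lI fc[OF y f] fc[OF y f]])
    show "l (inD (\<lambda>x\<in>carrier A. f x \<oplus> g x) \<odot>\<^bsub>M\<^esub> y) = l (inD f \<odot>\<^bsub>M\<^esub> y) \<oplus> l (inD g \<odot>\<^bsub>M\<^esub> y)"
      if g: "g \<in> dual_space K A" for g
      using l(2)[OF lI fc[OF y f] fc[OF y g]] yM
      by (simp add: inD_add M.act_add_scalar in_closed f g)
    show "l (inD (\<lambda>x\<in>carrier A. c \<otimes> f x) \<odot>\<^bsub>M\<^esub> y) = c \<otimes> l (inD f \<odot>\<^bsub>M\<^esub> y)" if c: "c \<in> carrier K" for c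
    proof -
      have "(\<lambda>x\<in>carrier A. c \<otimes> f x) = (\<lambda>x\<in>carrier A. f (scalar c \<otimes>\<^bsub>A\<^esub> x))"
        using f c by (intro restrict_ext) (simp add: scalar_mult dual_smult K.m_comm dual_closed)
      then have "inD (\<lambda>x\<in>carrier A. c \<otimes> f x) = inD f \<otimes>\<^bsub>D\<^esub> in0 (scalar c)"
        by (simp add: inD_in0 f c scalar_closed)
      then have "inD (\<lambda>x\<in>carrier A. c \<otimes> f x) \<odot>\<^bsub>M\<^esub> y = in0 (scalar c) \<odot>\<^bsub>M\<^esub> (inD f \<odot>\<^bsub>M\<^esub> y)"
        by (simp add: M.act_assoc in_closed f c scalar_closed yM)
      then show ?thesis
        using l(3)[OF lI fc[OF y f] fc[OF y f] c] l(1)[OF lI fc[OF y f] fc[OF y f]] c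
        by (simp add: K.m_comm)
    qed
  qed
  define th where "th = (\<lambda>l. \<lambda>y\<in>part1 M. SOME a. a \<in> carrier A \<and> (\<forall>f\<in>dual_space K A. l (inD f \<odot>\<^bsub>M\<^esub> y) = f a))"
  have th: "th l y \<in> carrier A" "f \<in> dual_space K A \<Longrightarrow> f (th l y) = l (inD f \<odot>\<^bsub>M\<^esub> y)"
    if lI: "l \<in> I" and y: "y \<in> part1 M" for l y f
  proof -
    have "\<exists>a. a \<in> carrier A \<and> (\<forall>f\<in>dual_space K A. l (inD f \<odot>\<^bsub>M\<^esub> y) = f a)"
      using ex[OF lI y] by blast
    note * = someI_ex[OF this]
    have "th l y = (SOME a. a \<in> carrier A \<and> (\<forall>f\<in>dual_space K A. l (inD f \<odot>\<^bsub>M\<^esub> y) = f a))"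
      using y by (simp only: th_def restrict_apply')
    note * = *[folded this]
    show "th l y \<in> carrier A" using * by blast
    show "f \<in> dual_space K A \<Longrightarrow> f (th l y) = l (inD f \<odot>\<^bsub>M\<^esub> y)" using * by metis
  qed
  \<comment> \<open>\<open>DA\<close> separates the points of \<open>A\<close>, so the chosen value
    \<open>th l y\<close> is the only possible one. Its \<open>A\<close>-linearity in
    \<open>y\<close> follows by comparing under all elements of \<open>DA\<close>.\<close>
  have uniq: "a = b" if ab: "a \<in> carrier A" "b \<in> carrier A" and "\<And>f. f \<in> dual_space K A \<Longrightarrow> f a = f b" for a b
  proof -
    have "a \<ominus>\<^bsub>A\<^esub> b = \<zero>\<^bsub>A\<^esub>"
    proof (rule VA.functional_separates)
      fix f assume f: "f \<in> VA.functionals"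
      then have "f a = f b" using that(3) by (simp add: dual_space_def)
      then show "f (a \<ominus>\<^bsub>A\<^esub> b) = \<zero>"
        using VA.mod_hom_eq_iff[OF VA.right_module_K f ab] by simp
    qed (use ab in simp)
    then show ?thesis using VA.diff_zero_iff[OF ab] by simp
  qed
  have thom: "th l \<in> mod_hom A mod1 (regular A)" if lI: "l \<in> I" for l
  proof (rule mod_homI)
    show "th l \<in> carrier mod1 \<rightarrow>\<^sub>E carrier (regular A)"
      using th(1)[OF lI] by (intro PiE_I) (simp_all, simp add: th_def)
  next
    fix x y assume "x \<in> carrier mod1" "y \<in> carrier mod1"
    then have xy: "x \<in> part1 M" "y \<in> part1 M" by simp_all
    have "th l (x \<oplus>\<^bsub>M\<^esub> y) = th l x \<oplus>\<^bsub>A\<^esub> th l y"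
    proof (rule uniq)
      fix f assume f: "f \<in> dual_space K A"
      show "f (th l (x \<oplus>\<^bsub>M\<^esub> y)) = f (th l x \<oplus>\<^bsub>A\<^esub> th l y)"
        using l(2)[OF lI fc[OF xy(1) f] fc[OF xy(2) f]]
        by (simp add: th[OF lI] dual_add f xy part_subgroup M.act_add in_closed part_closed)
    qed (simp_all add: th(1)[OF lI] xy part_subgroup)
    then show "th l (x \<oplus>\<^bsub>mod1\<^esub> y) = th l x \<oplus>\<^bsub>regular A\<^esub> th l y" by simp
  next
    fix b x assume b: "b \<in> carrier A" and "x \<in> carrier mod1"
    then have x: "x \<in> part1 M" by simp
    have bx: "in1 b \<odot>\<^bsub>M\<^esub> x \<in> part1 M" by (rule act_part1(2)[OF x A.M.zero_closed dual_zero_closed b])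
    have "th l (in1 b \<odot>\<^bsub>M\<^esub> x) = th l x \<otimes>\<^bsub>A\<^esub> b"
    proof (rule uniq)
      fix f assume f: "f \<in> dual_space K A"
      have "f (th l (in1 b \<odot>\<^bsub>M\<^esub> x)) = l (inD (\<lambda>x\<in>carrier A. f (x \<otimes>\<^bsub>A\<^esub> b)) \<odot>\<^bsub>M\<^esub> x)"
        using M.act_assoc[OF in_closed(2)[OF b] in_closed(3)[OF f] part_closed(2)[OF x]]
        by (simp add: th(2)[OF lI bx f] in1_inD[OF f b])
      also have "\<dots> = f (th l x \<otimes>\<^bsub>A\<^esub> b)"
        using th(2)[OF lI x dual_act_left[OF f b]] th(1)[OF lI x] by simp
      finally show "f (th l (in1 b \<odot>\<^bsub>M\<^esub> x)) = f (th l x \<otimes>\<^bsub>A\<^esub> b)" .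
    qed (simp_all add: th(1)[OF lI] x bx b)
    then show "th l (b \<odot>\<^bsub>mod1\<^esub> x) = b \<odot>\<^bsub>regular A\<^esub> th l x" by simp
  qed
  define \<theta> where "\<theta> = (\<lambda>y\<in>carrier mod1. \<lambda>l\<in>I. th l y)"
  have \<theta>: "\<theta> \<in> mod_hom A mod1 (direct_sum I (\<lambda>_. regular A))"
    unfolding \<theta>_def by (rule mod_hom_pairing[OF right_module_mod1 thom])
  \<comment> \<open>If all coordinates of \<open>\<theta> y\<close> vanish, every functional
    \<open>l\<close> vanishes on every product y f, so all these products are zero.\<close>
  have ker: "\<theta> y = \<zero>\<^bsub>direct_sum I (\<lambda>_. regular A)\<^esub> \<longleftrightarrow> y \<in> annihilated M" if y: "y \<in> part1 M" for y
  proof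
    assume 0: "\<theta> y = \<zero>\<^bsub>direct_sum I (\<lambda>_. regular A)\<^esub>"
    have "inD f \<odot>\<^bsub>M\<^esub> y = \<zero>\<^bsub>change_scalars scalar mod0\<^esub>" if f: "f \<in> dual_space K A" for f
    proof (rule V0.functional_separates)
      fix l assume "l \<in> V0.functionals"
      then have lI: "l \<in> I" by (simp add: I_def)
      then have "th l y = \<zero>\<^bsub>A\<^esub>" using fun_cong[OF 0, of l] y by (simp add: \<theta>_def)
      then show "l (inD f \<odot>\<^bsub>M\<^esub> y) = \<zero>" using th(2)[OF lI y f] dual_zero[OF f] by simp
    qed (use fc[OF y f] in simp)
    then show "y \<in> annihilated M" using y by (simp add: annihilated_def)
  next
    assume a: "y \<in> annihilated M"
    have "th l y = \<zero>\<^bsub>A\<^esub>" if lI: "l \<in> I" for l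
    proof (rule uniq)
      fix f assume f: "f \<in> dual_space K A"
      have "l \<zero>\<^bsub>M\<^esub> = \<zero>"
        using V0.mod_hom_zero[OF V0.right_module_K, of l] lI by (simp add: I_def)
      then show "f (th l y) = f \<zero>\<^bsub>A\<^esub>"
        using a f by (simp add: th(2)[OF lI y f] annihilated_def dual_zero)
    qed (simp_all add: th(1)[OF lI y])
    then show "\<theta> y = \<zero>\<^bsub>direct_sum I (\<lambda>_. regular A)\<^esub>"
      using y by (auto simp: \<theta>_def intro!: restrict_ext)
  qed
  have "{x \<in> carrier mod1. \<theta> x = \<zero>\<^bsub>direct_sum I (\<lambda>_. regular A)\<^esub>} = annihilated M"
    using ker by (auto simp: annihilated_def simp del: direct_sum_simps)
  then obtain P where P: "splits_as A mod1 (annihilated M) P"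
    using kernel_splits[OF right_module_mod1 fin1 I \<theta>] by auto
  note PS = V.splits_asD[OF P] and PD = V.submoduleD[OF V.splits_asD(2)[OF P]]
  \<comment> \<open>\<open>P\<close> is a submodule of \<open>mod1\<close> and need not be stable
    under \<open>DA\<close>; \<open>T\<close> consists of \<open>P\<close> together with the whole
    first part, where the products with \<open>DA\<close> land.\<close>
  define T where "T = {m \<in> carrier M. e1 \<odot>\<^bsub>M\<^esub> m \<in> P}"
  have T: "submodule T D M"
  proof (rule M.sub_moduleI)
    show "T \<subseteq> carrier M" by (auto simp: T_def)
    show "\<zero>\<^bsub>M\<^esub> \<in> T" using PD(2) by (simp add: T_def e_closed)
    show "x \<oplus>\<^bsub>M\<^esub> y \<in> T" if "x \<in> T" "y \<in> T" for x y
      using that PD(3) by (simp add: T_def M.act_add e_closed)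
    fix r x assume "r \<in> carrier D" and x: "x \<in> T"
    obtain a f b where r: "r = (a, f, b)" "a \<in> carrier A" "f \<in> dual_space K A" "b \<in> carrier A"
      using \<open>r \<in> carrier D\<close> by (cases r) (simp add: carrier_D)
    have xM: "x \<in> carrier M" "e1 \<odot>\<^bsub>M\<^esub> x \<in> P" using x by (auto simp: T_def)
    have "e1 \<odot>\<^bsub>M\<^esub> (r \<odot>\<^bsub>M\<^esub> x) \<in> P"
      unfolding r(1) e_act_general(1)[OF xM(1) r(2-4)] using PD(4)[OF r(4) xM(2)] by simp
    then show "r \<odot>\<^bsub>M\<^esub> x \<in> T"
      using M.act_closed[OF \<open>r \<in> carrier D\<close> xM(1)] by (simp add: T_def)
  qed
  have sub0: "part0 M \<subseteq> T" using PD(2) by (auto simp: T_def e_act_other(1) part_closed)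
  have "splits_as D M T (annihilated M)"
  proof (rule M.splits_asI[OF T submodule_annihilated])
    show "x = \<zero>\<^bsub>M\<^esub>" if "x \<in> T" "x \<in> annihilated M" for x
      using PS(3)[of x] that by (simp add: T_def annihilated_def part_act)
    fix m assume m: "m \<in> carrier M"
    obtain z p where zp: "z \<in> annihilated M" "p \<in> P" "e1 \<odot>\<^bsub>M\<^esub> m = z \<oplus>\<^bsub>M\<^esub> p"
      using PS(4)[of "e1 \<odot>\<^bsub>M\<^esub> m"] e_act_part(2)[OF m] by auto
    have c: "z \<in> carrier M" "p \<in> part1 M" "p \<in> carrier M" "e0 \<odot>\<^bsub>M\<^esub> m \<in> T" "e0 \<odot>\<^bsub>M\<^esub> m \<in> carrier M"
      using zp PD(1) e_act_part(1)[OF m] sub0 M.submoduleD(1)[OF submodule_annihilated]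
      by (auto simp: part_closed)
    have pT: "p \<in> T" using c zp(2) by (simp add: T_def part_act)
    have "m = (e0 \<odot>\<^bsub>M\<^esub> m \<oplus>\<^bsub>M\<^esub> p) \<oplus>\<^bsub>M\<^esub> z"
      using decompose[OF m] zp(3) c by (simp add: M.a_ac)
    moreover have "e0 \<odot>\<^bsub>M\<^esub> m \<oplus>\<^bsub>M\<^esub> p \<in> T" by (rule M.submoduleD(3)[OF T c(4) pT])
    ultimately show "\<exists>a\<in>T. \<exists>b\<in>annihilated M. m = a \<oplus>\<^bsub>M\<^esub> b" using zp(1) by blast
  qed
  then show ?thesis using sub0 by blast
qed

end

section \<open>Composition factors and indecomposable summands\<close>

context right_module
begin

text \<open>Submodules of the quotient correspond to submodules between \<open>L\<close> and
  \<open>N\<close>; \<open>P'\<close> is the preimage of \<open>P\<close>, and \<open>P\<close> its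
  image.\<close>

lemma simple_quot_mod:
  assumes L: "submodule L R M" and N: "submodule N R M" and sub: "L \<subset> N"
    and between: "\<And>P. submodule P R M \<Longrightarrow> L \<subseteq> P \<Longrightarrow> P \<subseteq> N \<Longrightarrow> P = L \<or> P = N"
  shows "simple_module R (quot_mod (sub_mod M N) L)"
proof -
  interpret N: right_module R "sub_mod M N" by (rule right_module_sub_mod[OF N])
  have LN: "submodule L R (sub_mod M N)" using L sub by (simp add: submodule_sub_mod_iff[OF N])
  note rQ = N.right_module_quot_mod[OF LN] and q = N.quot_proj_hom[OF LN]
    and surj = N.quot_proj_surj[OF LN] and ker = N.quot_proj_ker[OF LN]
  interpret Q: right_module R "quot_mod (sub_mod M N) L" by (rule rQ)
  show ?thesis
    unfolding simple_module_def
  proof (intro conjI allI impI rQ)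
    obtain x where x: "x \<in> N" "x \<notin> L" using sub by blast
    then have "N.quot_proj L x \<noteq> \<zero>\<^bsub>quot_mod (sub_mod M N) L\<^esub>" using ker[of x] by simp
    moreover have "N.quot_proj L x \<in> carrier (quot_mod (sub_mod M N) L)"
      using mod_hom_closed[OF q] x(1) by (metis sub_mod_simps(1))
    ultimately show "carrier (quot_mod (sub_mod M N) L) \<noteq> {\<zero>\<^bsub>quot_mod (sub_mod M N) L\<^esub>}" by blast
  next
    fix P assume P: "submodule P R (quot_mod (sub_mod M N) L)"
    define P' where "P' = {x \<in> N. N.quot_proj L x \<in> P}"
    have P': "submodule P' R M" "P' \<subseteq> N"
      using N.submodule_vimage[OF rQ q P] by (simp_all add: submodule_sub_mod_iff[OF N] P'_def)
    have "L \<subseteq> P'"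
    proof
      fix x assume x: "x \<in> L"
      then have xN: "x \<in> N" using sub by blast
      then have "N.quot_proj L x = \<zero>\<^bsub>quot_mod (sub_mod M N) L\<^esub>" using ker[of x] x by simp
      then show "x \<in> P'" using xN Q.submoduleD(2)[OF P] by (simp add: P'_def)
    qed
    then have "P' = L \<or> P' = N" using between P' by blast
    moreover have im: "P = N.quot_proj L ` P'"
    proof (intro Set.equalityI subsetI)
      fix y assume y: "y \<in> P"
      then have "y \<in> carrier (quot_mod (sub_mod M N) L)" by (rule Q.submoduleD(6)[OF P])
      then obtain x where "x \<in> N" "y = N.quot_proj L x" unfolding surj[symmetric] by auto
      then show "y \<in> N.quot_proj L ` P'" using y by (simp add: P'_def)
    qed (auto simp: P'_def)
    moreover have "P = {\<zero>\<^bsub>quot_mod (sub_mod M N) L\<^esub>}" if "P' = L"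
    proof -
      have "N.quot_proj L ` L = {\<zero>\<^bsub>quot_mod (sub_mod M N) L\<^esub>}"
      proof (intro Set.equalityI subsetI)
        fix y assume "y \<in> N.quot_proj L ` L"
        then obtain x where "x \<in> L" "y = N.quot_proj L x" by blast
        then show "y \<in> {\<zero>\<^bsub>quot_mod (sub_mod M N) L\<^esub>}" using ker[of x] sub by auto
      next
        fix y assume "y \<in> {\<zero>\<^bsub>quot_mod (sub_mod M N) L\<^esub>}"
        moreover have "N.quot_proj L \<zero>\<^bsub>M\<^esub> = \<zero>\<^bsub>quot_mod (sub_mod M N) L\<^esub>"
          using ker[of "\<zero>\<^bsub>M\<^esub>"] submoduleD(2)[OF L] submoduleD(2)[OF N] by simp
        ultimately show "y \<in> N.quot_proj L ` L" using submoduleD(2)[OF L] by force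
      qed
      then show ?thesis using im that by simp
    qed
    moreover have "P = carrier (quot_mod (sub_mod M N) L)" if "P' = N"
      using im that surj by simp
    ultimately show "P = {\<zero>\<^bsub>quot_mod (sub_mod M N) L\<^esub>} \<or> P = carrier (quot_mod (sub_mod M N) L)" by blast
  qed
qed

abbreviation simple_step :: "'m set \<Rightarrow> 'm set \<Rightarrow> bool" where
  "simple_step L N \<equiv> L \<subseteq> N \<and> simple_module R (quot_mod (sub_mod M N) L)"

text \<open>\<open>P\<close> is chosen minimal among the submodules strictly above \<open>L\<close>
  and inside \<open>N\<close>, so nothing fits in between.\<close>

lemma ex_simple_above:
  assumes fin: "finite (carrier M)" and L: "submodule L R M" and N: "submodule N R M" and sub: "L \<subset> N"
  obtains P where "submodule P R M" "L \<subset> P" "P \<subseteq> N" "simple_step L P"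
proof -
  let ?S = "{P. submodule P R M \<and> L \<subset> P \<and> P \<subseteq> N}"
  have "N \<in> ?S" using N sub by blast
  then have "?S \<noteq> {}" by blast
  from finite_has_minimal[OF finite_submodules[OF fin] this]
  obtain P where P: "P \<in> ?S" "\<forall>P'\<in>?S. P' \<subseteq> P \<longrightarrow> P = P'" by blast
  have "P' = L \<or> P' = P" if P': "submodule P' R M" "L \<subseteq> P'" "P' \<subseteq> P" for P'
  proof (cases "P' = L")
    case False
    then have "P' \<in> ?S" using P(1) P' by auto
    from P(2)[rule_format, OF this P'(3)] show ?thesis by simp
  qed simp
  then have "simple_module R (quot_mod (sub_mod M P) L)"
    using P(1) by (intro simple_quot_mod L) auto
  then show ?thesis using that[of P] P(1) by blast
qed

lemma ex_simple_below:
  assumes fin: "finite (carrier M)" and L: "submodule L R M" and N: "submodule N R M" and sub: "L \<subset> N"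
  obtains P where "submodule P R M" "L \<subseteq> P" "P \<subset> N" "simple_step P N"
proof -
  let ?S = "{P. submodule P R M \<and> L \<subseteq> P \<and> P \<subset> N}"
  have "L \<in> ?S" using L sub by blast
  then have "?S \<noteq> {}" by blast
  from finite_has_maximal[OF finite_submodules[OF fin] this]
  obtain P where P: "P \<in> ?S" "\<forall>P'\<in>?S. P \<subseteq> P' \<longrightarrow> P = P'" by blast
  have "P' = P \<or> P' = N" if P': "submodule P' R M" "P \<subseteq> P'" "P' \<subseteq> N" for P'
  proof (cases "P' = N")
    case False
    then have "P' \<in> ?S" using P(1) P' by auto
    from P(2)[rule_format, OF this P'(2)] show ?thesis by simp
  qed simp
  then have "simple_module R (quot_mod (sub_mod M N) P)"
    using P(1) by (intro simple_quot_mod N) auto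
  then show ?thesis using that[of P] P(1) by blast
qed

lemma ex_chain:
  assumes fin: "finite (carrier M)" and N: "submodule N R M" and "submodule L R M" "L \<subseteq> N"
  shows "\<exists>Ls. Ls \<noteq> [] \<and> hd Ls = L \<and> last Ls = N \<and> (\<forall>P\<in>set Ls. submodule P R M) \<and> successively simple_step Ls"
  using assms(3,4)
\<comment> \<open>Every simple step enlarges \<open>L\<close>, so the number of elements of
  \<open>N\<close> still missing decreases.\<close>
proof (induction "card (N - L)" arbitrary: L rule: less_induct)
  case less
  show ?case
  proof (cases "L = N")
    case True
    then show ?thesis using N by (intro exI[of _ "[L]"]) simp
  next
    case False
    then obtain P where P: "submodule P R M" "L \<subset> P" "P \<subseteq> N" "simple_step L P"
      using ex_simple_above[OF fin less.prems(1) N] less.prems(2) by (metis psubsetI)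
    have "finite N" using submoduleD(1)[OF N] fin finite_subset by blast
    then have "card (N - P) < card (N - L)"
      using P(2,3) by (intro psubset_card_mono) auto
    then obtain Ls where Ls: "Ls \<noteq> []" "hd Ls = P" "last Ls = N" "\<forall>P\<in>set Ls. submodule P R M"
      "successively simple_step Ls"
      using less.hyps[OF _ P(1,3)] by blast
    then have "successively simple_step (L # Ls)" using P(4) by (simp add: successively_Cons)
    then show ?thesis using Ls less.prems(1) by (intro exI[of _ "L # Ls"]) simp
  qed
qed

text \<open>A chain of simple steps from zero to \<open>L\<close> and another from \<open>N\<close>
  to the top, joined by the given step, form a composition series in which this step occurs.\<close>

lemma composition_factorI:
  assumes fin: "finite (carrier M)" and L: "submodule L R M" and N: "submodule N R M"
    and LN: "simple_step L N" and S: "mod_iso R (quot_mod (sub_mod M N) L) S"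
  shows "composition_factor R M S"
proof -
  obtain Ls where Ls: "Ls \<noteq> []" "hd Ls = {\<zero>\<^bsub>M\<^esub>}" "last Ls = L" "\<forall>P\<in>set Ls. submodule P R M"
    "successively simple_step Ls"
    using ex_chain[OF fin L submodule_zero] submoduleD(2)[OF L] by auto
  obtain Ns where Ns: "Ns \<noteq> []" "hd Ns = N" "last Ns = carrier M" "\<forall>P\<in>set Ns. submodule P R M"
    "successively simple_step Ns"
    using ex_chain[OF fin submodule_carrier N submoduleD(1)[OF N]] by auto
  have "successively simple_step (Ls @ Ns)"
    using Ls Ns LN by (simp add: successively_append_iff)
  then have "composition_series R M (Ls @ Ns)"
    using Ls Ns unfolding composition_series_def successively_conv_nth by auto
  \<comment> \<open>\<open>Ls\<close> is nonempty and ends in \<open>L\<close>, and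
    \<open>Ns\<close> begins with \<open>N\<close>, so the step sits at index
    \<open>length Ls - 1\<close>.\<close>
  moreover have "(Ls @ Ns) ! (length Ls - 1) = L" "(Ls @ Ns) ! Suc (length Ls - 1) = N"
    using Ls(1,3) Ns(1,2) by (simp_all add: nth_append last_conv_nth hd_conv_nth)
  moreover have "Suc (length Ls - 1) < length (Ls @ Ns)" using Ls(1) Ns(1) by (simp add: Suc_diff_1)
  ultimately show ?thesis unfolding composition_factor_def using S by metis
qed

lemma simple_module_iso:
  assumes M: "simple_module R M" and N: "right_module R N" and iso: "mod_iso R M N"
  shows "simple_module R N"
proof -
  interpret N: right_module R N by fact
  obtain f where f: "f \<in> mod_hom R M N" "bij_betw f (carrier M) (carrier N)"
    using iso by (auto simp: mod_iso_def)
  have im: "f ` carrier M = carrier N" and inj: "inj_on f (carrier M)" using f(2) by (auto simp: bij_betw_def)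
  have f0: "f ` {\<zero>\<^bsub>M\<^esub>} = {\<zero>\<^bsub>N\<^esub>}" using mod_hom_zero[OF N f(1)] by simp
  have "carrier N \<noteq> {\<zero>\<^bsub>N\<^esub>}"
  proof
    assume "carrier N = {\<zero>\<^bsub>N\<^esub>}"
    then have "f ` carrier M = f ` {\<zero>\<^bsub>M\<^esub>}" using im f0 by simp
    then have "carrier M = {\<zero>\<^bsub>M\<^esub>}" using inj_on_image_eq_iff[OF inj order_refl, of "{\<zero>\<^bsub>M\<^esub>}"] by simp
    then show False using M by (simp add: simple_module_def)
  qed
  moreover have "L = {\<zero>\<^bsub>N\<^esub>} \<or> L = carrier N" if L: "submodule L R N" for L
  proof -
    let ?P = "{x \<in> carrier M. f x \<in> L}"
    have "?P = {\<zero>\<^bsub>M\<^esub>} \<or> ?P = carrier M"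
      using M submodule_vimage[OF N f(1) L] by (simp add: simple_module_def)
    moreover have fP: "f ` ?P = L"
    proof (intro Set.equalityI subsetI)
      fix y assume y: "y \<in> L"
      then have "y \<in> f ` carrier M" using im N.submoduleD(6)[OF L] by simp
      then show "y \<in> f ` ?P" using y by blast
    qed blast
    ultimately consider "f ` {\<zero>\<^bsub>M\<^esub>} = L" | "f ` carrier M = L" by (elim disjE) simp_all
    then show ?thesis unfolding im f0 by cases simp_all
  qed
  ultimately show ?thesis using N by (simp add: simple_module_def)
qed

text \<open>Associativity of internal direct sums: the second summand of \<open>L\<close> is
  absorbed into the complement. A summand of a summand is thereby a summand of
  \<open>M\<close>.\<close>

lemma splits_as_refine:
  assumes S: "splits_as R M L L'" and T: "splits_as R (sub_mod M L) P P'"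
  shows "splits_as R M P (set_add M P' L')"
proof -
  note S' = splits_asD[OF S]
  interpret L: right_module R "sub_mod M L" by (rule right_module_sub_mod[OF S'(1)])
  note T' = L.splits_asD[OF T]
  have P: "submodule P R M" "P \<subseteq> L" "submodule P' R M" "P' \<subseteq> L"
    using T'(1,2) by (simp_all add: submodule_sub_mod_iff[OF S'(1)])
  have c: "x \<in> L \<Longrightarrow> x \<in> carrier M" "x \<in> L' \<Longrightarrow> x \<in> carrier M" for x
    using submoduleD(6)[OF S'(1)] submoduleD(6)[OF S'(2)] by auto
  show ?thesis
  proof (rule splits_asI[OF P(1) submodule_set_add[OF P(3) S'(2)]])
    fix x assume x: "x \<in> P" "x \<in> set_add M P' L'"
    then obtain p l where pl: "p \<in> P'" "l \<in> L'" "x = p \<oplus>\<^bsub>M\<^esub> l" by (auto simp: mem_set_add)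
    have cc: "p \<in> carrier M" "l \<in> carrier M" using pl P(4) c by auto
    have "\<ominus>\<^bsub>M\<^esub> p \<oplus>\<^bsub>M\<^esub> x = l" using cc by (simp add: pl(3) M.r_neg1)
    moreover have "\<ominus>\<^bsub>M\<^esub> p \<oplus>\<^bsub>M\<^esub> x \<in> L"
      using submoduleD(3,5)[OF S'(1)] P(2,4) x(1) pl(1) by blast
    ultimately have "l = \<zero>\<^bsub>M\<^esub>" using S'(3)[OF _ pl(2)] by simp
    then have "x = p" using pl(3) cc by simp
    then show "x = \<zero>\<^bsub>M\<^esub>" using T'(3)[OF x(1)] pl(1) by simp
  next
    fix x assume "x \<in> carrier M"
    with S'(4) obtain l l' where l: "l \<in> L" "l' \<in> L'" "x = l \<oplus>\<^bsub>M\<^esub> l'" by blast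
    obtain p p' where p: "p \<in> P" "p' \<in> P'" "l = p \<oplus>\<^bsub>M\<^esub> p'" using T'(4)[of l] l(1) by auto
    have "p \<in> carrier M" "p' \<in> carrier M" "l' \<in> carrier M"
      using p(1,2) l(2) P(2,4) c by auto
    then have "x = p \<oplus>\<^bsub>M\<^esub> (p' \<oplus>\<^bsub>M\<^esub> l')" using l(3) p(3) by (simp add: M.a_assoc)
    moreover have "p' \<oplus>\<^bsub>M\<^esub> l' \<in> set_add M P' L'" unfolding mem_set_add using p(2) l(2) by blast
    ultimately show "\<exists>a\<in>P. \<exists>b\<in>set_add M P' L'. x = a \<oplus>\<^bsub>M\<^esub> b" using p(1) by blast
  qed
qed

lemma splits_as_zero: "splits_as R M (carrier M) {\<zero>\<^bsub>M\<^esub>}"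
proof (rule splits_asI[OF submodule_carrier submodule_zero])
  show "\<exists>a\<in>carrier M. \<exists>b\<in>{\<zero>\<^bsub>M\<^esub>}. x = a \<oplus>\<^bsub>M\<^esub> b" if "x \<in> carrier M" for x
    using that by (intro bexI[of _ x] bexI[of _ "\<zero>\<^bsub>M\<^esub>"]) auto
qed simp

text \<open>A direct summand minimal among the nonzero ones is indecomposable, because its own
  summands are summands of \<open>M\<close> by \<open>splits_as_refine\<close>.\<close>

lemma ex_indecomposable_summand:
  assumes fin: "finite (carrier M)" and nz: "carrier M \<noteq> {\<zero>\<^bsub>M\<^esub>}"
  obtains L L' where "splits_as R M L L'" "indecomposable R (sub_mod M L)"
proof -
  define S where "S = {L. L \<noteq> {\<zero>\<^bsub>M\<^esub>} \<and> (\<exists>L'. splits_as R M L L')}"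
  have "S \<subseteq> {P. submodule P R M \<and> True}" using splits_asD(1) by (auto simp: S_def)
  then have finS: "finite S" by (rule finite_subset) (rule finite_submodules[OF fin])
  have "carrier M \<in> S" using splits_as_zero nz by (auto simp: S_def)
  then have "S \<noteq> {}" by blast
  from finite_has_minimal[OF finS this]
  obtain L where L: "L \<in> S" "\<forall>P\<in>S. P \<subseteq> L \<longrightarrow> L = P" by blast
  then obtain L' where LL': "L \<noteq> {\<zero>\<^bsub>M\<^esub>}" "splits_as R M L L'" by (auto simp: S_def)
  note LS = splits_asD(1)[OF LL'(2)]
  interpret L: right_module R "sub_mod M L" by (rule right_module_sub_mod[OF LS])
  have "P = {\<zero>\<^bsub>M\<^esub>} \<or> P' = {\<zero>\<^bsub>M\<^esub>}" if T: "splits_as R (sub_mod M L) P P'" for P P'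
  proof (rule ccontr)
    assume ne: "\<not> (P = {\<zero>\<^bsub>M\<^esub>} \<or> P' = {\<zero>\<^bsub>M\<^esub>})"
    note T' = L.splits_asD[OF T]
    have "P \<in> S" using splits_as_refine[OF LL'(2) T] ne by (auto simp: S_def)
    moreover have "P \<subseteq> L" "P' \<subseteq> L" using T'(1,2) by (simp_all add: submodule_sub_mod_iff[OF LS])
    \<comment> \<open>Minimality gives \<open>P = L\<close>, so \<open>P'\<close> is contained in
      \<open>P\<close> and hence in their zero intersection.\<close>
    ultimately have "P' \<subseteq> P" using L(2) by blast
    then have "P' \<subseteq> {\<zero>\<^bsub>M\<^esub>}" using T'(3) by auto
    then show False using ne L.submoduleD(2)[OF T'(2)] by auto
  qed
  then have "indecomposable R (sub_mod M L)"
    using LL'(1) L.right_module_axioms by (simp add: indecomposable_def)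
  then show ?thesis using that LL'(2) by blast
qed

text \<open>The inductive step for external sums, with the new summand placed at index
  \<open>n\<close>. The isomorphism is built out of \<open>M\<close> by components: the projection
  to \<open>L\<close> feeds the last index, the projection to \<open>L'\<close> the earlier
  ones.\<close>

lemma direct_sum_Suc_iso:
  assumes S: "splits_as R M L L'" and N: "\<And>i. i < n \<Longrightarrow> right_module R (N i)" and P: "right_module R P"
    and iso: "mod_iso R (direct_sum {..<n} N) (sub_mod M L')" "mod_iso R P (sub_mod M L)"
  shows "mod_iso R (direct_sum {..<Suc n} (N(n := P))) M"
proof -
  note S' = splits_asD[OF S]
  let ?N = "N(n := P)"
  have c: "x \<in> L \<Longrightarrow> x \<in> carrier M" "x \<in> L' \<Longrightarrow> x \<in> carrier M" for x
    using submoduleD(6)[OF S'(1)] submoduleD(6)[OF S'(2)] by auto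
  have rN: "right_module R (?N i)" if "i \<in> {..<Suc n}" for i
    using that N P by (auto simp: less_Suc_eq)
  have rS: "right_module R (direct_sum {..<n} N)" by (rule right_module_direct_sum[OF R.ring_axioms]) (use N in simp)
  have rS': "right_module R (direct_sum {..<Suc n} ?N)" by (rule right_module_direct_sum[OF R.ring_axioms rN])
  obtain p where p: "p \<in> mod_hom R M (sub_mod M L')" "\<forall>x\<in>L. p x = \<zero>\<^bsub>M\<^esub>"
    "\<forall>x\<in>L'. p x = x" "\<forall>x\<in>carrier M. p x = \<zero>\<^bsub>M\<^esub> \<longrightarrow> x \<in> L"
    by (rule splits_as_proj[OF S]) (rule that)
  obtain q where q: "q \<in> mod_hom R M (sub_mod M L)" "\<forall>x\<in>L'. q x = \<zero>\<^bsub>M\<^esub>"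
    "\<forall>x\<in>L. q x = x" "\<forall>x\<in>carrier M. q x = \<zero>\<^bsub>M\<^esub> \<longrightarrow> x \<in> L'"
    by (rule splits_as_proj[OF splits_as_sym[OF S]]) (rule that)
  obtain \<beta> where \<beta>: "\<beta> \<in> mod_hom R (sub_mod M L') (direct_sum {..<n} N)" "bij_betw \<beta> L' (carrier (direct_sum {..<n} N))"
    using mod_iso_sym[OF iso(1) rS] by (auto simp: mod_iso_def)
  obtain \<alpha> where \<alpha>: "\<alpha> \<in> mod_hom R (sub_mod M L) P" "bij_betw \<alpha> L (carrier P)"
    using mod_iso_sym[OF iso(2) P] by (auto simp: mod_iso_def)
  interpret L: right_module R "sub_mod M L" by (rule right_module_sub_mod[OF S'(1)])
  interpret L': right_module R "sub_mod M L'" by (rule right_module_sub_mod[OF S'(2)])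
  note \<alpha>p = mod_hom_compose[OF q(1) \<alpha>(1) right_module_axioms]
  note \<beta>p = mod_hom_compose[OF p(1) \<beta>(1) right_module_axioms]
  define g where "g = (\<lambda>i. if i = n then compose (carrier M) \<alpha> q
    else (\<lambda>x\<in>carrier M. compose (carrier M) \<beta> p x i))"
  have g: "g i \<in> mod_hom R M (?N i)" if "i \<in> {..<Suc n}" for i
    using that \<alpha>p mod_hom_component[OF right_module_axioms _ \<beta>p, of i] by (auto simp: g_def less_Suc_eq)
  define h where "h = (\<lambda>x\<in>carrier M. \<lambda>i\<in>{..<Suc n}. g i x)"
  have h: "h \<in> mod_hom R M (direct_sum {..<Suc n} ?N)"
    unfolding h_def by (rule mod_hom_pairing[OF right_module_axioms g])
  have hn: "h x n = \<alpha> (q x)" and hi: "i < n \<Longrightarrow> h x i = \<beta> (p x) i" if "x \<in> carrier M" for x i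
    using that by (simp_all add: h_def g_def compose_def)
  have "inj_on h (carrier M)"
    unfolding mod_hom_inj_iff[OF rS' h]
  proof (intro ballI impI)
    fix x assume x: "x \<in> carrier M" and 0: "h x = \<zero>\<^bsub>direct_sum {..<Suc n} ?N\<^esub>"
    have pL: "p x \<in> L'" and qL: "q x \<in> L" using mod_hom_closed[OF p(1) x] mod_hom_closed[OF q(1) x] by auto
    have "\<alpha> (q x) = \<zero>\<^bsub>P\<^esub>" using hn[OF x] 0 by simp
    then have "q x = \<zero>\<^bsub>M\<^esub>"
      using L.mod_hom_inj_iff[OF P \<alpha>(1)] \<alpha>(2) qL by (simp add: bij_betw_def)
    then have xL: "x \<in> L'" using q(4) x by blast
    have "\<beta> (p x) = \<zero>\<^bsub>direct_sum {..<n} N\<^esub>"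
    proof (rule extensionalityI[of _ "{..<n}"])
      show "\<beta> (p x) \<in> extensional {..<n}" using mod_hom_closed[OF \<beta>(1)] pL by (simp add: PiE_iff)
      fix i assume "i \<in> {..<n}"
      then show "\<beta> (p x) i = \<zero>\<^bsub>direct_sum {..<n} N\<^esub> i" using hi[OF x, of i] 0 by simp
    qed simp
    then have "p x = \<zero>\<^bsub>M\<^esub>"
      using L'.mod_hom_inj_iff[OF rS \<beta>(1)] \<beta>(2) pL by (simp add: bij_betw_def)
    then show "x = \<zero>\<^bsub>M\<^esub>" using p(3) xL by simp
  qed
  moreover have "y \<in> h ` carrier M" if y: "y \<in> carrier (direct_sum {..<Suc n} ?N)" for y
  proof -
    have "y n \<in> carrier P" using y by (auto simp: PiE_iff dest!: bspec[of _ _ n])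
    then obtain a where a: "a \<in> L" "\<alpha> a = y n" using \<alpha>(2) by (metis bij_betw_def imageE)
    have "y i \<in> carrier (N i)" if "i < n" for i using y that by (auto simp: PiE_iff dest!: bspec[of _ _ i])
    then have "restrict y {..<n} \<in> carrier (direct_sum {..<n} N)" by auto
    then obtain b where b: "b \<in> L'" "\<beta> b = restrict y {..<n}" using \<beta>(2) by (metis bij_betw_def imageE)
    have ab: "a \<in> carrier M" "b \<in> carrier M" using a b c by auto
    have ab': "a \<oplus>\<^bsub>M\<^esub> b \<in> carrier M" using ab by simp
    have "q (a \<oplus>\<^bsub>M\<^esub> b) = a" "p (a \<oplus>\<^bsub>M\<^esub> b) = b"
      using a(1) b(1) ab p(2,3) q(2,3) by (simp_all add: mod_hom_add[OF p(1)] mod_hom_add[OF q(1)])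
    then have "h (a \<oplus>\<^bsub>M\<^esub> b) n = y n" "\<And>i. i < n \<Longrightarrow> h (a \<oplus>\<^bsub>M\<^esub> b) i = y i"
      using hn[OF ab'] hi[OF ab'] a(2) b(2) by simp_all
    then have "h (a \<oplus>\<^bsub>M\<^esub> b) = y"
      using y ab' by (intro extensionalityI[of _ "{..<Suc n}"]) (auto simp: h_def PiE_iff less_Suc_eq)
    then show ?thesis using ab' by blast
  qed
  ultimately have "bij_betw h (carrier M) (carrier (direct_sum {..<Suc n} ?N))"
    using mod_hom_closed[OF h] by (auto simp: bij_betw_def simp del: direct_sum_simps)
  then have "mod_iso R M (direct_sum {..<Suc n} ?N)" by (rule mod_isoI[OF h])
  then show ?thesis by (rule mod_iso_sym[OF _ right_module_axioms])
qed

end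

lemma (in right_module) indecomposable_iso:
  assumes M: "indecomposable R M" and N: "right_module R N" and iso: "mod_iso R M N"
  shows "indecomposable R N"
proof -
  interpret N: right_module R N by fact
  obtain g where g: "g \<in> mod_hom R N M" "bij_betw g (carrier N) (carrier M)"
    using mod_iso_sym[OF iso right_module_axioms] by (auto simp: mod_iso_def)
  have im: "g ` carrier N = carrier M" and inj: "inj_on g (carrier N)" using g(2) by (auto simp: bij_betw_def)
  have g0: "g ` {\<zero>\<^bsub>N\<^esub>} = {\<zero>\<^bsub>M\<^esub>}" using N.mod_hom_zero[OF right_module_axioms g(1)] by simp
  have z: "L = {\<zero>\<^bsub>N\<^esub>}" if "submodule L R N" "g ` L = {\<zero>\<^bsub>M\<^esub>}" for L
    using inj_on_image_eq_iff[OF inj N.submoduleD(1)[OF that(1)], of "{\<zero>\<^bsub>N\<^esub>}"] that(2) g0 by simp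
  have "carrier N \<noteq> {\<zero>\<^bsub>N\<^esub>}"
    using M im g0 by (auto simp: indecomposable_def)
  moreover have "L = {\<zero>\<^bsub>N\<^esub>} \<or> L' = {\<zero>\<^bsub>N\<^esub>}" if S: "splits_as R N L L'" for L L'
  proof -
    have "g ` L = {\<zero>\<^bsub>M\<^esub>} \<or> g ` L' = {\<zero>\<^bsub>M\<^esub>}"
      using M N.splits_as_image[OF S right_module_axioms g] by (simp add: indecomposable_def)
    then show ?thesis using z N.splits_asD(1,2)[OF S] by blast
  qed
  ultimately show ?thesis using N by (simp add: indecomposable_def)
qed

section \<open>Full, annihilated and mixed modules\<close>

context finite_hereditary
begin

lemma dup_moduleI: "right_module D M \<Longrightarrow> dup_module K A M"
  by (simp add: dup_module_def finite_hereditary_axioms)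

lemma fullD: "full M \<Longrightarrow> submodule L D M \<Longrightarrow> part1 M \<subseteq> L \<Longrightarrow> L = carrier M"
  unfolding full_def by blast

lemma part_hom:
  assumes f: "f \<in> mod_hom D M N"
  shows "m \<in> part0 M \<Longrightarrow> f m \<in> part0 N" "m \<in> part1 M \<Longrightarrow> f m \<in> part1 N"
  using mod_hom_closed[OF f] mod_hom_smult[OF f e_closed(1), of m] mod_hom_smult[OF f e_closed(2), of m]
  by (simp_all add: part0_def part1_def)

lemma annihilated_hom:
  assumes M: "right_module D M" and N: "right_module D N" and f: "f \<in> mod_hom D M N" and m: "m \<in> annihilated M"
  shows "f m \<in> annihilated N"
proof -
  interpret M: right_module D M by fact
  have m': "m \<in> part1 M" "m \<in> carrier M" using m by (auto simp: annihilated_def part1_def)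
  have "inD g \<odot>\<^bsub>N\<^esub> f m = \<zero>\<^bsub>N\<^esub>" if g: "g \<in> dual_space K A" for g
    using m g M.mod_hom_zero[OF N f] by (simp add: annihilated_def in_closed m' flip: mod_hom_smult[OF f])
  then show ?thesis using part_hom(2)[OF f m'(1)] by (simp add: annihilated_def)
qed

lemma part0_surj:
  assumes "f \<in> mod_hom D M N" "f ` carrier M = carrier N" "part0 M = carrier M"
  shows "part0 N = carrier N"
proof (intro Set.equalityI subsetI)
  fix y assume "y \<in> carrier N"
  then obtain x where "x \<in> part0 M" "y = f x" using assms(2,3) by blast
  then show "y \<in> part0 N" using part_hom(1)[OF assms(1)] by simp
qed (simp add: part0_def)

lemma annihilated_surj:
  assumes "right_module D M" "right_module D N" "f \<in> mod_hom D M N" "f ` carrier M = carrier N" "annihilated M = carrier M"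
  shows "annihilated N = carrier N"
proof (intro Set.equalityI subsetI)
  fix y assume "y \<in> carrier N"
  then obtain x where "x \<in> annihilated M" "y = f x" using assms(4,5) by blast
  then show "y \<in> annihilated N" using annihilated_hom[OF assms(1-3)] by simp
qed (simp add: annihilated_def part1_def)

lemma full_iso:
  assumes iso: "mod_iso D M N" and M: "right_module D M" and N: "right_module D N" and full: "full M"
  shows "full N"
  unfolding full_def
proof (intro allI impI)
  interpret M: right_module D M by fact
  interpret N: right_module D N by fact
  fix L assume L: "submodule L D N" and sub: "part1 N \<subseteq> L"
  obtain f where f: "f \<in> mod_hom D M N" "bij_betw f (carrier M) (carrier N)"
    using iso by (auto simp: mod_iso_def)
  let ?L = "{x \<in> carrier M. f x \<in> L}"
  have "part1 M \<subseteq> ?L"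
  proof
    fix m assume m: "m \<in> part1 M"
    then have "f m \<in> L" using part_hom(2)[OF f(1)] sub by blast
    then show "m \<in> ?L" using m by (simp add: part1_def)
  qed
  then have "?L = carrier M" by (rule fullD[OF full M.submodule_vimage[OF N f(1) L]])
  then have "f ` carrier M \<subseteq> L" by blast
  then show "L = carrier N" using f(2) N.submoduleD(1)[OF L] by (simp add: bij_betw_def)
qed

lemma annihilated_zero_iso:
  assumes iso: "mod_iso D M N" and M: "right_module D M" and N: "right_module D N"
    and N0: "annihilated N = {\<zero>\<^bsub>N\<^esub>}"
  shows "annihilated M = {\<zero>\<^bsub>M\<^esub>}"
proof (intro Set.equalityI subsetI)
  interpret M: dup_module K A M by (rule dup_moduleI[OF M])
  obtain f where f: "f \<in> mod_hom D M N" "bij_betw f (carrier M) (carrier N)"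
    using iso by (auto simp: mod_iso_def)
  fix m assume m: "m \<in> annihilated M"
  then have mM: "m \<in> carrier M" by (auto simp: annihilated_def part1_def)
  have "f m = \<zero>\<^bsub>N\<^esub>" using annihilated_hom[OF M N f(1) m] N0 by simp
  then show "m \<in> {\<zero>\<^bsub>M\<^esub>}" using M.M.mod_hom_inj_iff[OF N f(1)] f(2) mM by (simp add: bij_betw_def)
next
  interpret M: dup_module K A M by (rule dup_moduleI[OF M])
  fix m assume "m \<in> {\<zero>\<^bsub>M\<^esub>}"
  then show "m \<in> annihilated M" using M.M.submoduleD(2)[OF M.submodule_annihilated] by simp
qed

text \<open>The modules with neither \<open>A\<^sub>0\<close>- nor \<open>A\<^sub>1\<close>-modules as direct summands.\<close>

definition mixed :: "('a \<times> ('a \<Rightarrow> 'k) \<times> 'a, 'm) module \<Rightarrow> bool" where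
  "mixed M \<longleftrightarrow> full M \<and> annihilated M = {\<zero>\<^bsub>M\<^esub>}"

lemma mixed_iso:
  "mod_iso D M N \<Longrightarrow> right_module D M \<Longrightarrow> right_module D N \<Longrightarrow> mixed M \<Longrightarrow> mixed N"
  unfolding mixed_def using full_iso[of M N] annihilated_zero_iso[of N M] mod_iso_sym[of D M N] by blast

text \<open>A direct summand is both a quotient and a submodule: as a quotient it inherits fullness,
  by preimages under the projection, and as a submodule it inherits the zero annihilated
  part.\<close>

lemma mixed_summand:
  assumes M: "right_module D M" and S: "splits_as D M L L'" and mixed: "mixed M"
  shows "mixed (sub_mod M L)"
proof -
  interpret M: dup_module K A M by (rule dup_moduleI[OF M])
  note S' = M.M.splits_asD[OF S]
  note LD = M.M.submoduleD[OF S'(1)] and L'D = M.M.submoduleD[OF S'(2)]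
  obtain p where p: "p \<in> mod_hom D M (sub_mod M L)" "\<forall>x\<in>L'. p x = \<zero>\<^bsub>M\<^esub>"
    "\<forall>x\<in>L. p x = x" "\<forall>x\<in>carrier M. p x = \<zero>\<^bsub>M\<^esub> \<longrightarrow> x \<in> L'"
    by (rule M.M.splits_as_proj[OF M.M.splits_as_sym[OF S]]) (rule that)
  have "full (sub_mod M L)"
    unfolding full_def
  proof (intro allI impI)
    fix W assume W: "submodule W D (sub_mod M L)" and sub: "part1 (sub_mod M L) \<subseteq> W"
    have "submodule {x \<in> carrier M. p x \<in> W} D M"
      by (rule M.M.submodule_vimage[OF M.M.right_module_sub_mod[OF S'(1)] p(1) W])
    moreover have "part1 M \<subseteq> {x \<in> carrier M. p x \<in> W}"
      using part_hom(2)[OF p(1)] sub M.part_closed(2) by blast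
    ultimately have "{x \<in> carrier M. p x \<in> W} = carrier M"
      using mixed by (intro fullD) (simp_all add: mixed_def)
    then have "p x \<in> W" if "x \<in> L" for x using LD(6)[OF that] by blast
    then have "L \<subseteq> W" using p(3) by auto
    then show "W = carrier (sub_mod M L)" using W by (simp add: M.M.submodule_sub_mod_iff[OF S'(1)])
  qed
  moreover have "annihilated (sub_mod M L) = {\<zero>\<^bsub>M\<^esub>}"
    using mixed LD(2) by (auto simp: part_sub_mod[OF LD(1)] mixed_def)
  ultimately show ?thesis by (simp add: mixed_def)
qed

text \<open>Once e acts as the identity, the whole algebra acts through the entry \<open>a\<close>,
  so \<open>mod0\<close> carries all the structure.\<close>

lemma is_A0_moduleI:
  assumes M: "right_module D M" "finite (carrier M)" and 0: "part0 M = carrier M"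
  shows "is_A0_module K A M"
proof -
  interpret M: dup_module K A M by (rule dup_moduleI[OF M(1)])
  obtain V where V: "V \<in> fin_modules A" "mod_iso A V M.mod0"
    using ex_fin_module[OF M.right_module_mod0] M(2) 0 by auto
  obtain g where g: "g \<in> mod_hom A V M.mod0" "bij_betw g (carrier V) (carrier M)"
    using V(2) 0 by (auto simp: mod_iso_def)
  have "g \<in> mod_hom D (change_scalars (\<lambda>(a, f, b). a) V) M"
  proof (rule mod_homI)
    show "g \<in> carrier (change_scalars (\<lambda>(a, f, b). a) V) \<rightarrow>\<^sub>E carrier M"
      using g(1) 0 by (auto simp: mod_hom_def)
    show "g (x \<oplus>\<^bsub>change_scalars (\<lambda>(a, f, b). a) V\<^esub> y) = g x \<oplus>\<^bsub>M\<^esub> g y"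
      if "x \<in> carrier (change_scalars (\<lambda>(a, f, b). a) V)" "y \<in> carrier (change_scalars (\<lambda>(a, f, b). a) V)" for x y
      using that mod_hom_add[OF g(1), of x y] by simp
    fix r x assume "r \<in> carrier D" and "x \<in> carrier (change_scalars (\<lambda>(a, f, b). a) V)"
    then have x: "x \<in> carrier V" by simp
    obtain a f b where r: "r = (a, f, b)" "a \<in> carrier A" "f \<in> dual_space K A" "b \<in> carrier A"
      using \<open>r \<in> carrier D\<close> by (cases r) (simp add: carrier_D)
    have "g x \<in> part0 M" using mod_hom_closed[OF g(1) x] by simp
    then show "g (r \<odot>\<^bsub>change_scalars (\<lambda>(a, f, b). a) V\<^esub> x) = r \<odot>\<^bsub>M\<^esub> g x"
      using mod_hom_smult[OF g(1) r(2) x] M.act_part0(1)[OF _ r(2-4)] by (simp add: r(1))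
  qed
  then show ?thesis using V(1) g(2) unfolding is_A0_module_def mod_iso_def by (metis change_scalars_simps(1))
qed

text \<open>The assumption says two things at once: e' acts as the identity, and \<open>DA\<close>
  acts by zero. Only the entry \<open>b\<close> is left.\<close>

lemma is_A1_moduleI:
  assumes M: "right_module D M" "finite (carrier M)" and 0: "annihilated M = carrier M"
  shows "is_A1_module K A M"
proof -
  interpret M: dup_module K A M by (rule dup_moduleI[OF M(1)])
  have 1: "part1 M = carrier M" using 0 M.part_sub(2) by (auto simp: annihilated_def)
  obtain V where V: "V \<in> fin_modules A" "mod_iso A V M.mod1"
    using ex_fin_module[OF M.right_module_mod1] M(2) 1 by auto
  obtain g where g: "g \<in> mod_hom A V M.mod1" "bij_betw g (carrier V) (carrier M)"
    using V(2) 1 by (auto simp: mod_iso_def)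
  have "g \<in> mod_hom D (change_scalars (\<lambda>(a, f, b). b) V) M"
  proof (rule mod_homI)
    show "g \<in> carrier (change_scalars (\<lambda>(a, f, b). b) V) \<rightarrow>\<^sub>E carrier M"
      using g(1) 1 by (auto simp: mod_hom_def)
    show "g (x \<oplus>\<^bsub>change_scalars (\<lambda>(a, f, b). b) V\<^esub> y) = g x \<oplus>\<^bsub>M\<^esub> g y"
      if "x \<in> carrier (change_scalars (\<lambda>(a, f, b). b) V)" "y \<in> carrier (change_scalars (\<lambda>(a, f, b). b) V)" for x y
      using that mod_hom_add[OF g(1), of x y] by simp
    fix r x assume "r \<in> carrier D" and "x \<in> carrier (change_scalars (\<lambda>(a, f, b). b) V)"
    then have x: "x \<in> carrier V" by simp
    obtain a f b where r: "r = (a, f, b)" "a \<in> carrier A" "f \<in> dual_space K A" "b \<in> carrier A"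
      using \<open>r \<in> carrier D\<close> by (cases r) (simp add: carrier_D)
    have gx: "g x \<in> part1 M" using mod_hom_closed[OF g(1) x] by simp
    have "inD f \<odot>\<^bsub>M\<^esub> g x = \<zero>\<^bsub>M\<^esub>" using 0 gx 1 r(3) by (auto simp: annihilated_def)
    then show "g (r \<odot>\<^bsub>change_scalars (\<lambda>(a, f, b). b) V\<^esub> x) = r \<odot>\<^bsub>M\<^esub> g x"
      using mod_hom_smult[OF g(1) r(4) x] M.act_part1(1,2)[OF gx r(2-4)] M.part_closed(2) by (simp add: r(1))
  qed
  then show ?thesis using V(1) g(2) unfolding is_A1_module_def mod_iso_def by (metis change_scalars_simps(1))
qed

text \<open>The first part is a submodule, so a simple submodule of \<open>M\<close> can be found
  inside it; this is a possible first step of a composition series.\<close>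

lemma composition_factor_A0:
  assumes M: "right_module D M" "finite (carrier M)" and ne: "part0 M \<noteq> {\<zero>\<^bsub>M\<^esub>}"
  shows "\<exists>S\<in>fin_modules D. simple_module D S \<and> is_A0_module K A S \<and> composition_factor D M S"
proof -
  interpret M: dup_module K A M by (rule dup_moduleI[OF M(1)])
  have "\<zero>\<^bsub>M\<^esub> \<in> part0 M" by (rule M.part_subgroup)
  then have sub: "{\<zero>\<^bsub>M\<^esub>} \<subset> part0 M" using ne by blast
  have p0: "submodule (part0 M) D M"
    using M.part_subgroup(1,2) M.act_part0(2)[OF _ _ dual_zero_closed A.M.zero_closed]
    by (intro M.submodule_part0) auto
  obtain P where P: "submodule P D M" "{\<zero>\<^bsub>M\<^esub>} \<subset> P" "P \<subseteq> part0 M" "M.M.simple_step {\<zero>\<^bsub>M\<^esub>} P"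
    using M.M.ex_simple_above[OF M(2) M.M.submodule_zero p0 sub] by blast
  interpret P: right_module D "sub_mod M P" by (rule M.M.right_module_sub_mod[OF P(1)])
  \<comment> \<open>Composition factors are quotients by definition, so the simple submodule
    \<open>P\<close> appears as \<open>P\<close> modulo zero.\<close>
  let ?Q = "quot_mod (sub_mod M P) {\<zero>\<^bsub>M\<^esub>}"
  have z: "submodule {\<zero>\<^bsub>M\<^esub>} D (sub_mod M P)" using P.submodule_zero by simp
  have rQ: "right_module D ?Q" by (rule P.right_module_quot_mod[OF z])
  interpret Q: right_module D ?Q by (rule rQ)
  have PM: "P \<subseteq> carrier M" by (rule M.M.submoduleD(1)[OF P(1)])
  have "part0 (sub_mod M P) = carrier (sub_mod M P)" using P(3) by (auto simp: part_sub_mod[OF PM])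
  then have Q0: "part0 ?Q = carrier ?Q"
    by (rule part0_surj[OF P.quot_proj_hom[OF z] P.quot_proj_surj[OF z]])
  have finQ: "finite (carrier ?Q)"
    unfolding P.quot_proj_surj[OF z, symmetric] using PM M(2) finite_subset by auto
  obtain S where S: "S \<in> fin_modules D" "mod_iso D S ?Q" by (rule ex_fin_module[OF rQ finQ])
  note rS = fin_modulesD(1)[OF S(1)] and iso = mod_iso_sym[OF S(2) fin_modulesD(1)[OF S(1)]]
  have "simple_module D S" using Q.simple_module_iso[OF _ rS iso] P(4) by blast
  moreover obtain f where "f \<in> mod_hom D ?Q S" "f ` carrier ?Q = carrier S"
    using iso by (auto simp: mod_iso_def bij_betw_def)
  then have "is_A0_module K A S"
    using part0_surj Q0 is_A0_moduleI[OF rS fin_modulesD(2)[OF S(1)]] by blast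
  moreover have "composition_factor D M S"
    by (rule M.M.composition_factorI[OF M(2) M.M.submodule_zero P(1,4) iso])
  ultimately show ?thesis using S(1) by blast
qed

text \<open>Here the factor is taken at the top: as the second part is nonzero, a maximal submodule
  \<open>P\<close> lies above the first part. In the quotient e acts by zero, and so does
  \<open>DA\<close>, because the products y f lie in the first part.\<close>

lemma composition_factor_A1:
  assumes M: "right_module D M" "finite (carrier M)" and ne: "part1 M \<noteq> {\<zero>\<^bsub>M\<^esub>}"
  shows "\<exists>S\<in>fin_modules D. simple_module D S \<and> is_A1_module K A S \<and> composition_factor D M S"
proof -
  interpret M: dup_module K A M by (rule dup_moduleI[OF M(1)])
  have "part0 M \<noteq> carrier M"
  proof
    assume "part0 M = carrier M"
    then have "part1 M \<subseteq> {\<zero>\<^bsub>M\<^esub>}" using M.part_Int M.part_closed(2) by blast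
    then show False using ne M.part_subgroup(4) by blast
  qed
  then have sub: "part0 M \<subset> carrier M" using M.part_sub by blast
  have p0: "submodule (part0 M) D M"
    using M.part_subgroup(1,2) M.act_part0(2)[OF _ _ dual_zero_closed A.M.zero_closed]
    by (intro M.submodule_part0) auto
  obtain P where P: "submodule P D M" "part0 M \<subseteq> P" "P \<subset> carrier M" "M.M.simple_step P (carrier M)"
    using M.M.ex_simple_below[OF M(2) p0 M.M.submodule_carrier sub] by blast
  let ?Q = "quot_mod (sub_mod M (carrier M)) P"
  have Q: "?Q = quot_mod M P" by (simp add: sub_mod_carrier)
  note PD = M.M.submoduleD[OF P(1)]
  have rQ: "right_module D ?Q" unfolding Q by (rule M.M.right_module_quot_mod[OF P(1)])
  note q = M.M.quot_proj_hom[OF P(1), folded Q] and surj = M.M.quot_proj_surj[OF P(1), folded Q]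
    and ker = M.M.quot_proj_ker[OF P(1), folded Q]
  interpret Q: right_module D ?Q by (rule rQ)
  have Q1: "annihilated ?Q = carrier ?Q"
  proof (intro Set.equalityI subsetI)
    fix y assume "y \<in> carrier ?Q"
    then obtain x where x: "x \<in> carrier M" "y = M.M.quot_proj P x" unfolding surj[symmetric] by blast
    have e0: "M.e0 \<odot>\<^bsub>M\<^esub> x \<in> carrier M" "M.e0 \<odot>\<^bsub>M\<^esub> x \<in> P"
      using M.e_act_part(1)[OF x(1)] P(2) M.part_sub by auto
    have e1: "M.e1 \<odot>\<^bsub>M\<^esub> x \<in> part1 M" "M.e1 \<odot>\<^bsub>M\<^esub> x \<in> carrier M"
      using M.e_act_part(2)[OF x(1)] M.part_sub by auto
    have q0: "M.M.quot_proj P p = \<zero>\<^bsub>?Q\<^esub>" if "p \<in> P" for p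
      using ker[OF PD(6)[OF that]] that by simp
    have "y = M.M.quot_proj P (M.e0 \<odot>\<^bsub>M\<^esub> x) \<oplus>\<^bsub>?Q\<^esub> M.M.quot_proj P (M.e1 \<odot>\<^bsub>M\<^esub> x)"
      unfolding x(2) mod_hom_add[OF q e0(1) e1(2), symmetric] M.decompose[OF x(1), symmetric] ..
    also have "\<dots> = M.M.quot_proj P (M.e1 \<odot>\<^bsub>M\<^esub> x)"
      using q0[OF e0(2)] mod_hom_closed[OF q e1(2)] by (simp only: Q.M.l_zero)
    finally have y: "y = M.M.quot_proj P (M.e1 \<odot>\<^bsub>M\<^esub> x)" .
    have "inD f \<odot>\<^bsub>?Q\<^esub> y = \<zero>\<^bsub>?Q\<^esub>" if f: "f \<in> dual_space K A" for f
    proof -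
      have "inD f \<odot>\<^bsub>M\<^esub> (M.e1 \<odot>\<^bsub>M\<^esub> x) \<in> P"
        using M.act_part1(3)[OF e1(1) A.M.zero_closed f A.M.zero_closed] P(2) by blast
      then show ?thesis
        unfolding y mod_hom_smult[OF q in_closed(3)[OF f] e1(2), symmetric] by (rule q0)
    qed
    moreover have "y \<in> part1 ?Q" unfolding y by (rule part_hom(2)[OF q e1(1)])
    ultimately show "y \<in> annihilated ?Q" by (simp add: annihilated_def)
  qed (simp add: annihilated_def part1_def)
  have finQ: "finite (carrier ?Q)" unfolding surj[symmetric] using M(2) by simp
  obtain S where S: "S \<in> fin_modules D" "mod_iso D S ?Q" by (rule ex_fin_module[OF rQ finQ])
  note rS = fin_modulesD(1)[OF S(1)] and iso = mod_iso_sym[OF S(2) fin_modulesD(1)[OF S(1)]]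
  have "simple_module D S" using Q.simple_module_iso[OF _ rS iso] P(4) by blast
  moreover obtain f where f: "f \<in> mod_hom D ?Q S" "f ` carrier ?Q = carrier S"
    using iso by (auto simp: mod_iso_def bij_betw_def)
  have "is_A1_module K A S"
    by (rule is_A1_moduleI[OF rS fin_modulesD(2)[OF S(1)] annihilated_surj[OF rQ rS f Q1]])
  moreover have "composition_factor D M S"
    by (rule M.M.composition_factorI[OF M(2) P(1) M.M.submodule_carrier P(4) iso])
  ultimately show ?thesis using S(1) by blast
qed

text \<open>If the second part were zero, fullness would make \<open>M\<close> zero. If the first
  part were zero, \<open>DA\<close> would act by zero on the second part, which would then be
  annihilated and hence zero.\<close>

lemma mixed_indecomposable:
  assumes M: "M \<in> fin_modules D" and ind: "indecomposable D M" and mixed: "mixed M"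
  shows "M \<in> A01_ind K A"
proof -
  note M' = fin_modulesD[OF M]
  interpret M: dup_module K A M by (rule dup_moduleI[OF M'(1)])
  have nz: "carrier M \<noteq> {\<zero>\<^bsub>M\<^esub>}" using ind by (simp add: indecomposable_def)
  have p1: "part1 M \<noteq> {\<zero>\<^bsub>M\<^esub>}"
  proof
    assume "part1 M = {\<zero>\<^bsub>M\<^esub>}"
    then have "{\<zero>\<^bsub>M\<^esub>} = carrier M"
      using mixed M.M.submodule_zero by (intro fullD) (simp_all add: mixed_def)
    then show False using nz by simp
  qed
  have "part0 M \<noteq> {\<zero>\<^bsub>M\<^esub>}"
  proof
    assume 0: "part0 M = {\<zero>\<^bsub>M\<^esub>}"
    have "part1 M \<subseteq> annihilated M"
    proof
      fix y assume y: "y \<in> part1 M"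
      have "inD f \<odot>\<^bsub>M\<^esub> y = \<zero>\<^bsub>M\<^esub>" if "f \<in> dual_space K A" for f
        using M.act_part1(3)[OF y A.M.zero_closed that A.M.zero_closed] 0 by simp
      then show "y \<in> annihilated M" using y by (simp add: annihilated_def)
    qed
    then have "part1 M \<subseteq> {\<zero>\<^bsub>M\<^esub>}" using mixed by (simp add: mixed_def)
    then show False using p1 M.part_subgroup(4) by blast
  qed
  then show ?thesis
    using M ind composition_factor_A0[OF M'] composition_factor_A1[OF M' p1] by (simp add: A01_ind_def Let_def)
qed

lemma mixed_decomposes:
  fixes M :: "('a \<times> ('a \<Rightarrow> 'k) \<times> 'a, 'm) module"
  assumes "right_module D M" "finite (carrier M)" "mixed M"
  shows "\<exists>(n::nat) N. (\<forall>i<n. N i \<in> A01_ind K A) \<and> mod_iso D (direct_sum {..<n} N) M"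
  using assms
proof (induction "card (carrier M)" arbitrary: M rule: less_induct)
  case less
  note M = less.prems
  interpret M: right_module D M by (rule M(1))
  show ?case
  proof (cases "carrier M = {\<zero>\<^bsub>M\<^esub>}")
    case True
    \<comment> \<open>The zero module is the empty direct sum; \<open>zero_module\<close> merely
      fills in the family of summands and fixes its type.\<close>
    let ?S = "direct_sum {..<0::nat} (\<lambda>_. zero_module :: ('a \<times> ('a \<Rightarrow> 'k) \<times> 'a, nat) module)"
    interpret S: right_module D ?S
      by (rule right_module_direct_sum[OF ring_duplicated_algebra]) simp
    have "(\<lambda>x\<in>carrier ?S. \<zero>\<^bsub>M\<^esub>) \<in> mod_hom D ?S M"
    proof (rule mod_homI)
      show "(\<lambda>x\<in>carrier ?S. \<zero>\<^bsub>M\<^esub>) \<in> carrier ?S \<rightarrow>\<^sub>E carrier M" by (intro PiE_I) simp_all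
    qed (use S.M.a_closed S.act_closed in \<open>simp_all del: direct_sum_simps\<close>)
    moreover have "bij_betw (\<lambda>x\<in>carrier ?S. \<zero>\<^bsub>M\<^esub>) (carrier ?S) (carrier M)"
      using True by (auto simp: bij_betw_def)
    ultimately have "mod_iso D ?S M" by (rule mod_isoI)
    then show ?thesis by (intro exI[of _ 0] exI[of _ "\<lambda>_. zero_module"]) simp
  next
    case False
    obtain L L' where S: "splits_as D M L L'" and ind: "indecomposable D (sub_mod M L)"
      using M.ex_indecomposable_summand[OF M(2) False] by blast
    note S' = M.splits_asD[OF S]
    note LD = M.submoduleD[OF S'(1)] and L'D = M.submoduleD[OF S'(2)]
    have rL: "right_module D (sub_mod M L)" and rL': "right_module D (sub_mod M L')"
      using M.right_module_sub_mod S'(1,2) by blast+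
    have finL: "finite (carrier (sub_mod M L))" and finL': "finite (carrier (sub_mod M L'))"
      using LD(1) L'D(1) M(2) finite_subset by auto
    have "L' \<noteq> carrier M"
    proof
      assume "L' = carrier M"
      then have "L \<subseteq> {\<zero>\<^bsub>M\<^esub>}" using S'(3) LD(1) by blast
      then show False using ind LD(2) by (auto simp: indecomposable_def)
    qed
    then have "card (carrier (sub_mod M L')) < card (carrier M)"
      using L'D(1) M(2) by (simp add: psubset_card_mono psubsetI)
    then obtain n N where N: "\<forall>i<n::nat. N i \<in> A01_ind K A" "mod_iso D (direct_sum {..<n} N) (sub_mod M L')"
      using less.hyps[OF _ rL' finL' mixed_summand[OF M(1) M.splits_as_sym[OF S] M(3)]] by blast
    obtain P where P: "P \<in> fin_modules D" "mod_iso D P (sub_mod M L)"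
      by (rule ex_fin_module[OF rL finL])
    note rP = fin_modulesD(1)[OF P(1)] and iso = mod_iso_sym[OF P(2) fin_modulesD(1)[OF P(1)]]
    have "indecomposable D P"
      using right_module.indecomposable_iso[OF rL ind rP iso] .
    moreover have "mixed P" using mixed_iso[OF iso rL rP] mixed_summand[OF M(1) S M(3)] by blast
    ultimately have "P \<in> A01_ind K A" using mixed_indecomposable[OF P(1)] by blast
    then have "\<forall>i<Suc n. (N(n := P)) i \<in> A01_ind K A" using N(1) by (auto simp: less_Suc_eq)
    moreover have "right_module D (N i)" if "i < n" for i
      using N(1) that by (auto simp: A01_ind_def Let_def fin_modulesD(1))
    then have "mod_iso D (direct_sum {..<Suc n} (N(n := P))) M"
      by (rule M.direct_sum_Suc_iso[OF S _ rP N(2) P(2)])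
    ultimately show ?thesis by blast
  qed
qed

text \<open>\<open>mixed_decomposes\<close> already yields a full direct sum, so the summand asked
  for by \<open>in_add\<close> is the whole sum, with complement zero.\<close>

lemma mixed_in_add:
  assumes M: "right_module D M" "finite (carrier M)" "mixed M"
  shows "in_add D (A01_ind K A) M"
proof -
  obtain n N where N: "\<forall>i<n::nat. N i \<in> A01_ind K A" "mod_iso D (direct_sum {..<n} N) M"
    using mixed_decomposes[OF M] by blast
  have "right_module D (N i)" if "i \<in> {..<n}" for i
    using N(1) that by (auto simp: A01_ind_def Let_def fin_modulesD(1))
  then interpret S: right_module D "direct_sum {..<n} N"
    by (rule right_module_direct_sum[OF ring_duplicated_algebra])
  show ?thesis
    unfolding in_add_def using N S.splits_as_zero
    by (intro exI[of _ n] exI[of _ N] exI[of _ "carrier (direct_sum {..<n} N)"] exI[of _ "{\<zero>\<^bsub>direct_sum {..<n} N\<^esub>}"])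
      (simp add: sub_mod_carrier del: direct_sum_simps)
qed

end

section \<open>Products in the Ringel-Hall algebra\<close>

lemma iso_class_eqI:
  assumes "M \<in> fin_modules R" "N \<in> fin_modules R" "mod_iso R M N"
  shows "iso_class R M = iso_class R N"
  unfolding iso_class_def
  using assms mod_iso_trans[of R _ M N] mod_iso_trans[of R _ N M] mod_iso_sym[of R M N]
  by (auto dest: fin_modulesD(1))

lemma class_rep_iso:
  assumes "M \<in> fin_modules R"
  shows "class_rep (iso_class R M) \<in> fin_modules R" "mod_iso R (class_rep (iso_class R M)) M"
proof -
  have "M \<in> iso_class R M"
    using assms mod_iso_refl[OF fin_modulesD(1)[OF assms]] by (simp add: iso_class_def)
  then have "class_rep (iso_class R M) \<in> iso_class R M"
    unfolding class_rep_def by (rule someI)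
  then show "class_rep (iso_class R M) \<in> fin_modules R" "mod_iso R (class_rep (iso_class R M)) M"
    by (simp_all add: iso_class_def)
qed

text \<open>If every extension of \<open>N1\<close> by \<open>N2\<close> splits, its middle term is
  determined up to isomorphism, and if the submodule is unique, it is counted once.
  \<open>uniq\<close> asks for one inclusion, as exchanging \<open>P\<close> and \<open>P'\<close>
  gives the other. \<open>M0\<close> is a copy of \<open>M\<close> in which the splitting is at
  hand.\<close>

lemma hall_basis_mult_split:
  assumes R: "ring R" and N1: "N1 \<in> fin_modules R" and N2: "N2 \<in> fin_modules R"
    and M: "M \<in> fin_modules R" and M0: "right_module R M0" "mod_iso R M M0"
    and S: "splits_as R M0 T L" and T: "mod_iso R (sub_mod M0 T) N1" and L: "mod_iso R (sub_mod M0 L) N2"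
    and uniq: "\<And>M' P P'. M' \<in> fin_modules R \<Longrightarrow> submodule P R M' \<Longrightarrow> submodule P' R M' \<Longrightarrow>
      mod_iso R (sub_mod M' P) N2 \<Longrightarrow> mod_iso R (quot_mod M' P) N1 \<Longrightarrow>
      mod_iso R (sub_mod M' P') N2 \<Longrightarrow> mod_iso R (quot_mod M' P') N1 \<Longrightarrow> P \<subseteq> P'"
    and split: "\<And>M' P. M' \<in> fin_modules R \<Longrightarrow> submodule P R M' \<Longrightarrow>
      mod_iso R (sub_mod M' P) N2 \<Longrightarrow> mod_iso R (quot_mod M' P) N1 \<Longrightarrow> \<exists>Q. splits_as R M' Q P"
  shows "hall_basis_mult R (iso_class R N1) (iso_class R N2) = frag_of (iso_class R M)"
proof -
  note rM = fin_modulesD(1)[OF M] and r1 = class_rep_iso[OF N1] and r2 = class_rep_iso[OF N2]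
  interpret M0: right_module R M0 by (rule M0(1))
  note S' = M0.splits_asD[OF S]
  have card: "hall_number R M' (class_rep (iso_class R N1)) (class_rep (iso_class R N2)) =
      (if mod_iso R M' M then 1 else 0)" if M': "M' \<in> fin_modules R" for M'
  proof -
    note rM' = fin_modulesD(1)[OF M']
    interpret M': right_module R M' by (rule rM')
    define H where "H = {P. submodule P R M' \<and> mod_iso R (sub_mod M' P) N2 \<and> mod_iso R (quot_mod M' P) N1}"
    \<comment> \<open>The product is defined with representatives picked by
      \<open>class_rep\<close>; for isomorphism questions they may be replaced by \<open>N1\<close>
      and \<open>N2\<close>.\<close>
    have tr: "mod_iso R X (class_rep (iso_class R N)) \<longleftrightarrow> mod_iso R X N"
      if "right_module R X" "N \<in> fin_modules R" for N and X :: "('a, 'x) module"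
      using mod_iso_trans[OF _ class_rep_iso(2)[OF that(2)] that(1)]
        mod_iso_trans[OF _ mod_iso_sym[OF class_rep_iso(2)[OF that(2)] fin_modulesD(1)[OF class_rep_iso(1)[OF that(2)]]] that(1)]
      by blast
    have "hall_number R M' (class_rep (iso_class R N1)) (class_rep (iso_class R N2)) = card H"
      unfolding hall_number_def H_def
      using tr[OF M'.right_module_sub_mod N2] tr[OF M'.right_module_quot_mod N1]
      by (intro arg_cong[of _ _ card]) auto
    moreover have "card H = 1" if iso: "mod_iso R M' M"
    proof -
      have "mod_iso R M0 M'"
        using mod_iso_trans[OF iso M0(2) rM'] mod_iso_sym rM' by blast
      then obtain f where f: "f \<in> mod_hom R M0 M'" "bij_betw f (carrier M0) (carrier M')"
        by (auto simp: mod_iso_def)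
      have LM: "L \<subseteq> carrier M0" by (rule M0.submoduleD(1)[OF S'(2)])
      have fL: "submodule (f ` L) R M'" by (rule M0.submodule_image[OF rM' f(1) S'(2)])
      have "mod_iso R (sub_mod M0 L) (sub_mod M' (f ` L))"
        using f LM by (intro M0.mod_iso_sub_mod_image S'(2)) (auto simp: bij_betw_def inj_on_subset)
      then have "mod_iso R (sub_mod M' (f ` L)) (sub_mod M0 L)"
        by (rule mod_iso_sym[OF _ M0.right_module_sub_mod[OF S'(2)]])
      then have 2: "mod_iso R (sub_mod M' (f ` L)) N2"
        by (rule mod_iso_trans[OF _ L M'.right_module_sub_mod[OF fL]])
      have "mod_iso R (quot_mod M' (f ` L)) (quot_mod M0 L)"
        by (rule mod_iso_sym[OF M0.mod_iso_quot_mod_image[OF rM' f S'(2)] M0.right_module_quot_mod[OF S'(2)]])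
      then have "mod_iso R (quot_mod M' (f ` L)) (sub_mod M0 T)"
        by (rule mod_iso_trans[OF _ M0.splits_as_quot_iso[OF M0.splits_as_sym[OF S]] M'.right_module_quot_mod[OF fL]])
      then have 1: "mod_iso R (quot_mod M' (f ` L)) N1"
        by (rule mod_iso_trans[OF _ T M'.right_module_quot_mod[OF fL]])
      \<comment> \<open>The image of the known summand \<open>L\<close> is one such submodule, and
        \<open>uniq\<close> in both directions leaves no other.\<close>
      have "H = {f ` L}"
      proof (intro Set.equalityI subsetI)
        fix P assume "P \<in> H"
        then have P: "submodule P R M'" "mod_iso R (sub_mod M' P) N2" "mod_iso R (quot_mod M' P) N1"
          by (simp_all add: H_def)
        have "P \<subseteq> f ` L" by (rule uniq[OF M' P(1) fL P(2,3) 2 1])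
        moreover have "f ` L \<subseteq> P" by (rule uniq[OF M' fL P(1) 2 1 P(2,3)])
        ultimately show "P \<in> {f ` L}" by simp
      qed (use 1 2 fL in \<open>simp add: H_def\<close>)
      then show ?thesis by simp
    qed
    moreover have "H = {}" if niso: "\<not> mod_iso R M' M"
    proof (rule ccontr)
      assume "H \<noteq> {}"
      then obtain P where P: "submodule P R M'" "mod_iso R (sub_mod M' P) N2" "mod_iso R (quot_mod M' P) N1"
        by (auto simp: H_def)
      \<comment> \<open>A submodule counted by \<open>H\<close> has a complement, and then
        \<open>M'\<close> and \<open>M0\<close> are sums of isomorphic parts, hence
        isomorphic.\<close>
      obtain Q where Q: "splits_as R M' Q P" using split[OF M' P] by blast
      note Q' = M'.splits_asD[OF Q]
      have "mod_iso R (sub_mod M' Q) (quot_mod M' P)"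
        by (rule mod_iso_sym[OF M'.splits_as_quot_iso[OF M'.splits_as_sym[OF Q]] M'.right_module_quot_mod[OF P(1)]])
      then have "mod_iso R (sub_mod M' Q) N1"
        by (rule mod_iso_trans[OF _ P(3) M'.right_module_sub_mod[OF Q'(1)]])
      then have 1: "mod_iso R (sub_mod M' Q) (sub_mod M0 T)"
        by (rule mod_iso_trans[OF _ mod_iso_sym[OF T M0.right_module_sub_mod[OF S'(1)]] M'.right_module_sub_mod[OF Q'(1)]])
      have 2: "mod_iso R (sub_mod M' P) (sub_mod M0 L)"
        by (rule mod_iso_trans[OF P(2) mod_iso_sym[OF L M0.right_module_sub_mod[OF S'(2)]] M'.right_module_sub_mod[OF P(1)]])
      have "mod_iso R M' M0" by (rule M'.splits_as_iso[OF Q M0(1) S 1 2])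
      then have "mod_iso R M' M" by (rule mod_iso_trans[OF _ mod_iso_sym[OF M0(2) rM] rM'])
      then show False using niso by simp
    qed
    ultimately show ?thesis by simp
  qed
  let ?G = "\<lambda>c. hall_number R (class_rep c) (class_rep (iso_class R N1)) (class_rep (iso_class R N2))"
  have G: "?G (iso_class R M') = (if mod_iso R M' M then 1 else 0)" if M': "M' \<in> fin_modules R" for M'
  proof -
    note c = class_rep_iso[OF M']
    have "mod_iso R (class_rep (iso_class R M')) M \<longleftrightarrow> mod_iso R M' M"
      using mod_iso_trans[OF c(2) _ fin_modulesD(1)[OF c(1)]]
        mod_iso_trans[OF mod_iso_sym[OF c(2) fin_modulesD(1)[OF c(1)]] _ fin_modulesD(1)[OF M']] by blast
    then show ?thesis using card[OF c(1)] by simp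
  qed
  have "{c \<in> iso_classes R (\<lambda>_. True). ?G c \<noteq> 0} = {iso_class R M}"
  proof (intro Set.equalityI subsetI)
    fix c assume "c \<in> {c \<in> iso_classes R (\<lambda>_. True). ?G c \<noteq> 0}"
    then obtain M' where M': "M' \<in> fin_modules R" "c = iso_class R M'" "?G c \<noteq> 0"
      by (auto simp: iso_classes_def)
    then have "mod_iso R M' M" using G[OF M'(1)] by (simp split: if_splits)
    then show "c \<in> {iso_class R M}" using iso_class_eqI[OF M'(1) M] M'(2) by simp
  next
    fix c assume "c \<in> {iso_class R M}"
    then show "c \<in> {c \<in> iso_classes R (\<lambda>_. True). ?G c \<noteq> 0}"
      using M G[OF M] mod_iso_refl[OF rM] by (auto simp: iso_classes_def)
  qed
  moreover have "?G (iso_class R M) = 1" using G[OF M] mod_iso_refl[OF rM] by simp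
  ultimately show ?thesis unfolding hall_basis_mult_def Let_def by simp
qed

section \<open>The two products in the factorization of a basis element\<close>

context finite_hereditary
begin

text \<open>Homomorphisms preserve parts, and the second part of an \<open>A_0\<close>-module is
  zero, so the second part of \<open>M\<close> dies in the quotient.\<close>

lemma part1_subset_of_quot_iso:
  assumes M: "right_module D M" and P: "submodule P D M" and X: "right_module D X" "part0 X = carrier X"
    and iso: "mod_iso D (quot_mod M P) X"
  shows "part1 M \<subseteq> P"
proof
  interpret M: dup_module K A M by (rule dup_moduleI[OF M])
  interpret X: dup_module K A X by (rule dup_moduleI[OF X(1)])
  note rQ = M.M.right_module_quot_mod[OF P]
  interpret Q: right_module D "quot_mod M P" by (rule rQ)
  obtain f where f: "f \<in> mod_hom D (quot_mod M P) X" "bij_betw f (carrier (quot_mod M P)) (carrier X)"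
    using iso by (auto simp: mod_iso_def)
  fix y assume y: "y \<in> part1 M"
  have q: "M.M.quot_proj P y \<in> carrier (quot_mod M P)"
    by (rule mod_hom_closed[OF M.M.quot_proj_hom[OF P] M.part_closed(2)[OF y]])
  have "f (M.M.quot_proj P y) \<in> part1 X"
    by (rule part_hom(2)[OF f(1) part_hom(2)[OF M.M.quot_proj_hom[OF P] y]])
  then have "f (M.M.quot_proj P y) = \<zero>\<^bsub>X\<^esub>" using X.part_Int X(2) X.part_closed(2) by blast
  then have "M.M.quot_proj P y = \<zero>\<^bsub>quot_mod M P\<^esub>"
    using Q.mod_hom_inj_iff[OF X(1) f(1)] f(2) q by (simp add: bij_betw_def del: quot_mod_simps)
  then show "y \<in> P" using M.M.quot_proj_ker[OF P M.part_closed(2)[OF y]] by simp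
qed

text \<open>Both \<open>P\<close> and \<open>P'\<close> contain the second part of
  \<open>M'\<close>, and so does their intersection; since \<open>P\<close> is generated by that
  part, the intersection is \<open>P\<close>. The splitting is \<open>full_splits\<close>.\<close>

lemma hall_mult_A0_full:
  assumes N1: "N1 \<in> fin_modules D" "part0 N1 = carrier N1" and N2: "N2 \<in> fin_modules D" "full N2"
    and M: "M \<in> fin_modules D" and M0: "right_module D M0" "mod_iso D M M0"
    and S: "splits_as D M0 T L" and T: "mod_iso D (sub_mod M0 T) N1" and L: "mod_iso D (sub_mod M0 L) N2"
  shows "hall_basis_mult D (iso_class D N1) (iso_class D N2) = frag_of (iso_class D M)"
proof (rule hall_basis_mult_split[OF ring_duplicated_algebra N1(1) N2(1) M M0 S T L])
  have facts: "part1 M' \<subseteq> P \<and> full (sub_mod M' P)"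
    if M': "M' \<in> fin_modules D" and P: "submodule P D M'" "mod_iso D (sub_mod M' P) N2" "mod_iso D (quot_mod M' P) N1"
    for M' P
  proof
    note rM' = fin_modulesD(1)[OF M']
    interpret M': dup_module K A M' by (rule dup_moduleI[OF rM'])
    show "part1 M' \<subseteq> P" by (rule part1_subset_of_quot_iso[OF rM' P(1) fin_modulesD(1)[OF N1(1)] N1(2) P(3)])
    note rP = M'.M.right_module_sub_mod[OF P(1)]
    show "full (sub_mod M' P)"
      by (rule full_iso[OF mod_iso_sym[OF P(2) rP] fin_modulesD(1)[OF N2(1)] rP N2(2)])
  qed
  show "P \<subseteq> P'" if M': "M' \<in> fin_modules D" and P: "submodule P D M'" and P': "submodule P' D M'"
    and iso: "mod_iso D (sub_mod M' P) N2" "mod_iso D (quot_mod M' P) N1"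
      "mod_iso D (sub_mod M' P') N2" "mod_iso D (quot_mod M' P') N1" for M' P P'
  proof -
    note rM' = fin_modulesD(1)[OF M']
    interpret M': dup_module K A M' by (rule dup_moduleI[OF rM'])
    note F = facts[OF M' P iso(1,2)] and F' = facts[OF M' P' iso(3,4)]
    have "submodule (P \<inter> P') D (sub_mod M' P)"
      using M'.M.submodule_Int[OF P P'] by (simp add: M'.M.submodule_sub_mod_iff[OF P])
    moreover have "part1 (sub_mod M' P) \<subseteq> P \<inter> P'"
      using F F' by (auto simp: part_sub_mod[OF M'.M.submoduleD(1)[OF P]])
    ultimately have "P \<inter> P' = carrier (sub_mod M' P)" using F by (intro fullD) auto
    then show ?thesis by auto
  qed
  show "\<exists>Q. splits_as D M' Q P" if M': "M' \<in> fin_modules D" and P: "submodule P D M'"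
    "mod_iso D (sub_mod M' P) N2" "mod_iso D (quot_mod M' P) N1" for M' P
  proof -
    interpret M': dup_module K A M' by (rule dup_moduleI[OF fin_modulesD(1)[OF M']])
    show ?thesis using M'.full_splits[OF fin_modulesD(2)[OF M'] P(1)] facts[OF M' P] by blast
  qed
qed

text \<open>The submodule is forced to be \<open>annihilated M'\<close>: all its elements are
  annihilated because \<open>N2\<close> is, and annihilated elements outside it would survive in the
  quotient, which has none besides zero. The splitting is \<open>annihilated_splits\<close>.\<close>

lemma hall_mult_annihilated:
  assumes N1: "N1 \<in> fin_modules D" "annihilated N1 = {\<zero>\<^bsub>N1\<^esub>}" and N2: "N2 \<in> fin_modules D" "annihilated N2 = carrier N2"
    and M: "M \<in> fin_modules D" and M0: "right_module D M0" "mod_iso D M M0"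
    and S: "splits_as D M0 T L" and T: "mod_iso D (sub_mod M0 T) N1" and L: "mod_iso D (sub_mod M0 L) N2"
  shows "hall_basis_mult D (iso_class D N1) (iso_class D N2) = frag_of (iso_class D M)"
proof (rule hall_basis_mult_split[OF ring_duplicated_algebra N1(1) N2(1) M M0 S T L])
  have eq: "P = annihilated M'"
    if M': "M' \<in> fin_modules D" and P: "submodule P D M'" "mod_iso D (sub_mod M' P) N2" "mod_iso D (quot_mod M' P) N1"
    for M' P
  proof
    note rM' = fin_modulesD(1)[OF M'] and rN1 = fin_modulesD(1)[OF N1(1)] and rN2 = fin_modulesD(1)[OF N2(1)]
    interpret M': dup_module K A M' by (rule dup_moduleI[OF rM'])
    note rP = M'.M.right_module_sub_mod[OF P(1)] and PM = M'.M.submoduleD(1)[OF P(1)]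
    obtain g where "g \<in> mod_hom D N2 (sub_mod M' P)" "g ` carrier N2 = carrier (sub_mod M' P)"
      using mod_iso_sym[OF P(2) rP] by (auto simp: mod_iso_def bij_betw_def)
    then have "annihilated (sub_mod M' P) = carrier (sub_mod M' P)"
      by (rule annihilated_surj[OF rN2 rP _ _ N2(2)])
    then show "P \<subseteq> annihilated M'" by (auto simp: part_sub_mod[OF PM])
    note rQ = M'.M.right_module_quot_mod[OF P(1)]
    have Q0: "annihilated (quot_mod M' P) = {\<zero>\<^bsub>quot_mod M' P\<^esub>}"
      by (rule annihilated_zero_iso[OF P(3) rQ rN1 N1(2)])
    show "annihilated M' \<subseteq> P"
    proof
      fix y assume y: "y \<in> annihilated M'"
      then have yM: "y \<in> carrier M'" by (rule M'.M.submoduleD(6)[OF M'.submodule_annihilated])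
      have "M'.M.quot_proj P y \<in> annihilated (quot_mod M' P)"
        by (rule annihilated_hom[OF rM' rQ M'.M.quot_proj_hom[OF P(1)] y])
      then show "y \<in> P" using Q0 M'.M.quot_proj_ker[OF P(1) yM] by simp
    qed
  qed
  show "P \<subseteq> P'" if M': "M' \<in> fin_modules D" and P: "submodule P D M'" and P': "submodule P' D M'"
    and iso: "mod_iso D (sub_mod M' P) N2" "mod_iso D (quot_mod M' P) N1"
      "mod_iso D (sub_mod M' P') N2" "mod_iso D (quot_mod M' P') N1" for M' P P'
    using eq[OF M' P iso(1,2)] eq[OF M' P' iso(3,4)] by simp
  show "\<exists>Q. splits_as D M' Q P" if M': "M' \<in> fin_modules D" and P: "submodule P D M'"
    "mod_iso D (sub_mod M' P) N2" "mod_iso D (quot_mod M' P) N1" for M' P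
  proof -
    interpret M': dup_module K A M' by (rule dup_moduleI[OF fin_modulesD(1)[OF M']])
    show ?thesis using M'.annihilated_splits[OF fin_modulesD(2)[OF M']] eq[OF M' P] by blast
  qed
qed

text \<open>The submodule generated by \<open>part1 M\<close>, as the intersection of all submodules
  containing it. It is full because a submodule of it that contains \<open>part1 M\<close> takes
  part in the intersection.\<close>

lemma ex_full_submodule:
  assumes M: "right_module D M"
  obtains L where "submodule L D M" "part1 M \<subseteq> L" "full (sub_mod M L)"
proof -
  interpret M: dup_module K A M by (rule dup_moduleI[OF M])
  define L where "L = \<Inter> {L. submodule L D M \<and> part1 M \<subseteq> L}"
  have mem: "x \<in> L \<longleftrightarrow> (\<forall>P. submodule P D M \<longrightarrow> part1 M \<subseteq> P \<longrightarrow> x \<in> P)" for x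
    by (auto simp: L_def)
  have L: "submodule L D M"
  proof (rule M.M.sub_moduleI)
    show "L \<subseteq> carrier M" using M.M.submodule_carrier M.part_sub by (auto simp: L_def)
  qed (simp_all add: mem M.M.submoduleD)
  moreover have sub: "part1 M \<subseteq> L" by (auto simp: mem)
  moreover have "full (sub_mod M L)"
    unfolding full_def
  proof (intro allI impI)
    fix P assume "submodule P D (sub_mod M L)" and p: "part1 (sub_mod M L) \<subseteq> P"
    then have P: "submodule P D M" "P \<subseteq> L" by (simp_all add: M.M.submodule_sub_mod_iff[OF L])
    have "part1 M \<subseteq> P" using p sub by (auto simp: part_sub_mod[OF M.M.submoduleD(1)[OF L]])
    then have "L \<subseteq> P" using P(1) by (auto simp: mem)
    then show "P = carrier (sub_mod M L)" using P(2) by simp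
  qed
  ultimately show ?thesis by (rule that)
qed

text \<open>The annihilated part is split off before the full submodule is formed: any submodule
  \<open>E\<close> of the complement \<open>T\<close> then has zero annihilated part, so fullness is
  all that is left to arrange for a mixed \<open>E\<close>.\<close>

lemma basis_factorization:
  assumes M: "M \<in> fin_modules D"
  obtains X E Z T where "X \<in> fin_modules D" "is_A0_module K A X" "E \<in> fin_modules D" "in_add D (A01_ind K A) E"
    "Z \<in> fin_modules D" "is_A1_module K A Z" "T \<in> fin_modules D"
    "hall_basis_mult D (iso_class D X) (iso_class D E) = frag_of (iso_class D T)"
    "hall_basis_mult D (iso_class D T) (iso_class D Z) = frag_of (iso_class D M)"
proof -
  note rM = fin_modulesD(1)[OF M] and finM = fin_modulesD(2)[OF M]
  interpret M: dup_module K A M by (rule dup_moduleI[OF rM])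
  obtain T where T: "splits_as D M T (annihilated M)" using M.annihilated_splits[OF finM] by blast
  note TS = M.M.splits_asD[OF T]
  note TM = M.M.submoduleD(1)[OF TS(1)] and ZM = M.M.submoduleD(1)[OF TS(2)]
  note rT = M.M.right_module_sub_mod[OF TS(1)] and rZ = M.M.right_module_sub_mod[OF TS(2)]
  have finT: "finite (carrier (sub_mod M T))" and finZ: "finite (carrier (sub_mod M (annihilated M)))"
    using finM TM ZM finite_subset by auto
  have annT: "annihilated (sub_mod M T) = {\<zero>\<^bsub>sub_mod M T\<^esub>}"
    unfolding part_sub_mod(3)[OF TM] sub_mod_simps
  proof (intro Set.equalityI subsetI)
    show "x \<in> {\<zero>\<^bsub>M\<^esub>}" if "x \<in> annihilated M \<inter> T" for x using TS(3)[of x] that by simp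
    show "x \<in> annihilated M \<inter> T" if "x \<in> {\<zero>\<^bsub>M\<^esub>}" for x
      using M.M.submoduleD(2)[OF TS(1)] M.M.submoduleD(2)[OF TS(2)] that by simp
  qed
  have annZ: "annihilated (sub_mod M (annihilated M)) = carrier (sub_mod M (annihilated M))"
    by (simp add: part_sub_mod[OF ZM])
  interpret T: dup_module K A "sub_mod M T" by (rule dup_moduleI[OF rT])
  obtain E where E: "submodule E D (sub_mod M T)" "part1 (sub_mod M T) \<subseteq> E" "full (sub_mod (sub_mod M T) E)"
    by (rule ex_full_submodule[OF rT])
  obtain X where X: "splits_as D (sub_mod M T) X E" "X \<subseteq> part0 (sub_mod M T)"
    using T.full_splits[OF finT E] by blast
  note XS = T.M.splits_asD[OF X(1)]
  note rX = T.M.right_module_sub_mod[OF XS(1)] and rE = T.M.right_module_sub_mod[OF XS(2)]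
  note XT = T.M.submoduleD(1)[OF XS(1)] and ET = T.M.submoduleD(1)[OF XS(2)]
  have finX: "finite (carrier (sub_mod (sub_mod M T) X))" and finE: "finite (carrier (sub_mod (sub_mod M T) E))"
    using finT XT ET finite_subset by auto
  have X0: "part0 (sub_mod (sub_mod M T) X) = carrier (sub_mod (sub_mod M T) X)"
    unfolding part_sub_mod(1)[OF XT] using X(2) by auto
  have "annihilated (sub_mod (sub_mod M T) E) = {\<zero>\<^bsub>sub_mod (sub_mod M T) E\<^esub>}"
    unfolding part_sub_mod(3)[OF ET] annT using T.M.submoduleD(2)[OF E(1)] by auto
  then have Emixed: "mixed (sub_mod (sub_mod M T) E)" using E(3) by (simp add: mixed_def)
  obtain X' where X': "X' \<in> fin_modules D" "mod_iso D X' (sub_mod (sub_mod M T) X)" by (rule ex_fin_module[OF rX finX])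
  obtain E' where E': "E' \<in> fin_modules D" "mod_iso D E' (sub_mod (sub_mod M T) E)" by (rule ex_fin_module[OF rE finE])
  obtain T' where T': "T' \<in> fin_modules D" "mod_iso D T' (sub_mod M T)" by (rule ex_fin_module[OF rT finT])
  obtain Z' where Z': "Z' \<in> fin_modules D" "mod_iso D Z' (sub_mod M (annihilated M))" by (rule ex_fin_module[OF rZ finZ])
  note rX' = fin_modulesD(1)[OF X'(1)] and rE' = fin_modulesD(1)[OF E'(1)]
    and rT' = fin_modulesD(1)[OF T'(1)] and rZ' = fin_modulesD(1)[OF Z'(1)]
  note isoX = mod_iso_sym[OF X'(2) rX'] and isoE = mod_iso_sym[OF E'(2) rE']
    and isoT = mod_iso_sym[OF T'(2) rT'] and isoZ = mod_iso_sym[OF Z'(2) rZ']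
  have X'0: "part0 X' = carrier X'"
  proof -
    obtain f where "f \<in> mod_hom D (sub_mod (sub_mod M T) X) X'" "f ` carrier (sub_mod (sub_mod M T) X) = carrier X'"
      using isoX unfolding mod_iso_def bij_betw_def by blast
    then show ?thesis by (rule part0_surj[OF _ _ X0])
  qed
  have Z'1: "annihilated Z' = carrier Z'"
  proof -
    obtain f where "f \<in> mod_hom D (sub_mod M (annihilated M)) Z'" "f ` carrier (sub_mod M (annihilated M)) = carrier Z'"
      using isoZ unfolding mod_iso_def bij_betw_def by blast
    then show ?thesis by (rule annihilated_surj[OF rZ rZ' _ _ annZ])
  qed
  have E'm: "mixed E'" by (rule mixed_iso[OF isoE rE rE' Emixed])
  have T'0: "annihilated T' = {\<zero>\<^bsub>T'\<^esub>}" by (rule annihilated_zero_iso[OF T'(2) rT' rT annT])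
  have "full E'" using E'm by (simp add: mixed_def)
  then have 1: "hall_basis_mult D (iso_class D X') (iso_class D E') = frag_of (iso_class D T')"
    using hall_mult_A0_full[OF X'(1) X'0 E'(1) _ T'(1) rT T'(2) X(1) isoX isoE] by blast
  have 2: "hall_basis_mult D (iso_class D T') (iso_class D Z') = frag_of (iso_class D M)"
    by (rule hall_mult_annihilated[OF T'(1) T'0 Z'(1) Z'1 M rM mod_iso_refl[OF rM] T isoT isoZ])
  show ?thesis
    by (rule that[OF X'(1) is_A0_moduleI[OF rX' fin_modulesD(2)[OF X'(1)] X'0] E'(1)
          mixed_in_add[OF rE' fin_modulesD(2)[OF E'(1)] E'm] Z'(1)
          is_A1_moduleI[OF rZ' fin_modulesD(2)[OF Z'(1)] Z'1] T'(1) 1 2])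
qed

end

section \<open>The Ringel-Hall algebra as a free abelian group\<close>

lemma hall_span_iff: "x \<in> hall_span R P \<longleftrightarrow> Poly_Mapping.keys x \<subseteq> iso_classes R P"
  by (simp add: hall_span_def)

lemma frag_of_hall_span: "M \<in> fin_modules R \<Longrightarrow> P M \<Longrightarrow> frag_of (iso_class R M) \<in> hall_span R P"
  by (simp add: hall_span_iff iso_classes_def)

text \<open>Products of basis elements are sums over isomorphism classes by definition, and
  \<open>frag_extend\<close> only forms combinations of them; hence \<open>x\<close> and
  \<open>y\<close> are arbitrary here.\<close>

lemma hall_algebra_mult_closed:
  "x \<otimes>\<^bsub>hall_algebra R\<^esub> y \<in> hall_span R (\<lambda>_. True)"
proof -
  have b: "Poly_Mapping.keys (hall_basis_mult R c d) \<subseteq> iso_classes R (\<lambda>_. True)" for c d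
  proof -
    have s: "Poly_Mapping.keys (\<Sum>i\<in>I. frag_cmul (int (g i)) (frag_of i)) \<subseteq> iso_classes R (\<lambda>_. True)"
      if "I \<subseteq> iso_classes R (\<lambda>_. True)" for I g
    proof -
      have "Poly_Mapping.keys (frag_cmul (int (g i)) (frag_of i)) \<subseteq> {i}" for i
        using keys_cmul[of "int (g i)" "frag_of i"] by simp
      then show ?thesis using keys_sum[of "\<lambda>i. frag_cmul (int (g i)) (frag_of i)" I] that by blast
    qed
    show ?thesis unfolding hall_basis_mult_def Let_def by (rule s) blast
  qed
  have *: "Poly_Mapping.keys (frag_extend f x) \<subseteq> iso_classes R (\<lambda>_. True)"
    if "\<And>c. Poly_Mapping.keys (f c) \<subseteq> iso_classes R (\<lambda>_. True)" for f x
    using keys_frag_extend[of f x] that by blast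
  show ?thesis
    unfolding hall_span_iff hall_algebra_def by (simp add: * b)
qed

lemma hall_algebra_simps [simp]:
  "carrier (hall_algebra R) = hall_span R (\<lambda>_. True)" "ring.add (hall_algebra R) = (+)" "ring.zero (hall_algebra R) = 0"
  by (simp_all add: hall_algebra_def)

text \<open>Identifies the group in which \<open>generate\<close> is taken with a free abelian
  group, for which \<open>frag_induction\<close> is at hand.\<close>

lemma add_monoid_hall_algebra:
  "add_monoid (hall_algebra R) = free_Abelian_group (iso_classes R (\<lambda>_. True))"
  by (simp add: hall_algebra_def hall_span_def free_Abelian_group_def)

theorem theorem3p1:
  fixes K :: "'k ring" and A :: "('k, 'a) module"
  assumes "fd_algebra K A"
    and "finite (carrier K)"
    and "tame_hereditary K A"
  shows "carrier (hall_algebra (duplicated_algebra K A)) =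
    generate (add_monoid (hall_algebra (duplicated_algebra K A)))
      {x \<otimes>\<^bsub>hall_algebra (duplicated_algebra K A)\<^esub> y \<otimes>\<^bsub>hall_algebra (duplicated_algebra K A)\<^esub> z | x y z.
        x \<in> hall_A0 K A \<and> y \<in> hall_A01 K A \<and> z \<in> hall_A1 K A}"
proof -
  interpret fd_algebra K A by fact
  interpret finite_hereditary K A
    using assms by unfold_locales (simp_all add: tame_hereditary_def)
  let ?H = "hall_algebra D" and ?I = "iso_classes D (\<lambda>_. True)"
  let ?P = "{x \<otimes>\<^bsub>?H\<^esub> y \<otimes>\<^bsub>?H\<^esub> z | x y z. x \<in> hall_A0 K A \<and> y \<in> hall_A01 K A \<and> z \<in> hall_A1 K A}"
  interpret G: group "free_Abelian_group ?I" by (rule group_free_Abelian_group)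
  have sub: "?P \<subseteq> carrier (free_Abelian_group ?I)"
    using hall_algebra_mult_closed by (force simp: hall_span_def)
  \<comment> \<open>A subgroup that contains the basis elements is everything; the difference case
    of \<open>frag_induction\<close> matches the subgroup property.\<close>
  have "x \<in> generate (free_Abelian_group ?I) ?P" if "Poly_Mapping.keys x \<subseteq> ?I" for x
    using that
  proof (induction x rule: frag_induction)
    case zero
    then show ?case using generate.one[of "free_Abelian_group ?I" ?P] by simp
  next
    case (one c)
    then obtain M where M: "M \<in> fin_modules D" "c = iso_class D M" by (auto simp: iso_classes_def)
    obtain X E Z T where "X \<in> fin_modules D" "is_A0_module K A X" "E \<in> fin_modules D" "in_add D (A01_ind K A) E"
      "Z \<in> fin_modules D" "is_A1_module K A Z" "T \<in> fin_modules D"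
      and mult: "hall_basis_mult D (iso_class D X) (iso_class D E) = frag_of (iso_class D T)"
      "hall_basis_mult D (iso_class D T) (iso_class D Z) = frag_of (iso_class D M)"
      by (rule basis_factorization[OF M(1)])
    then have mem: "frag_of (iso_class D X) \<in> hall_A0 K A" "frag_of (iso_class D E) \<in> hall_A01 K A"
      "frag_of (iso_class D Z) \<in> hall_A1 K A"
      by (simp_all add: hall_A0_def hall_A01_def hall_A1_def frag_of_hall_span)
    \<comment> \<open>On basis elements the bilinear extension reduces to
      \<open>hall_basis_mult\<close>, and both products consist of a single term with coefficient
      one, so the triple product is the basis element itself.\<close>
    have "frag_of c = frag_of (iso_class D X) \<otimes>\<^bsub>?H\<^esub> frag_of (iso_class D E) \<otimes>\<^bsub>?H\<^esub> frag_of (iso_class D Z)"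
      by (simp add: hall_algebra_def frag_extend_def M(2) mult)
    then have "frag_of c \<in> ?P" using mem by blast
    then show ?case by (rule generate.incl)
  next
    case (diff a b)
    note * = G.generate_is_subgroup[OF sub]
    have b: "Poly_Mapping.keys b \<subseteq> ?I" using G.generate_in_carrier[OF sub diff(2)] by simp
    have "a \<otimes>\<^bsub>free_Abelian_group ?I\<^esub> inv\<^bsub>free_Abelian_group ?I\<^esub> b \<in> generate (free_Abelian_group ?I) ?P"
      using subgroup.m_closed[OF *] subgroup.m_inv_closed[OF *] diff by blast
    then show ?case using b by simp
  qed
  then show ?thesis
    unfolding add_monoid_hall_algebra using G.generate_in_carrier[OF sub]
    by (auto simp: hall_span_iff)
qed

end
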